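(* Let $\Pi$ be a Boolean MDDLog program of diameter $k$. Then (1) if $\Pi$ is FO-rewritable, then it has a UCQ-rewriting in which each CQ has treewidth $(1,k)$; (2) if $\Pi$ is MDLog-rewritable, then it has an MDLog-rewriting of diameter $k$.
   Context: Instances are finite sets of facts over a schema. A Boolean MDDLog program over EDB schema $\mathbf{S}_E$ is a finite set of rules $S_1(\mathbf{x}_1)\vee\dots\vee S_m(\mathbf{x}_m)\leftarrow R_1(\mathbf{y}_1)\wedge\dots\wedge R_n(\mathbf{y}_n)$ ($n>0$, $m\ge0$, head variables occur in the body) with a distinguished nullary relation $\mathrm{goal}$ not occurring in bodies and only in rules with head $\mathrm{goal}()$, where relations occurring in heads (IDB) other than $\mathrm{goal}$ have arity $\le 1$ and other relations are in $\mathbf{S}_E$; $I\models\Pi$ iff $\Pi\cup I\models\mathrm{goal}()$. MDLog programs are MDDLog programs whose rule heads have exactly one atom. The diameter of a program is the maximum number of variables in a rule. A Boolean query $q$ is a rewriting of $\Pi$ if for all $\mathbf{S}_E$-instances $I$, $I\models q$ iff $I\models\Pi$; FO-rewritings are first-order sentences over $\mathbf{S}_E$ with equality and without constants; UCQ-rewritings are unions of Boolean conjunctive queries. A tree decomposition of an instance $I$ is a pair $(T,(B_v)_{v\in V})$ with $T=(V,E)$ an undirected tree and $B_v\subseteq\mathrm{adom}(I)$ such that for every $a\in\mathrm{adom}(I)$ the set $\{v\mid a\in B_v\}$ is nonempty and connected, and every fact of $I$ has all its constants in some $B_v$; it is an $(\ell,k)$-tree decomposition if $|B_v\cap B_{v'}|\le\ell$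 for all distinct $v,v'$ and $|B_v|\le k$ for all $v$. An instance has treewidth $(\ell,k)$ if it has an $(\ell,k)$-tree decomposition; a CQ has treewidth $(\ell,k)$ if the instance obtained from its atoms (variables as constants) does. *)

theory Defs
  imports Main
begin

section \<open>Basic syntax\<close>

text \<open>A relation symbol is a pair (name, arity). Constants and variables are natural numbers.
  An atom is a relation symbol with a list of variables; a fact is a relation symbol with a
  list of constants.\<close>

type_synonym rel = "nat \<times> nat"
type_synonym atom = "rel \<times> nat list"
type_synonym fact = "rel \<times> nat list"
type_synonym rule = "atom list \<times> atom list"  \<comment> \<open>(head atoms, body atoms)\<close>

definition instance_over :: "rel set \<Rightarrow> fact set \<Rightarrow> bool" where
  "instance_over SE I \<longleftrightarrow> finite I \<and> (\<forall>(R, cs) \<in> I. R \<in> SE \<and> length cs = snd R)"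

definition adom :: "fact set \<Rightarrow> nat set" where
  "adom I = (\<Union>f \<in> I. set (snd f))"

section \<open>MDDLog programs\<close>

definition rule_vars :: "rule \<Rightarrow> nat set" where
  "rule_vars r = (\<Union>a \<in> set (fst r) \<union> set (snd r). set (snd a))"

definition idb_rels :: "rule set \<Rightarrow> rel set" where
  "idb_rels P = {fst a | a r. r \<in> P \<and> a \<in> set (fst r)}"

definition mddlog_program :: "rel set \<Rightarrow> rel \<Rightarrow> rule set \<Rightarrow> bool" where
  "mddlog_program SE g P \<longleftrightarrow>
     finite P \<and> snd g = 0 \<and> g \<notin> SE \<and>
     (\<forall>r \<in> P.
        snd r \<noteq> [] \<and>
        (\<forall>a \<in> set (fst r) \<union> set (snd r). length (snd a) = snd (fst a)) \<and>
        (\<Union>a \<in> set (fst r). set (snd a)) \<subseteq> (\<Union>a \<in> set (snd r). set (snd a)) \<and>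
        (\<forall>a \<in> set (snd r). fst a \<noteq> g) \<and>
        (\<forall>a \<in> set (fst r). fst a = g \<longrightarrow> fst r = [(g, [])]) \<and>
        (\<forall>a \<in> set (fst r). fst a \<noteq> g \<longrightarrow> fst a \<notin> SE \<and> snd (fst a) \<le> 1) \<and>
        (\<forall>a \<in> set (snd r). fst a \<notin> idb_rels P \<longrightarrow> fst a \<in> SE))"

definition mdlog_program :: "rel set \<Rightarrow> rel \<Rightarrow> rule set \<Rightarrow> bool" where
  "mdlog_program SE g P \<longleftrightarrow> mddlog_program SE g P \<and> (\<forall>r \<in> P. length (fst r) = 1)"

definition diameter :: "rule set \<Rightarrow> nat" where
  "diameter P = Max ({card (rule_vars r) | r. r \<in> P} \<union> {0})"

text \<open>J is a model of the rules of P (J an arbitrary set of facts).\<close>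
definition is_model :: "rule set \<Rightarrow> fact set \<Rightarrow> bool" where
  "is_model P J \<longleftrightarrow>
     (\<forall>r \<in> P. \<forall>h :: nat \<Rightarrow> nat.
        (\<forall>(R, xs) \<in> set (snd r). (R, map h xs) \<in> J) \<longrightarrow>
        (\<exists>(R, xs) \<in> set (fst r). (R, map h xs) \<in> J))"

text \<open>I |= P iff P \<union> I entails goal().\<close>
definition entails :: "fact set \<Rightarrow> rel \<Rightarrow> rule set \<Rightarrow> bool" where
  "entails I g P \<longleftrightarrow> (\<forall>J. I \<subseteq> J \<and> is_model P J \<longrightarrow> (g, []) \<in> J)"

definition is_rewriting :: "rel set \<Rightarrow> rel \<Rightarrow> rule set \<Rightarrow> (fact set \<Rightarrow> bool) \<Rightarrow> bool" where
  "is_rewriting SE g P q \<longleftrightarrow> (\<forall>I. instance_over SE I \<longrightarrow> (q I \<longleftrightarrow> entails I g P))"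

section \<open>First-order sentences (with equality, no constants)\<close>

datatype fo = FAtom rel "nat list" | FEq nat nat | FNeg fo | FConj fo fo | FEx nat fo

fun fo_fv :: "fo \<Rightarrow> nat set" where
  "fo_fv (FAtom R xs) = set xs"
| "fo_fv (FEq x y) = {x, y}"
| "fo_fv (FNeg \<phi>) = fo_fv \<phi>"
| "fo_fv (FConj \<phi> \<psi>) = fo_fv \<phi> \<union> fo_fv \<psi>"
| "fo_fv (FEx x \<phi>) = fo_fv \<phi> - {x}"

fun fo_over :: "rel set \<Rightarrow> fo \<Rightarrow> bool" where
  "fo_over SE (FAtom R xs) \<longleftrightarrow> R \<in> SE \<and> length xs = snd R"
| "fo_over SE (FEq x y) \<longleftrightarrow> True"
| "fo_over SE (FNeg \<phi>) \<longleftrightarrow> fo_over SE \<phi>"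
| "fo_over SE (FConj \<phi> \<psi>) \<longleftrightarrow> fo_over SE \<phi> \<and> fo_over SE \<psi>"
| "fo_over SE (FEx x \<phi>) \<longleftrightarrow> fo_over SE \<phi>"

text \<open>Satisfaction in the finite structure with domain adom(I).\<close>
fun fo_sat :: "fact set \<Rightarrow> (nat \<Rightarrow> nat) \<Rightarrow> fo \<Rightarrow> bool" where
  "fo_sat I v (FAtom R xs) \<longleftrightarrow> (R, map v xs) \<in> I"
| "fo_sat I v (FEq x y) \<longleftrightarrow> v x = v y"
| "fo_sat I v (FNeg \<phi>) \<longleftrightarrow> \<not> fo_sat I v \<phi>"
| "fo_sat I v (FConj \<phi> \<psi>) \<longleftrightarrow> fo_sat I v \<phi> \<and> fo_sat I v \<psi>"
| "fo_sat I v (FEx x \<phi>) \<longleftrightarrow> (\<exists>a \<in> adom I. fo_sat I (v(x := a)) \<phi>)"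

definition fo_rewritable :: "rel set \<Rightarrow> rel \<Rightarrow> rule set \<Rightarrow> bool" where
  "fo_rewritable SE g P \<longleftrightarrow>
     (\<exists>\<phi>. fo_over SE \<phi> \<and> fo_fv \<phi> = {} \<and> is_rewriting SE g P (\<lambda>I. fo_sat I (\<lambda>_. 0) \<phi>))"

section \<open>(U)CQs\<close>

text \<open>A Boolean CQ is a finite set of atoms (all variables existentially quantified).\<close>
definition cq_over :: "rel set \<Rightarrow> atom set \<Rightarrow> bool" where
  "cq_over SE q \<longleftrightarrow> finite q \<and> (\<forall>(R, xs) \<in> q. R \<in> SE \<and> length xs = snd R)"

definition cq_sat :: "fact set \<Rightarrow> atom set \<Rightarrow> bool" where
  "cq_sat I q \<longleftrightarrow> (\<exists>h :: nat \<Rightarrow> nat. \<forall>(R, xs) \<in> q. (R, map h xs) \<in> I)"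

definition ucq_sat :: "fact set \<Rightarrow> atom set set \<Rightarrow> bool" where
  "ucq_sat I Q \<longleftrightarrow> (\<exists>q \<in> Q. cq_sat I q)"

definition ucq_rewriting :: "rel set \<Rightarrow> rel \<Rightarrow> rule set \<Rightarrow> atom set set \<Rightarrow> bool" where
  "ucq_rewriting SE g P Q \<longleftrightarrow>
     finite Q \<and> (\<forall>q \<in> Q. cq_over SE q) \<and> is_rewriting SE g P (\<lambda>I. ucq_sat I Q)"

definition mdlog_rewritable :: "rel set \<Rightarrow> rel \<Rightarrow> rule set \<Rightarrow> bool" where
  "mdlog_rewritable SE g P \<longleftrightarrow>
     (\<exists>g' P'. mdlog_program SE g' P' \<and> is_rewriting SE g P (\<lambda>I. entails I g' P'))"

section \<open>Tree decompositions\<close>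

definition connected_in :: "nat set \<Rightarrow> (nat \<times> nat) set \<Rightarrow> bool" where
  "connected_in V E \<longleftrightarrow> (\<forall>u \<in> V. \<forall>w \<in> V. (u, w) \<in> (E \<inter> (V \<times> V))\<^sup>*)"

definition has_cycle :: "nat set \<Rightarrow> (nat \<times> nat) set \<Rightarrow> bool" where
  "has_cycle V E \<longleftrightarrow> (\<exists>cs. length cs \<ge> 3 \<and> distinct cs \<and> set cs \<subseteq> V \<and>
      (\<forall>i < length cs. (cs ! i, cs ! ((i + 1) mod length cs)) \<in> E))"

text \<open>Undirected tree: symmetric irreflexive edge relation, nonempty, connected, acyclic.\<close>
definition is_tree :: "nat set \<Rightarrow> (nat \<times> nat) set \<Rightarrow> bool" where
  "is_tree V E \<longleftrightarrow> V \<noteq> {} \<and> E \<subseteq> V \<times> V \<and> sym E \<and> (\<forall>v. (v, v) \<notin> E) \<and>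
     connected_in V E \<and> \<not> has_cycle V E"

definition tree_decomposition ::
  "fact set \<Rightarrow> nat set \<Rightarrow> (nat \<times> nat) set \<Rightarrow> (nat \<Rightarrow> nat set) \<Rightarrow> bool" where
  "tree_decomposition I V E B \<longleftrightarrow> is_tree V E \<and> (\<forall>v \<in> V. B v \<subseteq> adom I) \<and>
     (\<forall>a \<in> adom I. {v \<in> V. a \<in> B v} \<noteq> {} \<and> connected_in {v \<in> V. a \<in> B v} E) \<and>
     (\<forall>f \<in> I. \<exists>v \<in> V. set (snd f) \<subseteq> B v)"

definition lk_tree_decomposition ::
  "nat \<Rightarrow> nat \<Rightarrow> fact set \<Rightarrow> nat set \<Rightarrow> (nat \<times> nat) set \<Rightarrow> (nat \<Rightarrow> nat set) \<Rightarrow> bool" where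
  "lk_tree_decomposition l k I V E B \<longleftrightarrow> tree_decomposition I V E B \<and>
     (\<forall>v \<in> V. \<forall>v' \<in> V. v \<noteq> v' \<longrightarrow> card (B v \<inter> B v') \<le> l) \<and>
     (\<forall>v \<in> V. card (B v) \<le> k)"

text \<open>Treewidth (l,k); for a CQ, apply it to the atom set itself (variables as constants).\<close>
definition has_treewidth :: "nat \<Rightarrow> nat \<Rightarrow> fact set \<Rightarrow> bool" where
  "has_treewidth l k I \<longleftrightarrow> (\<exists>V E B. lk_tree_decomposition l k I V E B)"

end

(* An instance I satisfying P has a homomorphic preimage I' satisfying P that is covered by blocks of at
   most k vertices any n of which form a hyperforest: blow up I so that every coloring of I' by sets of
   IDB relations restricts to a coloring of I on blocks of each type. Such a sparse preimage comes from
   the partite amalgamation of Nesetril and Rodl, without a probabilistic argument. Small subinstances of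
   I' have treewidth (1,k).

   (1) Let R be the radius given by the quantifier rank of a first-order rewriting. By Hanf's argument I'
   together with many copies of its R-balls is indistinguishable from the copies of the balls alone, so
   the latter satisfy P. The balls of I' are trees of blocks, hence they map homomorphically to a
   subinstance of I' of bounded size; no preservation theorem is needed.

   (2) Take all rules with at most k variables that are sound for the given rewriting, over labels naming
   queries of one block whose atoms may use labels of lower level. On I' every match of a rule body of the
   given program is covered by a forest of blocks, which these rules evaluate from the leaves. *)

theory Submission
  imports Defs "HOL-Library.Nat_Bijection" "HOL-Library.Countable"
begin

section \<open>Acyclic families of blocks\<close>

text \<open>The body of a rule may be spread over several facts, so blocks stand for arbitrary sets
  of at most \<open>k\<close> constants of \<open>I\<close>: every match of a rule over a colored
  \<open>I\<close> then lifts into a single block of \<open>I'\<close>.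

  In (1) the order of choices matters. The size of the folded subinstance must be bounded in terms
  of the schema, \<open>k\<close> and the radius alone, because the local acyclicity demanded of
  \<open>I'\<close> is fixed only after this bound. The bound therefore counts iterated types of
  vertices, of which there are finitely many at each depth. A ball can be folded along such types
  block by block: two overlaps of a block with the part already mapped would close a short cycle.

  In (2) the obstacle is that a label may have at most one argument. Acyclicity removes it, since
  all that hangs off a block is attached at one vertex and can be summarized there. Every further
  block consumes one level of labels, so the body lengths of the given rewriting determine the
  number of levels.\<close>

definition at_most_one :: "'a set \<Rightarrow> bool" where
  "at_most_one S \<longleftrightarrow> (\<forall>x y. x \<in> S \<longrightarrow> y \<in> S \<longrightarrow> x = y)"

lemma at_most_one_subset: "at_most_one T \<Longrightarrow> S \<subseteq> T \<Longrightarrow> at_most_one S"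
  unfolding at_most_one_def by blast

lemma at_most_one_image: "at_most_one S \<Longrightarrow> at_most_one (f ` S)"
  unfolding at_most_one_def by blast

lemma at_most_one_card: "at_most_one S \<Longrightarrow> finite S \<and> card S \<le> 1"
  unfolding at_most_one_def
  by (metis card.empty card_1_singleton_iff equals0I finite.emptyI finite_insert insertCI is_singletonI' is_singleton_def le_numeral_extra(4) zero_le_one One_nat_def)

text \<open>No step closes a cycle in the incidence graph of blocks and vertices. A new block may
  also miss all old ones, so disconnected families are covered.\<close>

inductive grows :: "'a set \<Rightarrow> 'a set set \<Rightarrow> bool" for e where
  base: "grows e {e}"
| step: "grows e F \<Longrightarrow> f \<notin> F \<Longrightarrow> at_most_one (f \<inter> \<Union>F) \<Longrightarrow> grows e (insert f F)"

text \<open>Berge acyclicity of a finite family. Every block has to be a possible root: gluing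
  starts at the block that holds the shared vertex, and rule evaluation in (2) at the block that
  holds the head.\<close>

definition forest :: "'a set set \<Rightarrow> bool" where
  "forest F \<longleftrightarrow> (\<forall>e\<in>F. grows e F)"

text \<open>A girth condition: no Berge cycle runs through at most \<open>n\<close> blocks.\<close>

definition locally_forest :: "nat \<Rightarrow> 'a set set \<Rightarrow> bool" where
  "locally_forest n B \<longleftrightarrow> (\<forall>F \<subseteq> B. finite F \<and> card F \<le> n \<longrightarrow> forest F)"

lemma grows_mem: "grows e F \<Longrightarrow> e \<in> F"
  by (induction rule: grows.induct) auto

lemma grows_finite: "grows e F \<Longrightarrow> finite F"
  by (induction rule: grows.induct) auto

lemma forest_empty: "forest {}"
  by (simp add: forest_def)

text \<open>The overlap of the families sits in \<open>f\<close>, so \<open>f\<close> attaches to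
  \<open>A\<close> in at most one vertex. A later block of \<open>B\<close> meets \<open>A\<close>
  only inside \<open>f\<close>, hence \<open>A\<close> does not enlarge its attachment.\<close>

lemma grows_union_grows:
  assumes "grows f B" "grows e A"
    "A \<inter> B = {}" "\<Union>A \<inter> \<Union>B \<subseteq> f" "at_most_one (\<Union>A \<inter> \<Union>B)"
  shows "grows e (A \<union> B)"
  using assms
proof (induction rule: grows.induct)
  case base
  have "grows e (insert f A)"
    by (rule grows.step) (use base in \<open>auto simp: Int_commute\<close>)
  then show ?case by simp
next
  case (step F f')
  have f: "f \<in> F" using grows_mem[OF step.hyps(1)] .
  have IH: "grows e (A \<union> F)"
    by (rule step.IH) (use step.prems in \<open>auto intro: at_most_one_subset\<close>)
  have "f' \<inter> \<Union>(A \<union> F) \<subseteq> f' \<inter> \<Union>F"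
    using step.prems f by blast
  then have "at_most_one (f' \<inter> \<Union>(A \<union> F))"
    using step.hyps(3) at_most_one_subset by blast
  moreover have "f' \<notin> A \<union> F" using step.hyps(2) step.prems by auto
  ultimately have "grows e (insert f' (A \<union> F))" using IH by (intro grows.step)
  then show ?case by simp
qed

lemma grows_union:
  assumes "grows e A" "forest B" "A \<inter> B = {}" "at_most_one (\<Union>A \<inter> \<Union>B)"
  shows "grows e (A \<union> B)"
proof (cases "B = {}")
  case False
  obtain f where f: "f \<in> B" "\<Union>A \<inter> \<Union>B \<subseteq> f"
  proof (cases "\<Union>A \<inter> \<Union>B = {}")
    case True
    then show ?thesis using that False by blast
  next
    case False
    then obtain z f where "z \<in> \<Union>A" "z \<in> f" "f \<in> B" by blast
    then have "\<Union>A \<inter> \<Union>B \<subseteq> f" using assms(4) unfolding at_most_one_def by blast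
    then show ?thesis using that \<open>f \<in> B\<close> by blast
  qed
  then have "grows f B" using assms(2) by (simp add: forest_def)
  then show ?thesis using grows_union_grows assms f by blast
qed (use assms in simp)

lemma forest_union:
  assumes "forest A" "forest B" "A \<inter> B = {}" "at_most_one (\<Union>A \<inter> \<Union>B)"
  shows "forest (A \<union> B)"
  unfolding forest_def
proof
  fix e assume "e \<in> A \<union> B"
  then consider "e \<in> A" | "e \<in> B" by blast
  then show "grows e (A \<union> B)"
  proof cases
    case 1
    then have "grows e A" using assms(1) by (simp add: forest_def)
    then show ?thesis using assms by (intro grows_union)
  next
    case 2
    then have "grows e (B \<union> A)"
      using assms by (intro grows_union) (auto simp: forest_def Int_commute)
    then show ?thesis by (simp add: Un_commute)
  qed
qed

lemma forest_singleton: "forest {e}"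
  by (simp add: forest_def grows.base)

lemma forest_insert:
  assumes "forest A" "f \<notin> A" "at_most_one (f \<inter> \<Union>A)"
  shows "forest (insert f A)"
  using forest_union[OF assms(1) forest_singleton[of f]] assms by (simp add: Int_commute)

lemma forest_if_all_leaves:
  assumes "finite F" "\<And>f. f \<in> F \<Longrightarrow> at_most_one (f \<inter> \<Union>(F - {f}))"
  shows "forest F"
  using assms
proof (induction rule: finite_induct)
  case empty
  show ?case by (rule forest_empty)
next
  case (insert f F)
  have "forest F"
  proof (rule insert.IH)
    fix f' assume "f' \<in> F"
    then show "at_most_one (f' \<inter> \<Union>(F - {f'}))"
      using insert.prems[of f'] by (rule_tac at_most_one_subset) auto
  qed
  moreover have "at_most_one (f \<inter> \<Union>F)"
    using insert.prems[of f] insert.hyps by (simp add: insert_Diff_if)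
  ultimately show ?case using forest_insert insert.hyps by blast
qed

lemma grows_image:
  assumes "grows e F" "inj_on \<phi> (\<Union>F)"
  shows "grows (\<phi> ` e) ((`) \<phi> ` F)"
  using assms
proof (induction rule: grows.induct)
  case base
  then show ?case by (simp add: grows.base)
next
  case (step F f)
  have IH: "grows (\<phi> ` e) ((`) \<phi> ` F)"
    using step by (meson inj_on_subset Sup_subset_mono subset_insertI)
  have "\<phi> ` f \<inter> \<Union>((`) \<phi> ` F) = \<phi> ` (f \<inter> \<Union>F)"
    using step.prems by (simp add: inj_on_image_Int[of _ "\<Union>(insert f F)"] image_Union)
  moreover have "\<phi> ` f \<notin> (`) \<phi> ` F"
  proof
    assume "\<phi> ` f \<in> (`) \<phi> ` F"
    then obtain f' where "f' \<in> F" "\<phi> ` f = \<phi> ` f'" by blast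
    then have "f = f'" using step.prems
      by (subst (asm) inj_on_image_eq_iff[of _ "\<Union>(insert f F)"]) auto
    then show False using \<open>f' \<in> F\<close> step.hyps by simp
  qed
  moreover have "at_most_one (\<phi> ` (f \<inter> \<Union>F))" by (rule at_most_one_image[OF step.hyps(3)])
  ultimately show ?case
    using IH grows.step[of "\<phi> ` e" "(`) \<phi> ` F" "\<phi> ` f"] by simp
qed

lemma forest_image:
  assumes "forest F" "inj_on \<phi> (\<Union>F)"
  shows "forest ((`) \<phi> ` F)"
  using assms grows_image unfolding forest_def by blast

text \<open>A new block reuses at most one old vertex. The sum is over integers because an empty
  block contributes -1.\<close>

lemma grows_card:
  assumes "grows e F" "\<And>f. f \<in> F \<Longrightarrow> finite f"
  shows "(\<Sum>f\<in>F. int (card f) - 1) + 1 \<le> int (card (\<Union>F))"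
  using assms
proof (induction rule: grows.induct)
  case (step F f)
  have fin: "finite F" using grows_finite[OF step.hyps(1)] .
  have finU: "finite (\<Union>F)" using fin step.prems by auto
  have "card (f \<inter> \<Union>F) \<le> 1" using at_most_one_card[OF step.hyps(3)] by simp
  moreover have "card (f \<union> \<Union>F) + card (f \<inter> \<Union>F) = card f + card (\<Union>F)"
    using card_Un_Int[of f "\<Union>F"] finU step.prems by simp
  moreover have "(\<Sum>f\<in>F. int (card f) - 1) + 1 \<le> int (card (\<Union>F))"
    using step by auto
  ultimately show ?case using step.hyps fin by simp
qed simp

lemma locally_forest_mono:
  "locally_forest n B \<Longrightarrow> m \<le> n \<Longrightarrow> locally_forest m B"
  unfolding locally_forest_def by auto

section \<open>Color-critical partite systems of large girth\<close>

lemma pigeonhole_subset: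
  assumes "finite K" "c ` A \<subseteq> K" "finite A" "card A > (r - 1) * card K"
  shows "\<exists>S \<kappa>. S \<subseteq> A \<and> card S = r \<and> (\<forall>a\<in>S. c a = \<kappa>)"
proof (rule ccontr)
  assume neg: "\<not> ?thesis"
  have small: "card {a\<in>A. c a = \<kappa>} \<le> r - 1" for \<kappa>
  proof (rule ccontr)
    assume "\<not> ?thesis"
    then have "r \<le> card {a\<in>A. c a = \<kappa>}" by simp
    then obtain S where S: "S \<subseteq> {a\<in>A. c a = \<kappa>}" "card S = r"
      using obtain_subset_with_card_n by metis
    have "S \<subseteq> A \<and> card S = r \<and> (\<forall>a\<in>S. c a = \<kappa>)" using S by auto
    then have "\<exists>S \<kappa>. S \<subseteq> A \<and> card S = r \<and> (\<forall>a\<in>S. c a = \<kappa>)" by (intro exI)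
    then show False using neg by contradiction
  qed
  have "A = (\<Union>\<kappa>\<in>K. {a\<in>A. c a = \<kappa>})" using assms by auto
  then have "card A \<le> (\<Sum>\<kappa>\<in>K. card {a\<in>A. c a = \<kappa>})"
    using card_UN_le[OF assms(1), of "\<lambda>\<kappa>. {a\<in>A. c a = \<kappa>}"] by simp
  also have "\<dots> \<le> (\<Sum>\<kappa>\<in>K. r - 1)" by (rule sum_mono) (rule small)
  finally show False using assms by (simp add: mult.commute)
qed

text \<open>The last clause excludes a proper coloring with palette \<open>K\<close>.\<close>

definition critical_hypergraph :: "'c set \<Rightarrow> nat \<Rightarrow> nat \<Rightarrow> nat set set \<Rightarrow> bool" where
  "critical_hypergraph K r n H \<longleftrightarrow> finite H \<and> (\<forall>h\<in>H. finite h \<and> card h = r) \<and> locally_forest n H \<and>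
     (\<forall>\<chi> :: nat \<Rightarrow> 'c. range \<chi> \<subseteq> K \<longrightarrow> (\<exists>h\<in>H. \<exists>\<kappa>. \<forall>v\<in>h. \<chi> v = \<kappa>))"

definition partite_system ::
  "nat set set \<Rightarrow> nat \<Rightarrow> nat set set \<Rightarrow> (nat \<Rightarrow> nat) \<Rightarrow> bool" where
  "partite_system \<S> n B \<pi> \<longleftrightarrow> finite B \<and> locally_forest n B \<and>
     (\<forall>e\<in>B. finite e \<and> inj_on \<pi> e \<and> \<pi> ` e \<in> \<S>)"

text \<open>\<open>D\<close> holds the parts already amalgamated. One \<open>c\<close> serves all
  \<open>S\<close> at once; this is what allows a coloring of \<open>I\<close> to be read off from a
  coloring of its preimage.\<close>

definition monochromatic_parts ::
  "'c set \<Rightarrow> nat set set \<Rightarrow> nat set \<Rightarrow> nat set set \<Rightarrow> (nat \<Rightarrow> nat) \<Rightarrow> bool" where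
  "monochromatic_parts K \<S> D B \<pi> \<longleftrightarrow>
     (\<forall>\<chi> :: nat \<Rightarrow> 'c. range \<chi> \<subseteq> K \<longrightarrow>
        (\<exists>c. range c \<subseteq> K \<and> (\<forall>S\<in>\<S>. \<exists>e\<in>B. \<pi> ` e = S \<and> (\<forall>v\<in>e. \<pi> v \<in> D \<longrightarrow> \<chi> v = c (\<pi> v)))))"

text \<open>Vertex map of the copy indexed by the hyperedge \<open>h\<close>: the part
  \<open>X\<close> is identified with \<open>h\<close> along \<open>\<beta>\<close>, every other
  vertex is tagged with a code of \<open>h\<close>. As \<open>set_encode\<close> separates only
  finite sets, \<open>glue_meet\<close> asks for finiteness.\<close>

definition glue :: "nat set \<Rightarrow> (nat \<Rightarrow> nat) \<Rightarrow> nat set \<Rightarrow> nat \<Rightarrow> nat" where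
  "glue X \<beta> h v = (if v \<in> X then sum_encode (Inl (\<beta> v))
                    else sum_encode (Inr (prod_encode (set_encode h, v))))"

definition glue_part :: "nat \<Rightarrow> (nat \<Rightarrow> nat) \<Rightarrow> nat \<Rightarrow> nat" where
  "glue_part a \<pi> w = (case sum_decode w of Inl _ \<Rightarrow> a | Inr p \<Rightarrow> \<pi> (snd (prod_decode p)))"

lemma glue_part_glue: "(v \<in> X \<Longrightarrow> \<pi> v = a) \<Longrightarrow> glue_part a \<pi> (glue X \<beta> h v) = \<pi> v"
  by (simp add: glue_def glue_part_def)

lemma glue_inj: "inj_on \<beta> X \<Longrightarrow> inj (glue X \<beta> h)"
  unfolding inj_def glue_def by (auto dest: inj_onD simp: sum_encode_eq prod_encode_eq)

lemma glue_meet: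
  assumes "glue X \<beta> h v = glue X \<beta>' h' v'" "h \<noteq> h'" "finite h" "finite h'"
  shows "v \<in> X \<and> v' \<in> X \<and> \<beta> v = \<beta>' v'"
  using assms by (auto simp: glue_def set_encode_eq sum_encode_eq prod_encode_eq split: if_splits)

text \<open>A family of \<open>n + 1\<close> blocks that lie in \<open>n + 1\<close> different copies is acyclic because each block
  has at most one vertex in the amalgamated part; a family meeting at most \<open>n\<close> copies
  inherits acyclicity from the \<open>n\<close>-locally acyclic hypergraph \<open>H\<close> that indexes the copies.\<close>

lemma amalgamation:
  assumes G: "partite_system \<S> (Suc n) G \<pi>" and mono: "monochromatic_parts K \<S> D G \<pi>"
    and H: "critical_hypergraph K (card {v\<in>\<Union>G. \<pi> v = a}) n H"
  shows "\<exists>G' \<pi>'. partite_system \<S> (Suc n) G' \<pi>' \<and> monochromatic_parts K \<S> (insert a D) G' \<pi>'"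
proof -
  define X where "X = {v\<in>\<Union>G. \<pi> v = a}"
  have finX: "finite X" using G by (auto simp: X_def partite_system_def)
  have finH: "finite h" if "h \<in> H" for h using H that by (auto simp: critical_hypergraph_def)
  have "\<exists>\<beta>. bij_betw \<beta> X h" if "h \<in> H" for h
    using H that finX by (intro finite_same_card_bij) (auto simp: critical_hypergraph_def X_def)
  then obtain \<beta> where \<beta>: "\<And>h. h \<in> H \<Longrightarrow> bij_betw (\<beta> h) X h" by metis
  define \<phi> where "\<phi> = (\<lambda>h. glue X (\<beta> h) h)"
  define \<pi>' where "\<pi>' = glue_part a \<pi>"
  define G' where "G' = (\<Union>h\<in>H. (`) (\<phi> h) ` G)"
  have \<pi>\<phi>: "\<pi>' (\<phi> h v) = \<pi> v" for h v
    unfolding \<pi>'_def \<phi>_def by (rule glue_part_glue) (simp add: X_def)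
  have inj: "inj (\<phi> h)" if "h \<in> H" for h
    unfolding \<phi>_def using \<beta>[OF that] by (intro glue_inj) (simp add: bij_betw_def)
  have meet: "v \<in> X \<and> v' \<in> X \<and> \<beta> h v = \<beta> h' v'"
    if "\<phi> h v = \<phi> h' v'" "h \<noteq> h'" "h \<in> H" "h' \<in> H" for h h' v v'
    using glue_meet that finH unfolding \<phi>_def by metis
  have loc: "forest F" if F: "F \<subseteq> G'" "finite F" "card F \<le> Suc n" for F
  proof -
    have "\<forall>f\<in>F. \<exists>h\<in>H. \<exists>e\<in>G. f = \<phi> h ` e" using F unfolding G'_def by blast
    then obtain \<eta> \<epsilon> where \<eta>: "\<And>f. f \<in> F \<Longrightarrow> \<eta> f \<in> H \<and> \<epsilon> f \<in> G \<and> f = \<phi> (\<eta> f) ` \<epsilon> f"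
      by metis
    then have \<eta>H: "\<And>f. f \<in> F \<Longrightarrow> \<eta> f \<in> H" "\<And>f. f \<in> F \<Longrightarrow> \<epsilon> f \<in> G"
      and \<eta>F: "\<And>f. f \<in> F \<Longrightarrow> \<phi> (\<eta> f) ` \<epsilon> f = f" by metis+
    show ?thesis
    proof (cases "card (\<eta> ` F) \<le> n")
      case True
      \<comment> \<open>The blocks inside one copy form an isomorphic image of a small subfamily of
        \<open>G\<close>.\<close>
      have part: "forest {f\<in>F. \<eta> f = h}" for h
      proof -
        let ?F = "{f\<in>F. \<eta> f = h}"
        have "\<phi> h ` \<epsilon> f = f" if "f \<in> ?F" for f
          using that \<eta>F[of f] by simp
        then have "(\<lambda>f. \<phi> h ` \<epsilon> f) ` ?F = (\<lambda>f. f) ` ?F"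
          by (rule image_cong[OF refl])
        then have eq: "(`) (\<phi> h) ` (\<epsilon> ` ?F) = ?F" unfolding image_image by simp
        have "card (\<epsilon> ` ?F) \<le> Suc n"
          using F(2,3) card_image_le[of ?F \<epsilon>] card_mono[of F ?F] by auto
        then have "forest (\<epsilon> ` ?F)"
          using G F(2) \<eta>H unfolding partite_system_def locally_forest_def by (simp add: image_subset_iff)
        moreover have "inj_on (\<phi> h) (\<Union>(\<epsilon> ` ?F))"
        proof (cases "?F = {}")
          case False
          then have "h \<in> H" using \<eta>H by auto
          then show ?thesis using inj by (meson inj_on_subset subset_UNIV)
        qed (metis Sup_empty image_empty inj_on_empty)
        ultimately show ?thesis using forest_image[of "\<epsilon> ` ?F" "\<phi> h"] unfolding eq by blast
      qed
      \<comment> \<open>Add the copies in the order in which \<open>H\<close> grows. Different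
        copies share only vertices of their hyperedges, and \<open>h'\<close> has at most one vertex
        in common with the earlier hyperedges.\<close>
      have acc: "forest {f\<in>F. \<eta> f \<in> A}" if "grows h A" "A \<subseteq> H" for h A
        using that
      proof (induction rule: grows.induct)
        case base
        then show ?case using part[of h] by simp
      next
        case (step A h')
        have "forest ({f\<in>F. \<eta> f \<in> A} \<union> {f\<in>F. \<eta> f = h'})"
        proof (rule forest_union)
          show "forest {f\<in>F. \<eta> f \<in> A}" using step by simp
          show "forest {f\<in>F. \<eta> f = h'}" by (rule part)
          show "{f\<in>F. \<eta> f \<in> A} \<inter> {f\<in>F. \<eta> f = h'} = {}" using step.hyps by auto
          have "\<Union>{f\<in>F. \<eta> f \<in> A} \<inter> \<Union>{f\<in>F. \<eta> f = h'} \<subseteq> (\<lambda>w. sum_encode (Inl w)) ` (h' \<inter> \<Union>A)"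
          proof
            fix w assume "w \<in> \<Union>{f\<in>F. \<eta> f \<in> A} \<inter> \<Union>{f\<in>F. \<eta> f = h'}"
            then obtain f f' where ff: "f \<in> F" "f' \<in> F" "\<eta> f \<in> A" "\<eta> f' = h'" "w \<in> f" "w \<in> f'" by blast
            then obtain v v' where vv: "w = \<phi> (\<eta> f) v" "w = \<phi> h' v'" using \<eta>F by (metis imageE)
            have H': "\<eta> f \<in> H" "h' \<in> H" using step.prems ff by auto
            have "\<eta> f \<noteq> h'" using step.hyps ff by auto
            then have *: "v \<in> X" "v' \<in> X" "\<beta> (\<eta> f) v = \<beta> h' v'" using meet vv H' by metis+
            then have "\<beta> h' v' \<in> h'" "\<beta> h' v' \<in> \<eta> f"
              using \<beta>[OF H'(1)] \<beta>[OF H'(2)] by (metis bij_betwE)+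
            moreover have "w = sum_encode (Inl (\<beta> h' v'))" using vv * by (simp add: \<phi>_def glue_def)
            ultimately show "w \<in> (\<lambda>w. sum_encode (Inl w)) ` (h' \<inter> \<Union>A)" using ff by blast
          qed
          then show "at_most_one (\<Union>{f\<in>F. \<eta> f \<in> A} \<inter> \<Union>{f\<in>F. \<eta> f = h'})"
            using at_most_one_subset at_most_one_image step.hyps(3) by meson
        qed
        moreover have "{f\<in>F. \<eta> f \<in> insert h' A} = {f\<in>F. \<eta> f \<in> A} \<union> {f\<in>F. \<eta> f = h'}" by auto
        ultimately show ?case by simp
      qed
      have FH: "forest (\<eta> ` F)"
        using H True F(2) \<eta>H unfolding critical_hypergraph_def locally_forest_def
        by (simp add: image_subset_iff)
      show ?thesis
      proof (cases "F = {}")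
        case False
        then obtain f where "f \<in> F" by blast
        then have "grows (\<eta> f) (\<eta> ` F)" using FH by (simp add: forest_def)
        then have "forest {f\<in>F. \<eta> f \<in> \<eta> ` F}" using acc \<eta>H by blast
        moreover have "{f\<in>F. \<eta> f \<in> \<eta> ` F} = F" by auto
        ultimately show ?thesis by simp
      qed (simp add: forest_empty)
    next
      case False
      \<comment> \<open>At most \<open>Suc n\<close> blocks lie in more than \<open>n\<close>
        copies, so no two of them share a copy. Overlaps then lie in part \<open>a\<close>, where
        each block has at most one vertex.\<close>
      then have "card F \<le> card (\<eta> ` F)" using F(3) by simp
      then have "card (\<eta> ` F) = card F" using card_image_le[OF F(2), of \<eta>] by simp
      then have inj\<eta>: "inj_on \<eta> F" using F(2) eq_card_imp_inj_on by blast
      show ?thesis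
      proof (rule forest_if_all_leaves[OF F(2)])
        fix f assume f: "f \<in> F"
        show "at_most_one (f \<inter> \<Union>(F - {f}))"
          unfolding at_most_one_def
        proof (intro allI impI)
          fix x y assume xy: "x \<in> f \<inter> \<Union>(F - {f})" "y \<in> f \<inter> \<Union>(F - {f})"
          have *: "\<exists>v\<in>\<epsilon> f. w = \<phi> (\<eta> f) v \<and> \<pi> v = a" if w: "w \<in> f \<inter> \<Union>(F - {f})" for w
          proof -
            obtain f' where f': "f' \<in> F" "f' \<noteq> f" "w \<in> f'" using w by blast
            have "w \<in> f" using w by blast
            obtain v where v: "v \<in> \<epsilon> f" "w = \<phi> (\<eta> f) v" using \<eta>F[OF f] \<open>w \<in> f\<close> by (metis imageE)
            obtain v' where v': "w = \<phi> (\<eta> f') v'" using \<eta>F[OF f'(1)] f'(3) by (metis imageE)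
            have "\<eta> f \<noteq> \<eta> f'" using inj\<eta> f f' by (metis inj_onD)
            then have "v \<in> X" using meet v v' \<eta>H(1)[OF f] \<eta>H(1)[OF f'(1)] by metis
            then show ?thesis using v by (auto simp: X_def)
          qed
          obtain v v' where "v \<in> \<epsilon> f" "x = \<phi> (\<eta> f) v" "\<pi> v = a"
            "v' \<in> \<epsilon> f" "y = \<phi> (\<eta> f) v'" "\<pi> v' = a" using *[OF xy(1)] *[OF xy(2)] by blast
          moreover have "inj_on \<pi> (\<epsilon> f)" using G \<eta>H(2)[OF f] by (simp add: partite_system_def)
          ultimately show "x = y" by (metis inj_onD)
        qed
      qed
    qed
  qed
  have "partite_system \<S> (Suc n) G' \<pi>'"
    unfolding partite_system_def locally_forest_def
  proof (intro conjI allI impI ballI)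
    show "finite G'" using H G by (auto simp: G'_def critical_hypergraph_def partite_system_def)
    show "forest F" if "F \<subseteq> G'" "finite F \<and> card F \<le> Suc n" for F using loc that by blast
    fix e assume "e \<in> G'"
    then obtain h e0 where e: "h \<in> H" "e0 \<in> G" "e = \<phi> h ` e0" by (auto simp: G'_def)
    have e0: "finite e0" "inj_on \<pi> e0" "\<pi> ` e0 \<in> \<S>" using G e by (auto simp: partite_system_def)
    show "finite e" using e e0 by simp
    show "inj_on \<pi>' e" using e0 unfolding e inj_on_def by (auto simp: \<pi>\<phi>)
    show "\<pi>' ` e \<in> \<S>" using e0 e by (simp add: image_image \<pi>\<phi>)
  qed
  moreover have "monochromatic_parts K \<S> (insert a D) G' \<pi>'"
    unfolding monochromatic_parts_def
  proof (intro allI impI)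
    fix \<chi> :: "nat \<Rightarrow> 'a" assume \<chi>: "range \<chi> \<subseteq> K"
    have "range (\<lambda>w. \<chi> (sum_encode (Inl w))) \<subseteq> K" using \<chi> by auto
    then obtain h \<kappa> where h: "h \<in> H" "\<And>w. w \<in> h \<Longrightarrow> \<chi> (sum_encode (Inl w)) = \<kappa>"
      using H unfolding critical_hypergraph_def by metis
    \<comment> \<open>Part \<open>a\<close> of copy \<open>h\<close> is monochromatic by the choice
      of \<open>h\<close>; the parts in \<open>D\<close> are settled by the hypothesis on
      \<open>G\<close> for the coloring pulled back to this copy.\<close>
    have "range (\<lambda>v. \<chi> (\<phi> h v)) \<subseteq> K" using \<chi> by auto
    then obtain c where c: "range c \<subseteq> K"
      "\<And>S. S \<in> \<S> \<Longrightarrow> \<exists>e\<in>G. \<pi> ` e = S \<and> (\<forall>v\<in>e. \<pi> v \<in> D \<longrightarrow> \<chi> (\<phi> h v) = c (\<pi> v))"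
      using mono unfolding monochromatic_parts_def by metis
    \<comment> \<open>If part \<open>a\<close> is empty, so is \<open>h\<close>, and
      \<open>\<kappa>\<close> may lie outside \<open>K\<close>; the old color is kept in that
      case.\<close>
    let ?c = "c(a := if \<exists>v\<in>\<Union>G. \<pi> v = a then \<kappa> else c a)"
    have *: "\<chi> (\<phi> h v) = \<kappa>" if "v \<in> X" for v
      using h \<beta>[OF h(1)] that unfolding \<phi>_def glue_def by (auto dest: bij_betwE)
    show "\<exists>c. range c \<subseteq> K \<and> (\<forall>S\<in>\<S>. \<exists>e\<in>G'. \<pi>' ` e = S \<and> (\<forall>v\<in>e. \<pi>' v \<in> insert a D \<longrightarrow> \<chi> v = c (\<pi>' v)))"
    proof (intro exI[of _ ?c] conjI ballI)
      have "\<kappa> \<in> K" if "v \<in> \<Union>G" "\<pi> v = a" for v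
        using *[of v] that \<chi> by (auto simp: X_def)
      then show "range ?c \<subseteq> K" using c(1) by (auto simp: image_subset_iff)
      fix S assume "S \<in> \<S>"
      then obtain e where e: "e \<in> G" "\<pi> ` e = S"
        "\<And>v. v \<in> e \<Longrightarrow> \<pi> v \<in> D \<Longrightarrow> \<chi> (\<phi> h v) = c (\<pi> v)" using c(2) by metis
      show "\<exists>e\<in>G'. \<pi>' ` e = S \<and> (\<forall>v\<in>e. \<pi>' v \<in> insert a D \<longrightarrow> \<chi> v = ?c (\<pi>' v))"
      proof (intro bexI[of _ "\<phi> h ` e"] conjI)
        show "\<phi> h ` e \<in> G'" using e h by (auto simp: G'_def)
        show "\<pi>' ` \<phi> h ` e = S" using e by (simp add: image_image \<pi>\<phi>)
        show "\<forall>v\<in>\<phi> h ` e. \<pi>' v \<in> insert a D \<longrightarrow> \<chi> v = ?c (\<pi>' v)"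
        proof (intro ballI impI)
          fix w assume w: "w \<in> \<phi> h ` e" "\<pi>' w \<in> insert a D"
          then obtain v where v: "v \<in> e" "w = \<phi> h v" by blast
          show "\<chi> w = ?c (\<pi>' w)"
          proof (cases "\<pi> v = a")
            case True
            then have "v \<in> X" using e(1) v(1) by (auto simp: X_def)
            then have "\<chi> w = \<kappa>" "\<exists>v\<in>\<Union>G. \<pi> v = a" using * v(2) by (auto simp: X_def)
            then show ?thesis using True v(2) by (simp add: \<pi>\<phi>)
          next
            case False
            then have "\<pi> v \<in> D" using w(2) v(2) by (simp add: \<pi>\<phi>)
            then show ?thesis using False e(3)[OF v(1)] v(2) by (simp add: \<pi>\<phi>)
          qed
        qed
      qed
    qed
  qed
  ultimately show ?thesis by blast
qed

lemma disjoint_blocks_system: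
  fixes \<S> :: "nat set set"
  assumes "finite \<S>" "\<And>S. S \<in> \<S> \<Longrightarrow> finite S"
  shows "\<exists>B \<pi>. partite_system \<S> n B \<pi> \<and> monochromatic_parts K \<S> {} B \<pi>"
proof -
  define e where "e = (\<lambda>S :: nat set. (\<lambda>a. prod_encode (set_encode S, a)) ` S)"
  define \<pi> where "\<pi> = (\<lambda>w. snd (prod_decode w))"
  have \<pi>e: "\<pi> ` e S = S" for S by (simp add: \<pi>_def e_def image_image)
  have meet: "S = S'" if "w \<in> e S" "w \<in> e S'" "S \<in> \<S>" "S' \<in> \<S>" for w S S'
    using that assms(2) by (auto simp: e_def prod_encode_eq set_encode_eq)
  have "forest F" if F: "F \<subseteq> e ` \<S>" "finite F" for F
  proof (rule forest_if_all_leaves[OF F(2)])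
    fix f assume "f \<in> F"
    have False if w: "w \<in> f" "w \<in> f'" "f' \<in> F" "f' \<noteq> f" for w f'
    proof -
      obtain S S' where "S \<in> \<S>" "S' \<in> \<S>" "f = e S" "f' = e S'" using F \<open>f \<in> F\<close> w by blast
      then show False using meet w by metis
    qed
    then have "f \<inter> \<Union>(F - {f}) = {}" by blast
    then show "at_most_one (f \<inter> \<Union>(F - {f}))" by (simp add: at_most_one_def)
  qed
  then have "partite_system \<S> n (e ` \<S>) \<pi>"
    using assms \<pi>e unfolding partite_system_def locally_forest_def
    by (auto simp: inj_on_def e_def \<pi>_def)
  moreover have "monochromatic_parts K \<S> {} (e ` \<S>) \<pi>"
    unfolding monochromatic_parts_def
  proof (intro allI impI)
    fix \<chi> :: "nat \<Rightarrow> _" assume "range \<chi> \<subseteq> K"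
    then show "\<exists>c. range c \<subseteq> K \<and>
        (\<forall>S\<in>\<S>. \<exists>f\<in>e ` \<S>. \<pi> ` f = S \<and> (\<forall>v\<in>f. \<pi> v \<in> {} \<longrightarrow> \<chi> v = c (\<pi> v)))"
      \<comment> \<open>No part is constrained yet, so any function into \<open>K\<close> will do,
        and \<open>\<chi>\<close> is one.\<close>
      using \<pi>e by (intro exI[of _ \<chi>]) simp
  qed
  ultimately show ?thesis by blast
qed

text \<open>The size of the part to be amalgamated depends on the earlier steps, so critical
  hypergraphs of every uniformity \<open>r\<close> are assumed. Acyclicity up to \<open>n\<close> in
  them yields \<open>Suc n\<close> for the system, which drives the next induction.\<close>

lemma partite_system_exists:
  fixes \<S> :: "nat set set" and K :: "'c set"
  assumes crit: "\<And>r. \<exists>H. critical_hypergraph K r n H"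
    and \<S>: "finite \<S>" "\<And>S. S \<in> \<S> \<Longrightarrow> finite S" and D: "finite D"
  shows "\<exists>B \<pi>. partite_system \<S> (Suc n) B \<pi> \<and> monochromatic_parts K \<S> D B \<pi>"
  using D
proof (induction rule: finite_induct)
  case empty
  then show ?case using disjoint_blocks_system[OF \<S>] by blast
next
  case (insert a D)
  then obtain B \<pi> where "partite_system \<S> (Suc n) B \<pi>" "monochromatic_parts K \<S> D B \<pi>" by blast
  moreover obtain H where "critical_hypergraph K (card {v \<in> \<Union>B. \<pi> v = a}) n H" using crit by blast
  ultimately show ?case by (rule amalgamation)
qed

text \<open>In the step the \<open>r\<close>-subsets of \<open>A\<close> become the patterns of a
  partite system. The pigeonhole principle, applied to the colors of the parts, finds
  \<open>r\<close> parts of one color, and the block over them is monochromatic.\<close>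

lemma critical_hypergraph_exists:
  fixes K :: "'c set"
  assumes K: "finite K"
  shows "\<exists>H. critical_hypergraph K r n H"
proof (induction n arbitrary: r)
  case (0 r)
  \<comment> \<open>\<open>A\<close> has \<open>(r - 1) * card K + 1\<close> elements, one more than
    \<open>card K\<close> classes of size \<open>r - 1\<close> can hold.\<close>
  define A where "A = {..(r - 1) * card K}"
  define H where "H = {S. S \<subseteq> A \<and> card S = r}"
  have "\<exists>h\<in>H. \<exists>\<kappa>. \<forall>v\<in>h. \<chi> v = \<kappa>" if "range \<chi> \<subseteq> K" for \<chi> :: "nat \<Rightarrow> 'c"
    using pigeonhole_subset[OF K, of \<chi> A r] that by (auto simp: A_def H_def)
  moreover have "finite H" by (auto simp: H_def A_def)
  moreover have "finite h" if "h \<in> H" for h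
    using that by (auto simp: H_def A_def intro: finite_subset)
  moreover have "locally_forest 0 H"
    unfolding locally_forest_def using forest_empty by fastforce
  moreover have "card h = r" if "h \<in> H" for h
    using that by (simp add: H_def)
  ultimately have "critical_hypergraph K r 0 H"
    unfolding critical_hypergraph_def by blast
  then show ?case by blast
next
  case (Suc n r)
  define A where "A = {..(r - 1) * card K}"
  define \<S> where "\<S> = {S. S \<subseteq> A \<and> card S = r}"
  have \<S>: "finite \<S>" "finite S" if "S \<in> \<S>" for S
    using that by (auto simp: \<S>_def A_def intro: finite_subset)
  have fin\<S>: "finite \<S>" by (auto simp: \<S>_def A_def)
  obtain B \<pi> where B: "partite_system \<S> (Suc n) B \<pi>" "monochromatic_parts K \<S> A B \<pi>"
    using partite_system_exists[OF Suc.IH fin\<S> \<S>(2), of A] by (auto simp: A_def)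
  have "critical_hypergraph K r (Suc n) B"
    unfolding critical_hypergraph_def
  proof (intro conjI ballI allI impI)
    show "finite B" "locally_forest (Suc n) B" using B by (auto simp: partite_system_def)
    fix h assume "h \<in> B"
    then have "finite h" "inj_on \<pi> h" "\<pi> ` h \<in> \<S>" using B by (auto simp: partite_system_def)
    then show "finite h" "card h = r" by (auto simp: \<S>_def card_image)
  next
    fix \<chi> :: "nat \<Rightarrow> 'c" assume "range \<chi> \<subseteq> K"
    then obtain c where c: "range c \<subseteq> K"
      "\<And>S. S \<in> \<S> \<Longrightarrow> \<exists>e\<in>B. \<pi> ` e = S \<and> (\<forall>v\<in>e. \<pi> v \<in> A \<longrightarrow> \<chi> v = c (\<pi> v))"
      using B(2) unfolding monochromatic_parts_def by metis
    have "c ` A \<subseteq> K" using c(1) by blast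
    moreover have "finite A" "(r - 1) * card K < card A" by (simp_all add: A_def)
    ultimately have "\<exists>S \<kappa>. S \<subseteq> A \<and> card S = r \<and> (\<forall>a\<in>S. c a = \<kappa>)" by (rule pigeonhole_subset[OF K])
    then obtain S \<kappa>
      where S: "S \<subseteq> A" "card S = r" "\<forall>a\<in>S. c a = \<kappa>" by blast
    then have "S \<in> \<S>" by (simp add: \<S>_def)
    then obtain e where e: "e \<in> B" "\<pi> ` e = S" "\<forall>v\<in>e. \<pi> v \<in> A \<longrightarrow> \<chi> v = c (\<pi> v)" using c(2) by blast
    have "\<chi> v = \<kappa>" if "v \<in> e" for v
    proof -
      have "\<pi> v \<in> S" using e(2) that by (metis imageI)
      then show ?thesis using e(3) S that by auto
    qed
    then have "\<forall>v\<in>e. \<chi> v = \<kappa>" by simp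
    then show "\<exists>h\<in>B. \<exists>\<kappa>. \<forall>v\<in>h. \<chi> v = \<kappa>" using e(1) by metis
  qed
  then show ?case by blast
qed

section \<open>Homomorphisms and sparse instances\<close>

definition hom :: "(nat \<Rightarrow> nat) \<Rightarrow> fact set \<Rightarrow> fact set \<Rightarrow> bool" where
  "hom h I J \<longleftrightarrow> (\<forall>f\<in>I. (fst f, map h (snd f)) \<in> J)"

lemma homI: "(\<And>R xs. (R, xs) \<in> I \<Longrightarrow> (R, map h xs) \<in> J) \<Longrightarrow> hom h I J"
  by (metis hom_def prod.collapse)

lemma homD: "hom h I J \<Longrightarrow> (R, xs) \<in> I \<Longrightarrow> (R, map h xs) \<in> J"
  by (force simp: hom_def)

lemma cq_sat_iff_hom: "cq_sat I q \<longleftrightarrow> (\<exists>h. hom h q I)"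
  by (simp add: cq_sat_def hom_def case_prod_beta)

lemma hom_comp: "hom h I J \<Longrightarrow> hom h' J L \<Longrightarrow> hom (h' \<circ> h) I L"
  by (fastforce simp: hom_def)

lemma is_model_iff:
  "is_model P J \<longleftrightarrow>
     (\<forall>r\<in>P. \<forall>h. hom h (set (snd r)) J \<longrightarrow> (\<exists>a\<in>set (fst r). (fst a, map h (snd a)) \<in> J))"
  by (simp add: is_model_def hom_def case_prod_beta)

text \<open>The preimage of a model along \<open>h\<close> is again a model, also for disjunctive
  heads, and it contains the same nullary facts.\<close>

lemma entails_hom:
  assumes "entails I g P" "hom h I I'"
  shows "entails I' g P"
  unfolding entails_def
proof (intro allI impI)
  fix J' assume J': "I' \<subseteq> J' \<and> is_model P J'"
  define J where "J = {(R, xs). (R, map h xs) \<in> J'}"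
  have "I \<subseteq> J" using assms(2) J' by (auto simp: J_def hom_def)
  moreover have "is_model P J"
    unfolding is_model_iff
  proof (intro ballI allI impI)
    fix r \<sigma> assume r: "r \<in> P" "hom \<sigma> (set (snd r)) J"
    then have "hom (h \<circ> \<sigma>) (set (snd r)) J'" by (auto simp: hom_def J_def)
    then obtain a where "a \<in> set (fst r)" "(fst a, map (h \<circ> \<sigma>) (snd a)) \<in> J'"
      using J' r(1) unfolding is_model_iff by metis
    then show "\<exists>a\<in>set (fst r). (fst a, map \<sigma> (snd a)) \<in> J" by (auto simp: J_def)
  qed
  ultimately have "(g, []) \<in> J" using assms(1) by (simp add: entails_def)
  then show "(g, []) \<in> J'" by (simp add: J_def)
qed

text \<open>The blocks in \<open>B\<close> cover the facts of \<open>I\<close>; a block need not be the set of constants of a fact.\<close>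

definition sparse_cover :: "nat \<Rightarrow> nat \<Rightarrow> fact set \<Rightarrow> nat set set \<Rightarrow> bool" where
  "sparse_cover n k I B \<longleftrightarrow> finite B \<and> B \<noteq> {} \<and> locally_forest n B \<and>
     (\<forall>e\<in>B. finite e \<and> card e \<le> k) \<and> (\<forall>f\<in>I. \<exists>e\<in>B. set (snd f) \<subseteq> e)"

lemma adom_fact: "(R, xs) \<in> I \<Longrightarrow> set xs \<subseteq> adom I"
  by (force simp: adom_def)

lemma instance_over_finite_adom: "instance_over SE I \<Longrightarrow> finite (adom I)"
  by (auto simp: instance_over_def adom_def)

lemma diameter_ge:
  assumes "finite P" "r \<in> P"
  shows "card (rule_vars r) \<le> diameter P"
proof -
  have "finite ({card (rule_vars r) | r. r \<in> P} \<union> {0})"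
    using assms by (simp only: setcompr_eq_image Collect_mem_eq finite_imageI finite_Un finite.intros)
  then show ?thesis unfolding diameter_def by (rule Max_ge) (use assms(2) in blast)
qed

lemma mddlog_rule:
  assumes "mddlog_program SE g P" "r \<in> P"
  shows "snd r \<noteq> []"
    and "a \<in> set (fst r) \<union> set (snd r) \<Longrightarrow> length (snd a) = snd (fst a)"
    and "(\<Union>a \<in> set (fst r). set (snd a)) \<subseteq> (\<Union>a \<in> set (snd r). set (snd a))"
    and "a \<in> set (snd r) \<Longrightarrow> fst a \<noteq> g"
    and "a \<in> set (fst r) \<Longrightarrow> snd (fst a) \<le> 1"
    and "a \<in> set (fst r) \<Longrightarrow> fst a \<notin> SE"
    and "a \<in> set (snd r) \<Longrightarrow> fst a \<notin> idb_rels P \<Longrightarrow> fst a \<in> SE"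
proof -
  note r = assms(1)[unfolded mddlog_program_def, THEN conjunct2, THEN conjunct2, THEN conjunct2,
      rule_format, OF assms(2)]
  have g: "snd g = 0" "g \<notin> SE" using assms(1) unfolding mddlog_program_def by blast+
  show "snd r \<noteq> []" and "(\<Union>a \<in> set (fst r). set (snd a)) \<subseteq> (\<Union>a \<in> set (snd r). set (snd a))"
    and "a \<in> set (fst r) \<union> set (snd r) \<Longrightarrow> length (snd a) = snd (fst a)"
    and "a \<in> set (snd r) \<Longrightarrow> fst a \<noteq> g"
    and "a \<in> set (snd r) \<Longrightarrow> fst a \<notin> idb_rels P \<Longrightarrow> fst a \<in> SE"
    using r by blast+
  show "snd (fst a) \<le> 1" "fst a \<notin> SE" if "a \<in> set (fst r)"
    using r g that by (cases "fst a = g"; simp)+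
qed

lemma idb_relsI: "r \<in> P \<Longrightarrow> a \<in> set (fst r) \<Longrightarrow> fst a \<in> idb_rels P"
  unfolding idb_rels_def by blast

lemma idb_rels_not_edb: "mddlog_program SE g P \<Longrightarrow> A \<in> idb_rels P \<Longrightarrow> A \<notin> SE"
  using mddlog_rule(6) unfolding idb_rels_def by blast

lemma idb_rels_arity: "mddlog_program SE g P \<Longrightarrow> A \<in> idb_rels P \<Longrightarrow> snd A \<le> 1"
  using mddlog_rule(5) unfolding idb_rels_def by blast

lemma finite_idb_rels:
  assumes "finite P" shows "finite (idb_rels P)"
proof -
  have "idb_rels P = fst ` (\<Union>r\<in>P. set (fst r))" by (force simp: idb_rels_def)
  then show ?thesis using assms by simp
qed

text \<open>A model over the preimage colors each vertex by the IDB relations that hold there. The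
  resulting colors of the parts define a model over \<open>I\<close>, which contains the goal fact;
  being nullary, this fact was taken from the given model.\<close>

lemma sparse_instance_exists:
  assumes P: "mddlog_program SE g P" "diameter P \<le> k"
    and I: "instance_over SE I" "entails I g P"
  shows "\<exists>I' B \<pi>. instance_over SE I' \<and> hom \<pi> I' I \<and> entails I' g P \<and> sparse_cover n k I' B"
proof -
  define K :: "rel set set" where "K = Pow (idb_rels P)"
  have finP: "finite P" using P by (simp add: mddlog_program_def)
  then have finK: "finite K" by (simp add: K_def finite_idb_rels)
  have finA: "finite (adom I)" using I(1) by (rule instance_over_finite_adom)
  \<comment> \<open>The variables of a rule can only be mapped onto such a set when they are sent to
    \<open>adom I\<close>, whether or not one fact covers it.\<close>
  define \<S> where "\<S> = {S. S \<subseteq> adom I \<and> card S \<le> k}"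
  have \<S>: "finite \<S>" "\<And>S. S \<in> \<S> \<Longrightarrow> finite S"
    using finA by (auto simp: \<S>_def intro: finite_subset)
  obtain B \<pi> where B: "partite_system \<S> (Suc n) B \<pi>" "monochromatic_parts K \<S> (adom I) B \<pi>"
    using partite_system_exists[OF critical_hypergraph_exists[OF finK] \<S> finA] by blast
  have Be: "finite e" "inj_on \<pi> e" "\<pi> ` e \<subseteq> adom I" "card e \<le> k" if "e \<in> B" for e
    using B(1) that card_image[of \<pi> e] by (auto simp: partite_system_def \<S>_def)
  define I' where "I' = {(R, xs). (R, map \<pi> xs) \<in> I \<and> (\<exists>e\<in>B. set xs \<subseteq> e)}"
  have finB: "finite B" using B(1) by (simp add: partite_system_def)
  have "instance_over SE I'"
    unfolding instance_over_def
  proof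
    let ?W = "\<Union>B"
    have "I' \<subseteq> (\<Union>(R, ys)\<in>I. {R} \<times> {xs. set xs \<subseteq> ?W \<and> length xs = length ys})"
    proof
      fix f assume "f \<in> I'"
      then obtain R xs where f: "f = (R, xs)" "(R, map \<pi> xs) \<in> I" "set xs \<subseteq> ?W"
        unfolding I'_def by blast
      then show "f \<in> (\<Union>(R, ys)\<in>I. {R} \<times> {xs. set xs \<subseteq> ?W \<and> length xs = length ys})"
        by (intro UN_I[of "(R, map \<pi> xs)"]) auto
    qed
    moreover have "finite \<dots>"
      using I(1) finB Be(1) by (auto simp: instance_over_def intro!: finite_lists_length_eq)
    ultimately show "finite I'" by (rule finite_subset)
    show "\<forall>(R, cs)\<in>I'. R \<in> SE \<and> length cs = snd R"
      using I(1) by (fastforce simp: I'_def instance_over_def)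
  qed
  moreover have "hom \<pi> I' I" by (auto simp: hom_def I'_def)
  moreover have "sparse_cover n k I' B"
  proof -
    \<comment> \<open>The pattern \<open>{}\<close> requires a block as well, so \<open>B\<close> is
      nonempty even if \<open>adom I\<close> is empty.\<close>
    have "{} \<in> \<S>" by (simp add: \<S>_def)
    moreover obtain A where "A \<in> K" by (auto simp: K_def)
    then have "range (\<lambda>_ :: nat. A) \<subseteq> K" by auto
    ultimately have "B \<noteq> {}" using B(2) unfolding monochromatic_parts_def by blast
    moreover have "locally_forest n B"
      using B(1) locally_forest_mono[of "Suc n" B n] by (simp add: partite_system_def)
    ultimately show ?thesis using finB Be by (auto simp: sparse_cover_def I'_def)
  qed
  moreover have "entails I' g P"
    unfolding entails_def
  proof (intro allI impI)
    fix J assume J: "I' \<subseteq> J \<and> is_model P J"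
    define \<chi> where "\<chi> = (\<lambda>v. {A \<in> idb_rels P. (A, [v]) \<in> J})"
    have "range \<chi> \<subseteq> K" by (auto simp: \<chi>_def K_def)
    then obtain c where c: "range c \<subseteq> K"
      "\<And>S. S \<in> \<S> \<Longrightarrow> \<exists>e\<in>B. \<pi> ` e = S \<and> (\<forall>v\<in>e. \<pi> v \<in> adom I \<longrightarrow> \<chi> v = c (\<pi> v))"
      using B(2) unfolding monochromatic_parts_def by metis
    define J' where "J' = I \<union> {(A, [a]) | A a. a \<in> adom I \<and> A \<in> c a} \<union> {(A, []) | A. (A, []) \<in> J}"
    have "is_model P J'"
      unfolding is_model_iff
    proof (intro ballI allI impI)
      fix r \<sigma> assume r: "r \<in> P" "hom \<sigma> (set (snd r)) J'"
      note wf = mddlog_rule[OF P(1) r(1)]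
      have "\<sigma> ` rule_vars r \<subseteq> adom I"
      proof
        fix b assume "b \<in> \<sigma> ` rule_vars r"
        then obtain R xs x where x: "(R, xs) \<in> set (snd r)" "x \<in> set xs" "b = \<sigma> x"
        proof -
          obtain x where "x \<in> rule_vars r" "b = \<sigma> x" using \<open>b \<in> \<sigma> ` rule_vars r\<close> by blast
          then obtain a where "a \<in> set (snd r)" "x \<in> set (snd a)"
            using wf(3) unfolding rule_vars_def by blast
          then show ?thesis using that \<open>b = \<sigma> x\<close> by (metis prod.collapse)
        qed
        then have "(R, map \<sigma> xs) \<in> J'" using homD[OF r(2)] by simp
        then show "b \<in> adom I" using x adom_fact[of R "map \<sigma> xs" I] by (auto simp: J'_def)
      qed
      moreover have "card (\<sigma> ` rule_vars r) \<le> k"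
        using diameter_ge[OF finP r(1)] P(2) card_image_le[of "rule_vars r" \<sigma>]
        by (fastforce simp: rule_vars_def)
      ultimately have "\<sigma> ` rule_vars r \<in> \<S>" by (simp add: \<S>_def)
      then obtain e where e: "e \<in> B" "\<pi> ` e = \<sigma> ` rule_vars r"
        "\<forall>v\<in>e. \<pi> v \<in> adom I \<longrightarrow> \<chi> v = c (\<pi> v)" using c(2) by metis
      then have "\<forall>x\<in>rule_vars r. \<exists>v\<in>e. \<pi> v = \<sigma> x" by (metis imageE imageI)
      \<comment> \<open>\<open>\<tau>\<close> lifts the match to a block whose colors agree with
        \<open>c\<close>. The body transfers to \<open>J\<close> along it, and the head comes back
        to \<open>J'\<close>.\<close>
      then obtain \<tau> where \<tau>: "\<And>x. x \<in> rule_vars r \<Longrightarrow> \<tau> x \<in> e \<and> \<pi> (\<tau> x) = \<sigma> x" by metis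
      have col: "\<chi> (\<tau> x) = c (\<sigma> x)" if "x \<in> rule_vars r" for x
        using \<tau>[OF that] e(1,3) Be(3) by fastforce
      have "hom \<tau> (set (snd r)) J"
      proof (rule homI)
        fix R xs assume a: "(R, xs) \<in> set (snd r)"
        then have R: "(R, map \<sigma> xs) \<in> J'" using homD[OF r(2)] by simp
        have vars: "set xs \<subseteq> rule_vars r" using a by (force simp: rule_vars_def)
        have eq: "map \<pi> (map \<tau> xs) = map \<sigma> xs" using vars \<tau> by auto
        consider "(R, map \<sigma> xs) \<in> I" | x where "xs = [x]" "R \<in> c (\<sigma> x)" | "xs = []" "(R, []) \<in> J"
          using R by (auto simp: J'_def)
        then show "(R, map \<tau> xs) \<in> J"
        proof cases
          case 1
          moreover have "set (map \<tau> xs) \<subseteq> e" using vars \<tau> by auto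
          ultimately have "(R, map \<tau> xs) \<in> I'"
            using eq e(1) unfolding I'_def mem_Collect_eq case_prod_conv by metis
          then show ?thesis using J by blast
        next
          case 2
          then have "R \<in> \<chi> (\<tau> x)" using col vars by simp
          then show ?thesis using 2 by (simp add: \<chi>_def)
        qed simp
      qed
      then obtain R xs where R: "(R, xs) \<in> set (fst r)" "(R, map \<tau> xs) \<in> J"
        using J r(1) unfolding is_model_iff by (metis prod.collapse)
      have "length xs \<le> 1" using R(1) wf(2)[of "(R, xs)"] wf(5)[of "(R, xs)"] by simp
      then consider "xs = []" | x where "xs = [x]" by (cases xs) auto
      then have "(R, map \<sigma> xs) \<in> J'"
      proof cases
        case 1
        then show ?thesis using R 1 by (cases R) (auto simp: J'_def)
      next
        case 2
        have x: "x \<in> rule_vars r" using R(1) 2 by (force simp: rule_vars_def)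
        have "R \<in> idb_rels P" using idb_relsI[OF r(1) R(1)] by simp
        then have "R \<in> \<chi> (\<tau> x)" using R 2 by (simp add: \<chi>_def)
        then have "R \<in> c (\<sigma> x)" using col[OF x] by simp
        moreover have "\<sigma> x \<in> adom I" using \<open>\<sigma> ` rule_vars r \<subseteq> adom I\<close> x by blast
        ultimately show ?thesis using 2 by (cases R) (simp add: J'_def)
      qed
      then show "\<exists>a\<in>set (fst r). (fst a, map \<sigma> (snd a)) \<in> J'" using R(1) by force
    qed
    moreover have "I \<subseteq> J'" by (auto simp: J'_def)
    ultimately have "(g, []) \<in> J'" using I(2) by (simp add: entails_def)
    moreover have "(g, []) \<notin> I" using I(1) P(1) by (auto simp: instance_over_def mddlog_program_def)
    ultimately show "(g, []) \<in> J" unfolding J'_def by blast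
  qed
  ultimately show ?thesis by blast
qed

section \<open>Tree decompositions of acyclic covers\<close>

lemma is_tree_singleton: "is_tree {v} {}"
proof -
  have "length cs < 3" if "distinct cs" "set cs \<subseteq> {v}" for cs
    using that card_mono[of "{v}" "set cs"] by (simp add: distinct_card)
  then show ?thesis unfolding is_tree_def connected_in_def has_cycle_def
    by (auto simp: sym_def not_le)
qed

lemma connected_in_mono:
  "connected_in V E \<Longrightarrow> E \<subseteq> E' \<Longrightarrow> connected_in V E'"
  unfolding connected_in_def by (meson Int_mono rtrancl_mono subset_iff subset_refl)

lemma connected_in_insert:
  assumes "connected_in V E" "v \<in> V" "(v, w) \<in> E" "(w, v) \<in> E"
  shows "connected_in (insert w V) E"
proof -
  let ?V = "insert w V" and ?R = "(E \<inter> (insert w V \<times> insert w V))\<^sup>*"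
  have old: "(x, y) \<in> ?R" if "x \<in> V" "y \<in> V" for x y
  proof -
    have "(x, y) \<in> (E \<inter> (V \<times> V))\<^sup>*" using assms(1) that by (simp add: connected_in_def)
    moreover have "(E \<inter> (V \<times> V))\<^sup>* \<subseteq> ?R" by (rule rtrancl_mono) blast
    ultimately show ?thesis by blast
  qed
  have vw: "(v, w) \<in> ?R" "(w, v) \<in> ?R" using assms by (auto intro!: r_into_rtrancl)
  show ?thesis
    unfolding connected_in_def
  proof (intro ballI)
    fix x y assume "x \<in> ?V" "y \<in> ?V"
    then have "(x, v) \<in> ?R" "(v, y) \<in> ?R" using old vw assms(2) by blast+
    then show "(x, y) \<in> ?R" by (rule rtrancl_trans)
  qed
qed

text \<open>From length 3 on, predecessor and successor on a cycle differ. A leaf has a single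
  neighbor, so no cycle passes through it.\<close>

lemma cycle_neighbours:
  assumes "length cs \<ge> 3" "distinct cs" "\<forall>i < length cs. (cs ! i, cs ! ((i + 1) mod length cs)) \<in> E"
    "w \<in> set cs"
  shows "\<exists>u v. u \<noteq> v \<and> (u, w) \<in> E \<and> (w, v) \<in> E"
proof -
  let ?n = "length cs"
  obtain i where i: "i < ?n" "cs ! i = w" using assms(4) by (metis in_set_conv_nth)
  define j where "j = (if i = 0 then ?n - 1 else i - 1)"
  define l where "l = (if i + 1 = ?n then 0 else i + 1)"
  have jl: "j < ?n" "l < ?n" "j \<noteq> l" using i assms(1) by (auto simp: j_def l_def split: if_splits)
  have "(j + 1) mod ?n = i" using i assms(1) by (auto simp: j_def)
  then have "(cs ! j, w) \<in> E" using assms(3) jl i by metis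
  moreover have "(i + 1) mod ?n = l" using i by (auto simp: l_def)
  then have "(w, cs ! l) \<in> E" using assms(3) i by metis
  moreover have "cs ! j \<noteq> cs ! l" using assms(2) jl by (simp add: nth_eq_iff_index_eq)
  ultimately show ?thesis by blast
qed

lemma is_tree_insert_leaf:
  assumes T: "is_tree V E" and v: "v \<in> V" and w: "w \<notin> V"
  shows "is_tree (insert w V) (insert (v, w) (insert (w, v) E))"
proof -
  let ?E = "insert (v, w) (insert (w, v) E)"
  have E: "E \<subseteq> V \<times> V" "sym E" "\<forall>v. (v, v) \<notin> E" "connected_in V E" "\<not> has_cycle V E"
    using T by (auto simp: is_tree_def)
  have nocycle: "\<not> has_cycle (insert w V) ?E"
  proof
    assume "has_cycle (insert w V) ?E"
    then obtain cs where cs: "length cs \<ge> 3" "distinct cs" "set cs \<subseteq> insert w V"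
      "\<forall>i < length cs. (cs ! i, cs ! ((i + 1) mod length cs)) \<in> ?E"
      unfolding has_cycle_def by blast
    have "w \<notin> set cs"
    proof
      assume "w \<in> set cs"
      then obtain x y where "x \<noteq> y" "(x, w) \<in> ?E" "(w, y) \<in> ?E"
        using cycle_neighbours[OF cs(1,2,4)] by blast
      then show False using E(1) v w by auto
    qed
    moreover have "\<forall>i < length cs. (cs ! i, cs ! ((i + 1) mod length cs)) \<in> E"
    proof (intro allI impI)
      fix i assume i: "i < length cs"
      then have "(i + 1) mod length cs < length cs" by (intro mod_less_divisor) linarith
      then have "cs ! i \<in> set cs" "cs ! ((i + 1) mod length cs) \<in> set cs" using i by simp_all
      then show "(cs ! i, cs ! ((i + 1) mod length cs)) \<in> E" using cs(4) i \<open>w \<notin> set cs\<close> by fastforce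
    qed
    ultimately have "has_cycle V E" using cs unfolding has_cycle_def by blast
    then show False using E(5) by blast
  qed
  have "connected_in V ?E" by (rule connected_in_mono[OF E(4)]) blast
  then have "connected_in (insert w V) ?E" by (rule connected_in_insert[OF _ v]) simp_all
  moreover have "sym ?E" using E(2) by (auto simp: sym_def)
  moreover have "?E \<subseteq> insert w V \<times> insert w V" using E(1) v by blast
  moreover have "\<forall>u. (u, u) \<notin> ?E" using E(3) v w by auto
  ultimately show ?thesis using nocycle by (simp add: is_tree_def)
qed

text \<open>A join tree in the sense of acyclic hypergraphs. The bound on overlaps concerns all
  pairs of nodes, not just adjacent ones, as the decomposition demands.\<close>

definition join_tree :: "nat set set \<Rightarrow> nat set \<Rightarrow> (nat \<times> nat) set \<Rightarrow> (nat \<Rightarrow> nat set) \<Rightarrow> bool" where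
  "join_tree F V E B \<longleftrightarrow> finite V \<and> is_tree V E \<and> B ` V = F \<and>
     (\<forall>x. connected_in {v\<in>V. x \<in> B v} E) \<and>
     (\<forall>v\<in>V. \<forall>v'\<in>V. v \<noteq> v' \<longrightarrow> at_most_one (B v \<inter> B v'))"

lemma grows_join_tree:
  assumes "grows e F"
  shows "\<exists>V E B. join_tree F V E B"
  using assms
proof (induction rule: grows.induct)
  case base
  show ?case
    by (intro exI[of _ "{0 :: nat}"] exI[of _ "{}"] exI[of _ "\<lambda>_. e"])
      (simp add: join_tree_def is_tree_singleton connected_in_def)
next
  case (step F f)
  from step.IH obtain V E B where "join_tree F V E B" by blast
  then have IH: "finite V" "is_tree V E" "B ` V = F"
     "\<And>x. connected_in {v\<in>V. x \<in> B v} E"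
     "\<And>v v'. v \<in> V \<Longrightarrow> v' \<in> V \<Longrightarrow> v \<noteq> v' \<Longrightarrow> at_most_one (B v \<inter> B v')"
    by (simp_all add: join_tree_def)
  obtain w :: nat where w: "w \<notin> V" using IH(1) ex_new_if_finite infinite_UNIV_nat by blast
  \<comment> \<open>The new bag is hung below a bag that contains its shared vertex, or anywhere if
    nothing is shared.\<close>
  obtain v where v: "v \<in> V" "f \<inter> \<Union>F \<subseteq> B v"
  proof (cases "f \<inter> \<Union>F = {}")
    case True
    then show ?thesis using that IH(2) by (auto simp: is_tree_def)
  next
    case False
    then obtain z b where z: "z \<in> f" "z \<in> b" "b \<in> F" by blast
    then have "f \<inter> \<Union>F \<subseteq> b" using step.hyps(3) unfolding at_most_one_def by blast
    then show ?thesis using that z(3) IH(3) by blast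
  qed
  let ?V = "insert w V" and ?E = "insert (v, w) (insert (w, v) E)" and ?B = "B(w := f)"
  have tree: "is_tree ?V ?E" using is_tree_insert_leaf[OF IH(2) v(1) w] .
  have img: "?B ` ?V = insert f F" using IH(3) w by auto
  have conn: "connected_in {u\<in>?V. x \<in> ?B u} ?E" for x
  proof (cases "x \<in> f")
    case False
    then have "{u\<in>?V. x \<in> ?B u} = {u\<in>V. x \<in> B u}" using w by auto
    then show ?thesis using connected_in_mono[OF IH(4)[of x], of ?E] by auto
  next
    case True
    then have eq: "{u\<in>?V. x \<in> ?B u} = insert w {u\<in>V. x \<in> B u}" using w by auto
    show ?thesis
    proof (cases "x \<in> \<Union>F")
      case True
      then have vx: "v \<in> {u\<in>V. x \<in> B u}" using v \<open>x \<in> f\<close> by blast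
      have "connected_in {u\<in>V. x \<in> B u} ?E" by (rule connected_in_mono[OF IH(4)]) blast
      then show ?thesis unfolding eq by (rule connected_in_insert[OF _ vx]) simp_all
    next
      case False
      then have none: "{u\<in>V. x \<in> B u} = {}" using IH(3) by auto
      show ?thesis unfolding eq none by (simp add: connected_in_def)
    qed
  qed
  have new: "at_most_one (f \<inter> B u)" "at_most_one (B u \<inter> f)" if "u \<in> V" for u
    using that IH(3) step.hyps(3) by (auto simp: at_most_one_def)
  have "at_most_one (?B u \<inter> ?B u')" if "u \<in> ?V" "u' \<in> ?V" "u \<noteq> u'" for u u'
    using that IH(5)[of u u'] new w by (auto split: if_splits)
  then have bags: "\<forall>u\<in>?V. \<forall>u'\<in>?V. u \<noteq> u' \<longrightarrow> at_most_one (?B u \<inter> ?B u')" by auto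
  have "join_tree (insert f F) ?V ?E ?B"
    unfolding join_tree_def
  proof (intro conjI)
    show "finite ?V" using IH(1) by simp
    show "is_tree ?V ?E" by (rule tree)
    show "?B ` ?V = insert f F" by (rule img)
    show "\<forall>x. connected_in {u\<in>?V. x \<in> ?B u} ?E" by (rule allI) (rule conn)
    show "\<forall>u\<in>?V. \<forall>u'\<in>?V. u \<noteq> u' \<longrightarrow> at_most_one (?B u \<inter> ?B u')" by (rule bags)
  qed
  then show ?case by blast
qed

lemma forest_has_treewidth:
  assumes "forest F" "\<And>e. e \<in> F \<Longrightarrow> card e \<le> k \<and> finite e" "\<forall>f\<in>I. \<exists>e\<in>F. set (snd f) \<subseteq> e"
  shows "has_treewidth 1 k I"
proof (cases "F = {}")
  case True
  then have "I = {}" using assms(3) by auto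
  then have "adom I = {}" by (simp add: adom_def)
  \<comment> \<open>A tree has at least one node, so the empty family is represented by one empty
    bag.\<close>
  then have "tree_decomposition I {0} {} (\<lambda>_. {})"
    unfolding tree_decomposition_def using is_tree_singleton[of 0] \<open>I = {}\<close> by simp
  then have "lk_tree_decomposition 1 k I {0} {} (\<lambda>_. {})"
    unfolding lk_tree_decomposition_def by simp
  then show ?thesis unfolding has_treewidth_def by (intro exI)
next
  case False
  then obtain e where "grows e F" using assms(1) by (auto simp: forest_def)
  then obtain V E B where "join_tree F V E B" using grows_join_tree by blast
  then have T: "is_tree V E" "B ` V = F" "\<And>x. connected_in {v\<in>V. x \<in> B v} E"
     "\<And>v v'. v \<in> V \<Longrightarrow> v' \<in> V \<Longrightarrow> v \<noteq> v' \<Longrightarrow> at_most_one (B v \<inter> B v')"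
    by (simp_all add: join_tree_def)
  \<comment> \<open>Blocks may contain vertices without facts, while bags have to stay inside
    \<open>adom I\<close>.\<close>
  let ?B = "\<lambda>v. B v \<inter> adom I"
  have bag: "card (B v) \<le> k" "finite (B v)" if "v \<in> V" for v
    using assms(2)[of "B v"] T(2) that by auto
  have "lk_tree_decomposition 1 k I V E ?B"
    unfolding lk_tree_decomposition_def tree_decomposition_def
  proof (intro conjI ballI impI)
    show "is_tree V E" by (rule T(1))
    show "?B v \<subseteq> adom I" for v by blast
    show "connected_in {v\<in>V. a \<in> ?B v} E" if "a \<in> adom I" for a using T(3)[of a] that by simp
    show "{v\<in>V. a \<in> ?B v} \<noteq> {}" if a: "a \<in> adom I" for a
    proof -
      obtain f where "f \<in> I" "a \<in> set (snd f)" using a unfolding adom_def by blast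
      then obtain b where b: "b \<in> F" "a \<in> b" using assms(3) by blast
      then obtain v where "v \<in> V" "B v = b" using T(2) by (metis imageE)
      then have "v \<in> {v\<in>V. a \<in> ?B v}" using a b by simp
      then show ?thesis by blast
    qed
    show "\<exists>v\<in>V. set (snd f) \<subseteq> ?B v" if f: "f \<in> I" for f
    proof -
      obtain b where b: "b \<in> F" "set (snd f) \<subseteq> b" using assms(3) f by blast
      then obtain v where "v \<in> V" "B v = b" using T(2) by (metis imageE)
      moreover have "set (snd f) \<subseteq> adom I" using f unfolding adom_def by blast
      ultimately show ?thesis using b(2) by blast
    qed
    show "card (?B v \<inter> ?B v') \<le> 1" if "v \<in> V" "v' \<in> V" "v \<noteq> v'" for v v'
    proof -
      have "at_most_one (?B v \<inter> ?B v')" using T(4)[OF that] by (rule at_most_one_subset) blast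
      then show ?thesis using at_most_one_card by blast
    qed
    show "card (?B v) \<le> k" if "v \<in> V" for v
      using bag[OF that] card_mono[of "B v" "?B v"] by simp
  qed
  then show ?thesis unfolding has_treewidth_def by (intro exI)
qed

lemma sparse_cover_treewidth:
  assumes "sparse_cover n k I B" "T \<subseteq> I" "finite T" "card T \<le> n"
  shows "has_treewidth 1 k T"
proof -
  have "\<forall>f\<in>T. \<exists>e\<in>B. set (snd f) \<subseteq> e" using assms(1,2) by (auto simp: sparse_cover_def)
  then obtain c where c: "\<And>f. f \<in> T \<Longrightarrow> c f \<in> B \<and> set (snd f) \<subseteq> c f" by metis
  have "card (c ` T) \<le> n" using card_image_le[OF assms(3), of c] assms(4) by linarith
  then have "forest (c ` T)"
    using assms(1,3) c unfolding sparse_cover_def locally_forest_def by (simp add: image_subset_iff)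
  then show ?thesis
  proof (rule forest_has_treewidth)
    show "card e \<le> k \<and> finite e" if "e \<in> c ` T" for e
      using that c assms(1) unfolding sparse_cover_def by blast
    show "\<forall>f\<in>T. \<exists>e\<in>c ` T. set (snd f) \<subseteq> e" using c by blast
  qed
qed

section \<open>Renaming of constants\<close>

definition rename :: "(nat \<Rightarrow> nat) \<Rightarrow> fact set \<Rightarrow> fact set" where
  "rename h I = (\<lambda>f. (fst f, map h (snd f))) ` I"

lemma hom_rename: "hom h I (rename h I)"
  by (simp add: hom_def rename_def)

lemma adom_rename: "adom (rename h I) = h ` adom I"
  by (simp add: adom_def rename_def image_UN)

lemma rename_inverse:
  assumes "inj_on h (adom I)"
  shows "hom (inv_into (adom I) h) (rename h I) I"
proof (rule homI)
  fix R ys assume "(R, ys) \<in> rename h I"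
  then obtain xs where xs: "(R, xs) \<in> I" "ys = map h xs" by (fastforce simp: rename_def)
  have "map (inv_into (adom I) h) (map h xs) = xs"
    using adom_fact[OF xs(1)] assms by (auto intro!: map_idI simp: inv_into_f_f)
  then show "(R, map (inv_into (adom I) h) ys) \<in> I" using xs by simp
qed

lemma has_treewidth_rename:
  assumes "has_treewidth l k I" "inj_on h (adom I)"
  shows "has_treewidth l k (rename h I)"
proof -
  obtain V E B where T: "lk_tree_decomposition l k I V E B"
    using assms(1) by (auto simp: has_treewidth_def)
  have B: "\<And>v. v \<in> V \<Longrightarrow> B v \<subseteq> adom I"
    using T by (auto simp: lk_tree_decomposition_def tree_decomposition_def)
  have inj: "inj_on h (B v)" if "v \<in> V" for v using B[OF that] assms(2) by (rule inj_on_subset[rotated])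
  have mem: "h a \<in> h ` B v \<longleftrightarrow> a \<in> B v" if "a \<in> adom I" "v \<in> V" for a v
    using that B assms(2) by (meson inj_on_image_mem_iff)
  have "lk_tree_decomposition l k (rename h I) V E (\<lambda>v. h ` B v)"
    unfolding lk_tree_decomposition_def tree_decomposition_def adom_rename
  proof (intro conjI ballI impI)
    show "is_tree V E" using T by (simp add: lk_tree_decomposition_def tree_decomposition_def)
    show "h ` B v \<subseteq> h ` adom I" if "v \<in> V" for v using B[OF that] by blast
    fix b assume "b \<in> h ` adom I"
    then obtain a where a: "a \<in> adom I" "b = h a" by blast
    then have "{v\<in>V. b \<in> h ` B v} = {v\<in>V. a \<in> B v}" using mem by auto
    then show "{v\<in>V. b \<in> h ` B v} \<noteq> {}" "connected_in {v\<in>V. b \<in> h ` B v} E"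
      using T a(1) by (auto simp: lk_tree_decomposition_def tree_decomposition_def)
  next
    fix f assume "f \<in> rename h I"
    then obtain f' where f': "f' \<in> I" "f = (fst f', map h (snd f'))" by (auto simp: rename_def)
    then obtain v where "v \<in> V" "set (snd f') \<subseteq> B v"
      using T unfolding lk_tree_decomposition_def tree_decomposition_def by blast
    then show "\<exists>v\<in>V. set (snd f) \<subseteq> h ` B v" using f'(2) by auto
  next
    fix v v' assume v: "v \<in> V" "v' \<in> V" "v \<noteq> v'"
    have "h ` B v \<inter> h ` B v' = h ` (B v \<inter> B v')"
      using inj_on_image_Int[OF assms(2) B[OF v(1)] B[OF v(2)]] by simp
    moreover have "card (h ` (B v \<inter> B v')) = card (B v \<inter> B v')"
      using inj[OF v(1)] by (intro card_image) (auto intro: inj_on_subset)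
    ultimately show "card (h ` B v \<inter> h ` B v') \<le> l"
      using T v by (auto simp: lk_tree_decomposition_def)
  next
    fix v assume v: "v \<in> V"
    show "card (h ` B v) \<le> k"
      using card_image[OF inj[OF v]] T v by (auto simp: lk_tree_decomposition_def)
  qed
  then show ?thesis unfolding has_treewidth_def by (intro exI)
qed

section \<open>Locality of first-order sentences\<close>

fun qrank :: "fo \<Rightarrow> nat" where
  "qrank (FAtom R xs) = 0"
| "qrank (FEq x y) = 0"
| "qrank (FNeg \<phi>) = qrank \<phi>"
| "qrank (FConj \<phi> \<psi>) = max (qrank \<phi>) (qrank \<psi>)"
| "qrank (FEx x \<phi>) = Suc (qrank \<phi>)"

text \<open>Radius \<open>1\<close> captures the facts through a pebble. A new vertex within
  \<open>radius m\<close> of a pebble has its own ball of \<open>radius m\<close>, which stays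
  within twice that distance of the pebble.\<close>

fun radius :: "nat \<Rightarrow> nat" where
  "radius 0 = 1"
| "radius (Suc m) = 2 * radius m + 1"

lemma radius_pos: "1 \<le> radius m"
  by (induction m) auto

section \<open>Disjoint unions of balls and the game played on them\<close>

type_synonym component = "(nat \<times> nat) option"

text \<open>\<open>None\<close> stands for the whole instance and \<open>Some (i, a)\<close> for the
  \<open>i\<close>-th copy of the ball around \<open>a\<close>.\<close>

definition elem :: "component \<Rightarrow> nat \<Rightarrow> nat" where
  "elem c v = to_nat (c, v)"

lemma elem_eq [simp]: "elem c v = elem c' v' \<longleftrightarrow> c = c' \<and> v = v'"
  by (simp add: elem_def)

locale adjacency =
  fixes I :: "fact set" and E :: "(nat \<times> nat) set"
  assumes adj_refl: "(x, x) \<in> E"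
    and adj_sym: "(x, y) \<in> E \<Longrightarrow> (y, x) \<in> E"
    and adj_fact: "(R, xs) \<in> I \<Longrightarrow> x \<in> set xs \<Longrightarrow> y \<in> set xs \<Longrightarrow> (x, y) \<in> E"
begin

definition ball :: "nat \<Rightarrow> nat \<Rightarrow> nat set" where
  "ball r v = {w. (v, w) \<in> E ^^ r}"

lemma ball_0: "ball 0 v = {v}"
  by (auto simp: ball_def)

lemma ball_Suc: "ball (Suc r) v = {w. \<exists>u\<in>ball r v. (u, w) \<in> E}"
  by (auto simp: ball_def)

lemma ball_trans: "u \<in> ball r v \<Longrightarrow> w \<in> ball s u \<Longrightarrow> w \<in> ball (r + s) v"
  unfolding ball_def by (auto simp: relpow_add)

lemma ball_self: "v \<in> ball r v"
proof (induction r)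
  case (Suc r)
  then show ?case using adj_refl by (auto simp: ball_Suc)
qed (simp add: ball_0)

lemma ball_mono:
  assumes "r \<le> s" shows "ball r v \<subseteq> ball s v"
proof
  fix w assume "w \<in> ball r v"
  then have "w \<in> ball (r + (s - r)) v" using ball_self ball_trans by blast
  then show "w \<in> ball s v" using assms by simp
qed

lemma ball_sym: "w \<in> ball r v \<Longrightarrow> v \<in> ball r w"
proof (induction r arbitrary: w)
  case (Suc r)
  then obtain u where u: "u \<in> ball r v" "(u, w) \<in> E" by (auto simp: ball_Suc)
  then have "u \<in> ball 1 w" using adj_sym by (simp add: ball_0 ball_Suc)
  then show ?case using ball_trans[of u 1 w v r] Suc.IH[OF u(1)] by simp
qed (simp add: ball_0)

lemma fact_in_ball:
  assumes "(S, xs) \<in> I" "w \<in> set xs" "1 \<le> r"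
  shows "set xs \<subseteq> ball r w"
proof -
  have "set xs \<subseteq> ball 1 w" using adj_fact[OF assms(1,2)] by (auto simp: ball_0 ball_Suc)
  then show ?thesis using ball_mono[OF assms(3)] by blast
qed

fun territory :: "nat \<Rightarrow> component \<Rightarrow> nat set" where
  "territory R None = UNIV"
| "territory R (Some (i, a)) = ball R a"

text \<open>The disjoint union of the structures induced on the territories of the components in \<open>C\<close>;
  nullary facts are shared.\<close>

definition copies :: "nat \<Rightarrow> component set \<Rightarrow> fact set" where
  "copies R C = {(S, map (elem c) xs) | S xs c. (S, xs) \<in> I \<and> c \<in> C \<and> set xs \<subseteq> territory R c}
     \<union> {(S, []) | S. (S, []) \<in> I}"

definition ball_components :: "nat \<Rightarrow> component set" where
  "ball_components q = {Some (i, a) | i a. i < q \<and> a \<in> adom I}"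

lemma adom_copies:
  "e \<in> adom (copies R C) \<longleftrightarrow>
     (\<exists>c\<in>C. \<exists>w S xs. e = elem c w \<and> (S, xs) \<in> I \<and> w \<in> set xs \<and> set xs \<subseteq> territory R c)"
proof
  assume "e \<in> adom (copies R C)"
  then obtain f where f: "f \<in> copies R C" "e \<in> set (snd f)" unfolding adom_def by blast
  then obtain S xs c where "(S, xs) \<in> I" "c \<in> C" "set xs \<subseteq> territory R c" "e \<in> set (map (elem c) xs)"
    unfolding copies_def by fastforce
  then show "\<exists>c\<in>C. \<exists>w S xs. e = elem c w \<and> (S, xs) \<in> I \<and> w \<in> set xs \<and> set xs \<subseteq> territory R c"
    by (metis imageE list.set_map)
next
  assume "\<exists>c\<in>C. \<exists>w S xs. e = elem c w \<and> (S, xs) \<in> I \<and> w \<in> set xs \<and> set xs \<subseteq> territory R c"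
  then obtain c w S xs where a: "c \<in> C" "e = elem c w" "(S, xs) \<in> I" "w \<in> set xs"
    "set xs \<subseteq> territory R c" by blast
  then have "(S, map (elem c) xs) \<in> copies R C" unfolding copies_def by blast
  moreover have "e \<in> set (map (elem c) xs)" using a by auto
  ultimately show "e \<in> adom (copies R C)" using adom_fact by blast
qed

text \<open>Pebbles \<open>s x\<close> and \<open>t x\<close> are copies of the same vertex \<open>p x\<close>, in the components \<open>c x\<close> and \<open>d x\<close>.\<close>

definition pebbled :: "nat \<Rightarrow> nat \<Rightarrow> nat set \<Rightarrow> (nat \<Rightarrow> nat) \<Rightarrow> (nat \<Rightarrow> component) \<Rightarrow> (nat \<Rightarrow> component) \<Rightarrow> bool" where
  "pebbled R r X p c d \<longleftrightarrow>
     (\<forall>x\<in>X. ball r (p x) \<inter> territory R (c x) = ball r (p x) \<inter> territory R (d x)) \<and>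
     (\<forall>x\<in>X. \<forall>y\<in>X. p y \<in> ball r (p x) \<longrightarrow> (c x = c y \<longleftrightarrow> d x = d y))"

lemma pebbled_ball:
  assumes "pebbled R r X p c d" "x \<in> X" "v \<in> ball r (p x)"
  shows "v \<in> territory R (c x) \<longleftrightarrow> v \<in> territory R (d x)"
proof -
  have "ball r (p x) \<inter> territory R (c x) = ball r (p x) \<inter> territory R (d x)"
    using assms(1,2) by (simp add: pebbled_def)
  then show ?thesis using assms(3) by blast
qed

lemma pebbled_near:
  "pebbled R r X p c d \<Longrightarrow> x \<in> X \<Longrightarrow> y \<in> X \<Longrightarrow> p y \<in> ball r (p x) \<Longrightarrow> c x = c y \<longleftrightarrow> d x = d y"
  by (simp add: pebbled_def)

text \<open>The invariant of an Ehrenfeucht-Fraisse game. Both sides share \<open>p\<close>, since a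
  move is always answered by a copy of the same vertex.\<close>

definition agree :: "nat \<Rightarrow> nat \<Rightarrow> nat set \<Rightarrow> component set \<Rightarrow> (nat \<Rightarrow> nat) \<Rightarrow> component set \<Rightarrow> (nat \<Rightarrow> nat) \<Rightarrow> bool" where
  "agree R r X C s D t \<longleftrightarrow> (\<exists>p c d. pebbled R r X p c d \<and>
     (\<forall>x\<in>X. c x \<in> C \<and> d x \<in> D \<and> s x = elem (c x) (p x) \<and> t x = elem (d x) (p x)))"

lemma agree_sym: "agree R r X C s D t \<Longrightarrow> agree R r X D t C s"
proof -
  assume "agree R r X C s D t"
  then obtain p c d where a: "pebbled R r X p c d"
     "\<forall>x\<in>X. c x \<in> C \<and> d x \<in> D \<and> s x = elem (c x) (p x) \<and> t x = elem (d x) (p x)"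
    unfolding agree_def by blast
  then have "pebbled R r X p d c" unfolding pebbled_def by (metis)
  then show ?thesis using a(2) unfolding agree_def by metis
qed

text \<open>A fact through a pebble lies within distance one of it. At that distance pebbles of a
  common component stay together and the two territories coincide.\<close>

lemma agree_atom:
  assumes "agree R r X C s D t" "1 \<le> r" "set xs \<subseteq> X" "(S, map s xs) \<in> copies R C"
  shows "(S, map t xs) \<in> copies R D"
proof (cases xs)
  case Nil
  then show ?thesis using assms(4) by (auto simp: copies_def)
next
  case (Cons x0 xs0)
  obtain p c d where pb: "pebbled R r X p c d"
     and el: "\<And>x. x \<in> X \<Longrightarrow> c x \<in> C \<and> d x \<in> D \<and> s x = elem (c x) (p x) \<and> t x = elem (d x) (p x)"
    using assms(1) unfolding agree_def by blast
  obtain ys c0 where ys: "(S, ys) \<in> I" "set ys \<subseteq> territory R c0" "map s xs = map (elem c0) ys"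
    using assms(4) Cons unfolding copies_def by auto
  have len: "length ys = length xs" using ys(3) by (metis length_map)
  have nth: "c (xs ! i) = c0 \<and> p (xs ! i) = ys ! i" if "i < length xs" for i
  proof -
    have "s (xs ! i) = elem c0 (ys ! i)" using ys(3) that len by (metis nth_map)
    moreover have "xs ! i \<in> X" using that assms(3) by auto
    ultimately show ?thesis using el[of "xs ! i"] by simp
  qed
  have p: "map p xs = ys" using nth len by (simp add: list_eq_iff_nth_eq)
  have c: "c x = c0" if "x \<in> set xs" for x using that nth by (metis in_set_conv_nth)
  have x0: "x0 \<in> set xs" using Cons by simp
  have near: "p x \<in> ball r (p x0)" if "x \<in> set xs" for x
  proof -
    have "p x0 \<in> set ys" "p x \<in> set ys" using that x0 unfolding p[symmetric] by auto
    then show ?thesis using fact_in_ball[OF ys(1) _ assms(2)] by blast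
  qed
  have d: "d x = d x0" if "x \<in> set xs" for x
  proof -
    have "x0 \<in> X" "x \<in> X" using that x0 assms(3) by blast+
    from pebbled_near[OF pb this near[OF that]] show ?thesis using c[OF that] c[OF x0] by simp
  qed
  have "p x \<in> territory R (d x0)" if "x \<in> set xs" for x
  proof -
    have "p x \<in> territory R (c x0)" using that ys(2) p c[OF x0] by auto
    then show ?thesis using pebbled_ball[OF pb _ near[OF that]] x0 assms(3) by auto
  qed
  then have "set ys \<subseteq> territory R (d x0)" using p by auto
  moreover have "d x0 \<in> D" using el x0 assms(3) by blast
  moreover have "t x = elem (d x0) (p x)" if "x \<in> set xs" for x
    using el[of x] d[OF that] that assms(3) by auto
  then have "map t xs = map (elem (d x0)) ys" unfolding p[symmetric] by simp
  ultimately show ?thesis using ys(1) unfolding copies_def by blast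
qed

lemma fresh_component:
  assumes "finite X" "card X < q"
  shows "\<exists>i<q. \<forall>x\<in>X. d x \<noteq> Some (i, a)"
proof (rule ccontr)
  assume "\<not> ?thesis"
  then have "\<forall>i<q. \<exists>x\<in>X. d x = Some (i, a)" by simp
  have "(\<lambda>i. Some (i, a)) ` {..<q} \<subseteq> d ` X"
  proof (rule image_subsetI)
    fix i assume "i \<in> {..<q}"
    then obtain x where "x \<in> X" "d x = Some (i, a)"
      using \<open>\<forall>i<q. \<exists>x\<in>X. d x = Some (i, a)\<close> by (meson lessThan_iff)
    then show "Some (i, a) \<in> d ` X" by (metis imageI)
  qed
  then have "card ((\<lambda>i. Some (i, a)) ` {..<q}) \<le> card (d ` X)" using assms(1) by (simp add: card_mono)
  moreover have "card ((\<lambda>i. Some (i, a)) ` {..<q}) = q" by (simp add: card_image inj_on_def)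
  ultimately show False using card_image_le[OF assms(1), of d] assms(2) by linarith
qed

text \<open>Close to an old pebble of its component the answer is the corresponding vertex next to the
  answering pebble; otherwise it is the same vertex in an unused copy of a ball.\<close>

lemma agree_extend:
  assumes ag: "agree R (radius (Suc m)) X C s D t" and X: "finite X" "card X < q"
    and rad: "radius (Suc m) \<le> R"
    and C: "C \<subseteq> insert None (ball_components q)" and D: "ball_components q \<subseteq> D"
    and e: "e \<in> adom (copies R C)"
  shows "\<exists>e'\<in>adom (copies R D). agree R (radius m) (insert x X) C (s(x := e)) D (t(x := e'))"
proof -
  obtain p c d where pb: "pebbled R (radius (Suc m)) X p c d"
     and el: "\<And>x. x \<in> X \<Longrightarrow> c x \<in> C \<and> d x \<in> D \<and> s x = elem (c x) (p x) \<and> t x = elem (d x) (p x)"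
    using ag unfolding agree_def by blast
  obtain c0 w S xs where w: "c0 \<in> C" "e = elem c0 w" "(S, xs) \<in> I" "w \<in> set xs"
    "set xs \<subseteq> territory R c0" using e unfolding adom_copies by blast
  have wI: "w \<in> adom I" using adom_fact[OF w(3)] w(4) by blast
  have big: "1 \<le> radius m" by (rule radius_pos)
  have "\<exists>d0\<in>D. set xs \<subseteq> territory R d0 \<and>
          ball (radius m) w \<inter> territory R c0 = ball (radius m) w \<inter> territory R d0 \<and>
          (\<forall>z\<in>X - {x}. w \<in> ball (radius m) (p z) \<longrightarrow> (c0 = c z \<longleftrightarrow> d0 = d z))"
  \<comment> \<open>The old pebble of \<open>x\<close> is disregarded because the quantifier may
    rebind \<open>x\<close>.\<close>
  proof (cases "\<exists>y\<in>X - {x}. c y = c0 \<and> w \<in> ball (radius m) (p y)")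
    case True
    then obtain y where y: "y \<in> X" "c y = c0" "w \<in> ball (radius m) (p y)" by blast
    have sub: "ball r w \<subseteq> ball (radius (Suc m)) (p y)" if "r \<le> radius m" for r
    proof
      fix u assume "u \<in> ball r w"
      then have "u \<in> ball (radius m + r) (p y)" by (rule ball_trans[OF y(3)])
      moreover have "radius m + r \<le> radius (Suc m)" using that by simp
      ultimately show "u \<in> ball (radius (Suc m)) (p y)" using ball_mono by blast
    qed
    have eq: "ball (radius (Suc m)) (p y) \<inter> territory R c0 = ball (radius (Suc m)) (p y) \<inter> territory R (d y)"
      using pebbled_ball[OF pb y(1)] y(2) by auto
    have "set xs \<subseteq> ball (radius (Suc m)) (p y)"
      using fact_in_ball[OF w(3,4), of 1] sub[of 1] big by blast
    then have "set xs \<subseteq> territory R (d y)" using eq w(5) by blast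
    moreover have "ball (radius m) w \<inter> territory R c0 = ball (radius m) w \<inter> territory R (d y)"
      using eq sub[of "radius m"] by blast
    moreover have "c0 = c z \<longleftrightarrow> d y = d z" if "z \<in> X - {x}" "w \<in> ball (radius m) (p z)" for z
    proof -
      have "p z \<in> ball (radius (Suc m)) (p y)"
        using ball_sym[OF that(2)] sub[of "radius m"] by blast
      then show ?thesis using pebbled_near[OF pb y(1), of z] y(2) that(1) by simp
    qed
    moreover have "d y \<in> D" using el y by blast
    ultimately show ?thesis by blast
  next
    case False
    \<comment> \<open>A vertex of the whole instance is answered in the ball centered at itself, a
      vertex of a ball in another copy with the same center.\<close>
    define a where "a = (case c0 of None \<Rightarrow> w | Some (i, a) \<Rightarrow> a)"
    have "a \<in> adom I" using w(1) C wI by (auto simp: a_def ball_components_def split: option.splits)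
    obtain i where i: "i < q" "\<forall>z\<in>X. d z \<noteq> Some (i, a)" using fresh_component[OF X, of d a] by auto
    let ?d = "Some (i, a)"
    have "?d \<in> D" using D i(1) \<open>a \<in> adom I\<close> unfolding ball_components_def by blast
    moreover have "set xs \<subseteq> territory R ?d \<and>
       ball (radius m) w \<inter> territory R c0 = ball (radius m) w \<inter> territory R ?d"
    proof (cases c0)
      case None
      have "set xs \<subseteq> ball R w" using fact_in_ball[OF w(3,4)] rad by simp
      moreover have "ball (radius m) w \<subseteq> ball R w" using rad by (intro ball_mono) simp
      ultimately show ?thesis using None by (auto simp: a_def)
    next
      case (Some b)
      then show ?thesis using w(5) by (cases b) (simp add: a_def)
    qed
    moreover have "c0 \<noteq> c z \<and> ?d \<noteq> d z" if "z \<in> X - {x}" "w \<in> ball (radius m) (p z)" for z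
      using False i(2) that by (metis DiffD1)
    ultimately show ?thesis by blast
  qed
  then obtain d0 where d0: "d0 \<in> D" "set xs \<subseteq> territory R d0"
    "ball (radius m) w \<inter> territory R c0 = ball (radius m) w \<inter> territory R d0"
    "\<And>z. z \<in> X - {x} \<Longrightarrow> w \<in> ball (radius m) (p z) \<Longrightarrow> c0 = c z \<longleftrightarrow> d0 = d z" by blast
  let ?p = "p(x := w)" and ?c = "c(x := c0)" and ?d = "d(x := d0)"
  have "pebbled R (radius m) (insert x X) ?p ?c ?d"
    unfolding pebbled_def
  proof (intro conjI ballI impI)
    fix y assume y: "y \<in> insert x X"
    show "ball (radius m) (?p y) \<inter> territory R (?c y) = ball (radius m) (?p y) \<inter> territory R (?d y)"
    proof (cases "y = x")
      case False
      then have "ball (radius (Suc m)) (p y) \<inter> territory R (c y) = ball (radius (Suc m)) (p y) \<inter> territory R (d y)"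
        using pebbled_ball[OF pb] y by auto
      moreover have "ball (radius m) (p y) \<subseteq> ball (radius (Suc m)) (p y)" by (rule ball_mono) simp
      ultimately show ?thesis using False by auto
    qed (use d0 in simp)
    fix z assume z: "z \<in> insert x X" and near: "?p z \<in> ball (radius m) (?p y)"
    show "(?c y = ?c z) = (?d y = ?d z)"
    proof (cases "y = x"; cases "z = x")
      assume "y \<noteq> x" "z \<noteq> x"
      moreover have "ball (radius m) (p y) \<subseteq> ball (radius (Suc m)) (p y)" by (rule ball_mono) simp
      ultimately show ?thesis using pebbled_near[OF pb, of y z] y z near by auto
    next
      assume "y = x" "z \<noteq> x"
      then show ?thesis using d0(4)[of z] z ball_sym near by auto
    next
      assume "y \<noteq> x" "z = x"
      then show ?thesis using d0(4)[of y] y near by auto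
    qed simp
  qed
  then have "agree R (radius m) (insert x X) C (s(x := e)) D (t(x := elem d0 w))"
    unfolding agree_def using el w(1,2) d0(1)
    by (intro exI[of _ ?p] exI[of _ ?c] exI[of _ ?d]) simp
  moreover have "elem d0 w \<in> adom (copies R D)"
    unfolding adom_copies using d0(1,2) w(3,4) by blast
  ultimately show ?thesis by blast
qed

text \<open>Pebbles placed plus rounds left stay within \<open>q\<close>, so every move finds a
  fresh copy. The same bounds on \<open>C\<close> and \<open>D\<close> let
  \<open>agree_extend\<close> serve both directions.\<close>

lemma agree_sat:
  assumes "fo_fv \<phi> \<subseteq> X" "finite X" "card X + m \<le> q" "qrank \<phi> \<le> m" "radius m \<le> R"
    and C: "ball_components q \<subseteq> C" "C \<subseteq> insert None (ball_components q)"
    and D: "ball_components q \<subseteq> D" "D \<subseteq> insert None (ball_components q)"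
    and "agree R (radius m) X C s D t"
  shows "fo_sat (copies R C) s \<phi> \<longleftrightarrow> fo_sat (copies R D) t \<phi>"
  using assms(1-5,10)
proof (induction \<phi> arbitrary: X m s t)
  case (FAtom S xs)
  then show ?case
    using agree_atom[of R "radius m" X C s D t xs S] agree_atom[of R "radius m" X D t C s xs S]
      agree_sym radius_pos[of m] by auto
next
  case (FEq x y)
  then obtain p c d where pb: "pebbled R (radius m) X p c d"
     and el: "\<And>x. x \<in> X \<Longrightarrow> s x = elem (c x) (p x) \<and> t x = elem (d x) (p x)"
    unfolding agree_def by blast
  have xy: "x \<in> X" "y \<in> X" using FEq by auto
  have "p x = p y \<Longrightarrow> c x = c y \<longleftrightarrow> d x = d y"
    using pebbled_near[OF pb xy] ball_self[of "p x"] by simp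
  then show ?case using el xy by auto
next
  case (FNeg \<phi>)
  then show ?case by simp
next
  case (FConj \<phi> \<psi>)
  have "fo_sat (copies R C) s \<phi> = fo_sat (copies R D) t \<phi>"
    by (rule FConj.IH(1)[of X m]) (use FConj.prems in auto)
  moreover have "fo_sat (copies R C) s \<psi> = fo_sat (copies R D) t \<psi>"
    by (rule FConj.IH(2)[of X m]) (use FConj.prems in auto)
  ultimately show ?case by simp
next
  case (FEx x \<phi>)
  then obtain m' where m: "m = Suc m'" "qrank \<phi> \<le> m'" by (cases m) auto
  have IH: "fo_sat (copies R C) s' \<phi> = fo_sat (copies R D) t' \<phi>"
    if "agree R (radius m') (insert x X) C s' D t'" for s' t'
  proof (rule FEx.IH[OF _ _ _ m(2) _ that])
    show "fo_fv \<phi> \<subseteq> insert x X" "finite (insert x X)" using FEx.prems by auto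
    show "card (insert x X) + m' \<le> q" using FEx.prems m card_insert_le_m1[of "Suc (card X)" X x]
      by (simp add: card_insert_if)
    show "radius m' \<le> R" using FEx.prems m by simp
  qed
  have X: "finite X" "card X < q" "radius (Suc m') \<le> R" using FEx.prems m by auto
  have ag: "agree R (radius (Suc m')) X C s D t" using FEx.prems m by simp
  show ?case
  proof
    assume "fo_sat (copies R C) s (FEx x \<phi>)"
    then obtain e where e: "e \<in> adom (copies R C)" "fo_sat (copies R C) (s(x := e)) \<phi>" by auto
    then obtain e' where "e' \<in> adom (copies R D)" "agree R (radius m') (insert x X) C (s(x := e)) D (t(x := e'))"
      using agree_extend[OF ag X C(2) D(1)] by blast
    then show "fo_sat (copies R D) t (FEx x \<phi>)" using IH e(2) by auto
  next
    assume "fo_sat (copies R D) t (FEx x \<phi>)"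
    then obtain e where e: "e \<in> adom (copies R D)" "fo_sat (copies R D) (t(x := e)) \<phi>" by auto
    then obtain e' where "e' \<in> adom (copies R C)" "agree R (radius m') (insert x X) D (t(x := e)) C (s(x := e'))"
      using agree_extend[OF agree_sym[OF ag] X D(2) C(1)] by blast
    then show "fo_sat (copies R C) s (FEx x \<phi>)" using IH[OF agree_sym] e(2) by auto
  qed
qed

lemma sentence_copies:
  assumes "fo_fv \<phi> = {}"
  shows "fo_sat (copies (radius (qrank \<phi>)) (insert None (ball_components (qrank \<phi>)))) s \<phi> \<longleftrightarrow>
         fo_sat (copies (radius (qrank \<phi>)) (ball_components (qrank \<phi>))) s \<phi>"
  by (rule agree_sat[of _ "{}" "qrank \<phi>" "qrank \<phi>"])
    (use assms in \<open>auto simp: agree_def pebbled_def\<close>)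

lemma instance_over_copies:
  assumes "instance_over SE I" "finite C"
  shows "instance_over SE (copies R C)"
  unfolding instance_over_def
proof
  have I: "finite I" "\<And>S xs. (S, xs) \<in> I \<Longrightarrow> S \<in> SE \<and> length xs = snd S"
    using assms(1) by (auto simp: instance_over_def)
  have "copies R C \<subseteq> (\<lambda>(c, f). (fst f, map (elem c) (snd f))) ` (C \<times> I) \<union> I"
    by (auto simp: copies_def image_iff) (metis fst_conv snd_conv)
  then show "finite (copies R C)" using I(1) assms(2) by (meson finite_SigmaI finite_UnI finite_imageI finite_subset)
  show "\<forall>(S, cs)\<in>copies R C. S \<in> SE \<and> length cs = snd S"
    using I(2) unfolding copies_def by fastforce
qed

lemma hom_copies: "None \<in> C \<Longrightarrow> hom (elem None) I (copies R C)"
proof (rule homI)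
  fix S xs assume "None \<in> C" "(S, xs) \<in> I"
  moreover have "set xs \<subseteq> territory R None" by simp
  ultimately show "(S, map (elem None) xs) \<in> copies R C" unfolding copies_def by blast
qed

lemma finite_ball_components: "finite (adom I) \<Longrightarrow> finite (ball_components q)"
proof -
  assume "finite (adom I)"
  moreover have "ball_components q = Some ` ({..<q} \<times> adom I)" by (auto simp: ball_components_def)
  ultimately show ?thesis by simp
qed

end

section \<open>Folding balls of sparse instances\<close>

lemma hom_cong:
  assumes "hom h I T" "\<And>f x. f \<in> I \<Longrightarrow> x \<in> set (snd f) \<Longrightarrow> g x = h x"
  shows "hom g I T"
  unfolding hom_def
proof
  fix f assume f: "f \<in> I"
  have eq: "map g (snd f) = map h (snd f)" using assms(2)[OF f] by simp
  show "(fst f, map g (snd f)) \<in> T" unfolding eq using assms(1) f by (simp add: hom_def)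
qed

definition facts_in :: "fact set \<Rightarrow> nat set \<Rightarrow> fact set" where
  "facts_in I e = {f \<in> I. set (snd f) \<subseteq> e}"

text \<open>A simulation of bounded depth: whichever block is entered at \<open>v\<close> has an
  image in \<open>T\<close> entered at \<open>b\<close>, and the game continues at each of its
  vertices. On a tree of blocks it unfolds into a homomorphism.\<close>

fun sim :: "fact set \<Rightarrow> nat set set \<Rightarrow> fact set \<Rightarrow> nat \<Rightarrow> nat \<Rightarrow> nat \<Rightarrow> bool" where
  "sim I B T 0 v b \<longleftrightarrow> True"
| "sim I B T (Suc d) v b \<longleftrightarrow> (\<forall>e\<in>B. v \<in> e \<longrightarrow>
     (\<exists>h. h v = b \<and> hom h (facts_in I e) T \<and> (\<forall>c\<in>e. sim I B T d c (h c))))"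

lemma sim_Suc_D: "sim I B T (Suc d) v b \<Longrightarrow> sim I B T d v b"
proof (induction d arbitrary: v b)
  case (Suc d)
  then show ?case by (subst sim.simps(2)) (metis sim.simps(2))
qed simp

lemma sim_mono: "sim I B T d v b \<Longrightarrow> T \<subseteq> T' \<Longrightarrow> sim I B T' d v b"
proof (induction d arbitrary: v b)
  case (Suc d)
  show ?case
    unfolding sim.simps
  proof (intro ballI impI)
    fix e assume "e \<in> B" "v \<in> e"
    then obtain h where h: "h v = b" "hom h (facts_in I e) T" "\<forall>c\<in>e. sim I B T d c (h c)"
      using Suc.prems(1) by auto
    have "hom h (facts_in I e) T'" using h(2) Suc.prems(2) unfolding hom_def by blast
    moreover have "\<forall>c\<in>e. sim I B T' d c (h c)" using h(3) Suc.IH Suc.prems(2) by blast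
    ultimately show "\<exists>h. h v = b \<and> hom h (facts_in I e) T' \<and> (\<forall>c\<in>e. sim I B T' d c (h c))"
      using h(1) by blast
  qed
qed simp

text \<open>Connected families around \<open>a\<close>. In contrast to \<open>grows\<close>, a new
  block has to meet the old vertices, possibly in several of them, which reverses the counting
  inequality.\<close>

inductive reach :: "'a \<Rightarrow> 'a set set \<Rightarrow> bool" for a where
  empty: "reach a {}"
| step: "reach a C \<Longrightarrow> f \<inter> insert a (\<Union>C) \<noteq> {} \<Longrightarrow> reach a (insert f C)"

lemma reach_finite: "reach a C \<Longrightarrow> finite C"
  by (induction rule: reach.induct) auto

lemma reach_root: "reach a C \<Longrightarrow> C \<noteq> {} \<Longrightarrow> a \<in> \<Union>C"
  by (induction rule: reach.induct) auto

lemma reach_union: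
  assumes "reach a C'" "reach a C" shows "reach a (C \<union> C')"
  using assms
proof (induction rule: reach.induct)
  case (step C' f)
  then have "reach a (C \<union> C')" by simp
  moreover have "f \<inter> insert a (\<Union>(C \<union> C')) \<noteq> {}" using step.hyps(2) by blast
  ultimately have "reach a (insert f (C \<union> C'))" by (rule reach.step)
  then show ?case by simp
qed simp

lemma reach_card:
  assumes "reach a C" "\<And>f. f \<in> C \<Longrightarrow> finite f"
  shows "int (card (insert a (\<Union>C))) \<le> 1 + (\<Sum>f\<in>C. int (card f) - 1)"
  using assms
proof (induction rule: reach.induct)
  case (step C f)
  let ?V = "insert a (\<Union>C)"
  have finC: "finite C" using reach_finite[OF step.hyps(1)] .
  then have finV: "finite ?V" using step.prems by auto
  have IH: "int (card ?V) \<le> 1 + (\<Sum>f\<in>C. int (card f) - 1)" using step by auto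
  show ?case
  proof (cases "f \<in> C")
    case True
    then show ?thesis using IH by (simp add: insert_absorb)
  next
    case False
    have "card (f \<union> ?V) + card (f \<inter> ?V) = card f + card ?V"
      using card_Un_Int[of f ?V] finV step.prems by simp
    moreover have "card (f \<inter> ?V) > 0" using step.hyps(2) finV by (simp add: card_gt_0_iff)
    moreover have "insert a (\<Union>(insert f C)) = f \<union> ?V" by auto
    ultimately show ?thesis using IH False finC by simp
  qed
qed simp

text \<open>In an acyclic family the inequality of \<open>grows_card\<close> bounds the number of vertices from below,
  while \<open>reach_card\<close> bounds it from above; a second common vertex of \<open>f\<close> and the connected
  family \<open>C\<close> would violate one of them.\<close>

lemma single_attachment:
  assumes B: "locally_forest n B" "\<And>e. e \<in> B \<Longrightarrow> finite e"
    and C: "C \<subseteq> B" "reach a C" "card C < n" and f: "f \<in> B" "f \<notin> C"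
  shows "at_most_one (f \<inter> insert a (\<Union>C))"
proof (cases "C = {}")
  case False
  let ?V = "insert a (\<Union>C)"
  have fin: "finite C" "finite ?V" "finite f" using reach_finite[OF C(2)] B(2) C(1) f by auto
  have "forest (insert f C)"
    using B(1) C f fin unfolding locally_forest_def by simp
  then have "grows f (insert f C)" by (simp add: forest_def)
  then have low: "(\<Sum>e\<in>insert f C. int (card e) - 1) + 1 \<le> int (card (\<Union>(insert f C)))"
    by (rule grows_card) (use B(2) C(1) f in auto)
  have "\<Union>(insert f C) = f \<union> ?V" using reach_root[OF C(2) False] by auto
  moreover have "card (f \<union> ?V) + card (f \<inter> ?V) = card f + card ?V"
    using card_Un_Int[of f ?V] fin by simp
  moreover have "int (card ?V) \<le> 1 + (\<Sum>f\<in>C. int (card f) - 1)"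
    by (rule reach_card) (use C B(2) in auto)
  ultimately have "card (f \<inter> ?V) \<le> 1" using low fin f by simp
  then show ?thesis
    unfolding at_most_one_def using fin by (auto simp: card_le_Suc0_iff_eq)
qed (simp add: at_most_one_def)

text \<open>Distance is measured along blocks, so balls grow by whole blocks. The diagonal makes
  them increase with the radius.\<close>

definition block_adj :: "nat set set \<Rightarrow> (nat \<times> nat) set" where
  "block_adj B = {(x, y). x = y \<or> (\<exists>e\<in>B. x \<in> e \<and> y \<in> e)}"

section \<open>Folding the balls of a sparse instance\<close>

locale sparse =
  fixes n k :: nat and I :: "fact set" and B :: "nat set set"
  assumes cover: "sparse_cover n k I B"
begin

sublocale adjacency I "block_adj B"
proof
  fix R xs x y assume a: "(R, xs) \<in> I" "x \<in> set xs" "y \<in> set xs"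
  then obtain e where "e \<in> B" "set xs \<subseteq> e" using cover unfolding sparse_cover_def by fastforce
  then show "(x, y) \<in> block_adj B" using a unfolding block_adj_def by blast
qed (auto simp: block_adj_def)

fun layer :: "nat \<Rightarrow> nat \<Rightarrow> nat set set" where
  "layer a 0 = {}"
| "layer a (Suc j) = {e\<in>B. e \<inter> ball j a \<noteq> {}}"

lemma layer_subset: "layer a j \<subseteq> B"
  by (cases j) auto

lemma layer_Suc: "layer a j \<subseteq> layer a (Suc j)"
  using ball_mono[of "j - 1" j a] by (cases j) auto

lemma ball_Suc_layer: "ball (Suc j) a = ball j a \<union> \<Union>(layer a (Suc j))"
  unfolding ball_Suc using ball_self by (auto simp: block_adj_def)

lemma layer_in_ball: "\<Union>(layer a j) \<subseteq> ball j a"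
  by (cases j) (auto simp: ball_Suc_layer)

lemma reach_ball:
  assumes "u \<in> ball j a"
  shows "\<exists>C. C \<subseteq> layer a j \<and> reach a C \<and> card C \<le> j \<and> u \<in> insert a (\<Union>C)"
  using assms
proof (induction j arbitrary: u)
  case 0
  then show ?case by (simp add: ball_0 reach.empty)
next
  case (Suc j)
  then obtain w where w: "w \<in> ball j a" "(w, u) \<in> block_adj B" by (auto simp: ball_Suc)
  obtain C where C: "C \<subseteq> layer a j" "reach a C" "card C \<le> j" "w \<in> insert a (\<Union>C)"
    using Suc.IH[OF w(1)] by blast
  show ?case
  proof (cases "w = u")
    case True
    then show ?thesis using C layer_Suc[of a j] by (intro exI[of _ C]) auto
  next
    case False
    then obtain e where e: "e \<in> B" "w \<in> e" "u \<in> e" using w(2) by (auto simp: block_adj_def)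
    have "reach a (insert e C)" using C(2,4) e(2) by (intro reach.step) auto
    moreover have "insert e C \<subseteq> layer a (Suc j)" using e w(1) C(1) layer_Suc[of a j] by auto
    moreover have "card (insert e C) \<le> Suc j" using C(3) by (simp add: card_insert_le_m1 card_insert_if reach_finite[OF C(2)])
    ultimately show ?thesis using e(3) by (intro exI[of _ "insert e C"]) auto
  qed
qed

text \<open>Two overlaps would be joined to \<open>a\<close> by connected families of at most
  \<open>Suc j\<close> blocks each. Together with \<open>f\<close> these are at most
  \<open>n\<close> blocks, so \<open>single_attachment\<close> applies.\<close>

lemma layer_attachment:
  assumes "2 * Suc j < n" "G \<subseteq> layer a (Suc j)" "layer a j \<subseteq> G" "f \<in> layer a (Suc j)" "f \<notin> G"
  shows "at_most_one (f \<inter> (ball j a \<union> \<Union>G))"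
proof -
  have ex: "\<exists>C\<subseteq>G. reach a C \<and> card C \<le> Suc j \<and> u \<in> insert a (\<Union>C)" if u: "u \<in> ball j a \<union> \<Union>G" for u
  proof (cases "u \<in> ball j a")
    case True
    then show ?thesis using reach_ball[OF True] assms(3) by (meson le_SucI order_trans)
  next
    case False
    then obtain e where e: "e \<in> G" "u \<in> e" using u by blast
    then obtain w where w: "w \<in> e" "w \<in> ball j a" using assms(2) by auto
    obtain C where C: "C \<subseteq> layer a j" "reach a C" "card C \<le> j" "w \<in> insert a (\<Union>C)"
      using reach_ball[OF w(2)] by blast
    have "reach a (insert e C)" using C(2,4) w(1) by (intro reach.step) auto
    moreover have "card (insert e C) \<le> Suc j" using C(3) by (simp add: card_insert_if reach_finite[OF C(2)])
    moreover have "insert e C \<subseteq> G" using C(1) e(1) assms(3) by blast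
    ultimately show ?thesis using e(2) by (intro exI[of _ "insert e C"]) auto
  qed
  show ?thesis
    unfolding at_most_one_def
  proof (intro allI impI)
    fix u v assume uv: "u \<in> f \<inter> (ball j a \<union> \<Union>G)" "v \<in> f \<inter> (ball j a \<union> \<Union>G)"
    obtain C where C: "C \<subseteq> G" "reach a C" "card C \<le> Suc j" "u \<in> insert a (\<Union>C)"
      using ex[of u] uv by blast
    obtain C' where C': "C' \<subseteq> G" "reach a C'" "card C' \<le> Suc j" "v \<in> insert a (\<Union>C')"
      using ex[of v] uv by blast
    have "at_most_one (f \<inter> insert a (\<Union>(C \<union> C')))"
    proof (rule single_attachment)
      show "locally_forest n B" "\<And>e. e \<in> B \<Longrightarrow> finite e" using cover by (auto simp: sparse_cover_def)
      show "C \<union> C' \<subseteq> B" using C(1) C'(1) assms(2) layer_subset by blast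
      show "reach a (C \<union> C')" by (rule reach_union[OF C'(2) C(2)])
      have "card (C \<union> C') \<le> Suc j + Suc j" using card_Un_le[of C C'] C(3) C'(3) by linarith
      then show "card (C \<union> C') < n" using assms(1) by simp
      show "f \<in> B" using assms(4) layer_subset by blast
      show "f \<notin> C \<union> C'" using assms(5) C(1) C'(1) by blast
    qed
    then show "u = v" using uv C(4) C'(4) unfolding at_most_one_def by blast
  qed
qed

text \<open>A stage within one layer. The vertices of the inner ball keep depth
  \<open>Suc d\<close>, since blocks still to come are entered through them.\<close>

definition folds :: "fact set \<Rightarrow> nat \<Rightarrow> nat \<Rightarrow> nat \<Rightarrow> nat \<Rightarrow> (nat \<Rightarrow> nat) \<Rightarrow> nat set set \<Rightarrow> bool" where
  "folds T d a b j g G \<longleftrightarrow> g a = b \<and> (\<forall>e\<in>G. hom g (facts_in I e) T) \<and>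
     (\<forall>v\<in>ball j a. sim I B T (Suc d) v (g v)) \<and> (\<forall>v\<in>\<Union>G. sim I B T d v (g v))"

text \<open>Each block of the layer meets the region mapped so far in a single vertex of the inner
  ball. The map that the simulation supplies there hence agrees with the old one.\<close>

lemma folds_layer:
  assumes n: "2 * Suc j < n" and g: "folds T d a b j g (layer a j)"
  shows "\<exists>g. folds T d a b j g (layer a (Suc j))"
proof -
  have "\<exists>g. folds T d a b j g (layer a j \<union> G)"
    if "finite G" "G \<subseteq> layer a (Suc j)" for G
    using that
  proof (induction rule: finite_induct)
    case empty
    then show ?case using g by auto
  next
    case (insert f G)
    let ?G = "layer a j \<union> G"
    obtain g where g: "folds T d a b j g ?G" using insert by blast
    show ?case
    proof (cases "f \<in> layer a j")
      case True
      then show ?thesis using g by (metis Un_insert_right insert_absorb UnI1)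
    next
      case False
      have f: "f \<in> layer a (Suc j)" "f \<notin> ?G" using insert False by auto
      then obtain z where z: "z \<in> f" "z \<in> ball j a" by auto
      have "f \<in> B" using f(1) layer_subset by blast
      have "sim I B T (Suc d) z (g z)" using g z(2) by (simp add: folds_def)
      then obtain h where h: "h z = g z" "hom h (facts_in I f) T" "\<forall>c\<in>f. sim I B T d c (h c)"
        using \<open>f \<in> B\<close> z(1) by auto
      define g' where "g' = (\<lambda>v. if v \<in> f then h v else g v)"
      have "at_most_one (f \<inter> (ball j a \<union> \<Union>?G))"
        by (rule layer_attachment[OF n _ _ f]) (use insert.prems layer_Suc[of a j] in auto)
      then have old: "g' v = g v" if "v \<in> ball j a \<union> \<Union>?G" for v
        using that z h(1) unfolding g'_def at_most_one_def by auto
      have "folds T d a b j g' (insert f ?G)"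
        unfolding folds_def
      proof (intro conjI ballI)
        show "g' a = b" using old[of a] ball_self g by (simp add: folds_def)
        show "sim I B T (Suc d) v (g' v)" if "v \<in> ball j a" for v
          using old[of v] that g unfolding folds_def by simp
        show "sim I B T d v (g' v)" if v: "v \<in> \<Union>(insert f ?G)" for v
        proof (cases "v \<in> f")
          case True
          then show ?thesis using h(3) by (simp add: g'_def)
        next
          case False
          then have "v \<in> \<Union>?G" using v by blast
          then show ?thesis using old[of v] g unfolding folds_def by simp
        qed
        fix e assume e: "e \<in> insert f ?G"
        show "hom g' (facts_in I e) T"
        proof (cases "e = f")
          case True
          have "g' x = h x" if "fa \<in> facts_in I f" "x \<in> set (snd fa)" for fa x
            using that by (auto simp: facts_in_def g'_def)
          then show ?thesis using hom_cong[OF h(2)] True by simp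
        next
          case False
          then have eG: "e \<in> ?G" using e by blast
          then have "hom g (facts_in I e) T" using g by (simp add: folds_def)
          then show ?thesis
          proof (rule hom_cong)
            fix fa x assume "fa \<in> facts_in I e" "x \<in> set (snd fa)"
            then have "x \<in> \<Union>?G" using eG unfolding facts_in_def by blast
            then show "g' x = g x" using old by simp
          qed
        qed
      qed
      then show ?thesis by auto
    qed
  qed
  moreover have "finite (layer a (Suc j))"
    by (rule finite_subset[OF layer_subset]) (use cover in \<open>simp add: sparse_cover_def\<close>)
  ultimately have "\<exists>g. folds T d a b j g (layer a j \<union> layer a (Suc j))" using order_refl by metis
  moreover have "layer a j \<union> layer a (Suc j) = layer a (Suc j)" using layer_Suc by blast
  ultimately show ?thesis by (simp only:)
qed

lemma ball_folds:
  assumes "2 * D < n" "sim I B T D a b" "j \<le> D"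
  shows "\<exists>g. g a = b \<and> (\<forall>e\<in>layer a j. hom g (facts_in I e) T) \<and>
     (\<forall>v\<in>ball j a. sim I B T (D - j) v (g v))"
  using assms(3)
proof (induction j)
  case 0
  then show ?case using assms(2) by (intro exI[of _ "\<lambda>_. b"]) (simp add: ball_0)
next
  case (Suc j)
  then obtain g where g: "g a = b" "\<forall>e\<in>layer a j. hom g (facts_in I e) T"
    "\<forall>v\<in>ball j a. sim I B T (D - j) v (g v)" by auto
  let ?d = "D - Suc j"
  have D: "D - j = Suc ?d" using Suc.prems by simp
  have "folds T ?d a b j g (layer a j)"
    unfolding folds_def using g layer_in_ball[of a j] sim_Suc_D unfolding D by blast
  then obtain g' where g': "folds T ?d a b j g' (layer a (Suc j))"
    using folds_layer[of j T ?d a b g] assms(1) Suc.prems by auto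
  then have "\<forall>v\<in>ball (Suc j) a. sim I B T ?d v (g' v)"
    unfolding folds_def ball_Suc_layer using sim_Suc_D by blast
  then show ?case using g' unfolding folds_def by blast
qed

text \<open>A fact inside a ball of radius \<open>R\<close> lies in a block that may stick out of
  the ball, hence depth \<open>Suc R\<close>. All copies of a ball are folded alike.\<close>

lemma copies_hom:
  assumes "2 * Suc R < n" "\<And>a. a \<in> adom I \<Longrightarrow> \<exists>b. sim I B T (Suc R) a b"
    "\<And>S. (S, []) \<in> I \<Longrightarrow> (S, []) \<in> T"
  shows "\<exists>h. hom h (copies R (ball_components q)) T"
proof -
  have "\<exists>g. \<forall>e\<in>layer a (Suc R). hom g (facts_in I e) T" if "a \<in> adom I" for a
    using assms(2)[OF that] ball_folds[OF assms(1)] by blast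
  then obtain g where g: "\<And>a e. a \<in> adom I \<Longrightarrow> e \<in> layer a (Suc R) \<Longrightarrow> hom (g a) (facts_in I e) T"
    by metis
  define h where "h = (\<lambda>w. case from_nat w :: component \<times> nat of (c, v) \<Rightarrow> g (snd (the c)) v)"
  have h: "h (elem (Some (i, a)) v) = g a v" for i a v by (simp add: h_def elem_def)
  have "hom h (copies R (ball_components q)) T"
  proof (rule homI)
    fix S ys assume "(S, ys) \<in> copies R (ball_components q)"
    then consider "ys = []" "(S, []) \<in> I"
      | xs i a where "(S, xs) \<in> I" "xs \<noteq> []" "a \<in> adom I" "set xs \<subseteq> ball R a" "ys = map (elem (Some (i, a))) xs"
      unfolding copies_def ball_components_def by fastforce
    then show "(S, map h ys) \<in> T"
    proof cases
      case 1
      then show ?thesis using assms(3) by simp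
    next
      case 2
      obtain e where e: "e \<in> B" "set xs \<subseteq> e" using cover 2(1) unfolding sparse_cover_def by fastforce
      then have "e \<in> layer a (Suc R)" using 2(2,4) by (cases xs) auto
      then have "hom (g a) (facts_in I e) T" using g 2(3) by blast
      moreover have "(S, xs) \<in> facts_in I e" using e(2) 2(1) by (simp add: facts_in_def)
      ultimately have "(S, map (g a) xs) \<in> T" by (rule homD)
      moreover have "map h ys = map (g a) xs" using 2(5) by (simp add: h)
      ultimately show ?thesis by simp
    qed
  qed
  then show ?thesis by blast
qed

end

section \<open>Bounded subinstances simulating a sparse instance\<close>

definition atoms_over :: "rel set \<Rightarrow> nat \<Rightarrow> atom set" where
  "atoms_over Rs k = {(S, xs). S \<in> Rs \<and> length xs = snd S \<and> set xs \<subseteq> {..<k}}"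

lemma finite_atoms_over:
  assumes "finite Rs" shows "finite (atoms_over Rs k)"
proof -
  have "atoms_over Rs k \<subseteq> (\<Union>S\<in>Rs. {S} \<times> {xs. set xs \<subseteq> {..<k} \<and> length xs = snd S})"
    by (auto simp: atoms_over_def)
  moreover have "finite \<dots>" using assms by (auto intro!: finite_lists_length_eq)
  ultimately show ?thesis by (rule finite_subset)
qed

text \<open>With \<open>v\<close> in front, equal patterns at \<open>v\<close> and \<open>b\<close>
  send \<open>v\<close> to \<open>b\<close>.\<close>

definition enum :: "nat set \<Rightarrow> nat \<Rightarrow> nat list" where
  "enum e v = v # sorted_list_of_set (e - {v})"

lemma enum_props:
  assumes "finite e" "v \<in> e"
  shows "set (enum e v) = e" "distinct (enum e v)" "length (enum e v) = card e" "enum e v ! 0 = v"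
proof -
  show "set (enum e v) = e" using assms by (auto simp: enum_def)
  show d: "distinct (enum e v)" using assms by (simp add: enum_def)
  show "length (enum e v) = card e" using card_Suc_Diff1[OF assms] by (simp add: enum_def)
  show "enum e v ! 0 = v" by (simp add: enum_def)
qed

lemma list_indices:
  assumes "set xs \<subseteq> set ys"
  shows "\<exists>js. set js \<subseteq> {..<length ys} \<and> xs = map ((!) ys) js"
proof -
  have "\<forall>x\<in>set xs. \<exists>i<length ys. ys ! i = x" using assms by (metis in_set_conv_nth subsetD)
  then obtain f where f: "\<And>x. x \<in> set xs \<Longrightarrow> f x < length ys \<and> ys ! f x = x" by metis
  then have "xs = map ((!) ys) (map f xs)" by (simp add: map_idI)
  moreover have "set (map f xs) \<subseteq> {..<length ys}" using f by auto
  ultimately show ?thesis by blast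
qed

text \<open>A code of the colored block pointed at \<open>v\<close>, with positions instead of
  vertices. Positions are cut off at \<open>card e\<close> because \<open>!\<close> is unspecified
  beyond the list.\<close>

definition pattern :: "rel set \<Rightarrow> nat \<Rightarrow> fact set \<Rightarrow> (nat \<Rightarrow> nat) \<Rightarrow> nat set \<Rightarrow> nat \<Rightarrow> atom set \<times> nat list" where
  "pattern SE k I col e v = ({f \<in> atoms_over SE k. set (snd f) \<subseteq> {..<card e} \<and>
      (fst f, map ((!) (enum e v)) (snd f)) \<in> I}, map col (enum e v))"

lemma facts_in_indices:
  assumes I: "instance_over SE I" and e: "finite e" "card e \<le> k" "v \<in> e" and f: "f \<in> facts_in I e"
  shows "\<exists>a \<in> fst (pattern SE k I col e v). f = (fst a, map ((!) (enum e v)) (snd a))"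
proof -
  note en = enum_props[OF e(1,3)]
  have "set (snd f) \<subseteq> set (enum e v)" using f en(1) by (simp add: facts_in_def)
  then obtain js where js: "set js \<subseteq> {..<card e}" "snd f = map ((!) (enum e v)) js"
    using list_indices en(3) by metis
  have "(fst f, snd f) \<in> I" using f by (simp add: facts_in_def)
  then have "fst f \<in> SE" "length (snd f) = snd (fst f)" using I by (auto simp: instance_over_def)
  then have "(fst f, js) \<in> atoms_over SE k" using js e(2) by (auto simp: atoms_over_def)
  then have "(fst f, js) \<in> fst (pattern SE k I col e v)"
    using js f by (simp add: pattern_def facts_in_def flip: js(2))
  then show ?thesis using js(2) by (metis fst_conv snd_conv prod.collapse)
qed

lemma card_facts_in:
  assumes "finite SE" "instance_over SE I" "finite e" "card e \<le> k" "v \<in> e"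
  shows "card (facts_in I e) \<le> card (atoms_over SE k)"
proof -
  have "facts_in I e \<subseteq> (\<lambda>a. (fst a, map ((!) (enum e v)) (snd a))) ` atoms_over SE k"
  proof
    fix f assume "f \<in> facts_in I e"
    then obtain a where "a \<in> fst (pattern SE k I id e v)" "f = (fst a, map ((!) (enum e v)) (snd a))"
      using facts_in_indices[OF assms(2-5)] by blast
    then show "f \<in> (\<lambda>a. (fst a, map ((!) (enum e v)) (snd a))) ` atoms_over SE k"
      by (auto simp: pattern_def)
  qed
  then show ?thesis using finite_atoms_over[OF assms(1)] surj_card_le by metis
qed

lemma pattern_eq_map:
  assumes I: "instance_over SE I" and e: "finite e" "card e \<le> k" "v \<in> e"
    and e': "finite e'" "b \<in> e'" and eq: "pattern SE k I col e v = pattern SE k I col e' b"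
  shows "\<exists>h. h v = b \<and> hom h (facts_in I e) (facts_in I e') \<and> (\<forall>c\<in>e. h c \<in> e' \<and> col (h c) = col c)"
proof -
  let ?l = "enum e v" and ?l' = "enum e' b"
  note en = enum_props[OF e(1,3)] and en' = enum_props[OF e']
  have cols: "map col ?l = map col ?l'" using eq by (simp add: pattern_def)
  then have len: "card e' = card e" using en(3) en'(3) by (metis length_map)
  define idx where "idx = (\<lambda>x. THE i. i < card e \<and> ?l ! i = x)"
  have idx: "idx (?l ! i) = i" if "i < card e" for i
    unfolding idx_def using that en(2,3) by (intro the_equality) (auto simp: nth_eq_iff_index_eq)
  define h where "h = (\<lambda>x. ?l' ! idx x)"
  have h: "h (?l ! i) = ?l' ! i" if "i < card e" for i using idx[OF that] by (simp add: h_def)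
  have pos: "0 < card e" using e by (auto simp: card_gt_0_iff)
  have "h v = b" using h[OF pos] en(4) en'(4) by simp
  moreover have "hom h (facts_in I e) (facts_in I e')"
    unfolding hom_def
  proof
    fix f assume "f \<in> facts_in I e"
    then obtain a where a: "a \<in> fst (pattern SE k I col e v)" "f = (fst a, map ((!) ?l) (snd a))"
      using facts_in_indices[OF I e] by blast
    then have a': "set (snd a) \<subseteq> {..<card e}" "(fst a, map ((!) ?l') (snd a)) \<in> I"
      using a(1) unfolding eq by (auto simp: pattern_def len)
    have eq_map: "map h (snd f) = map ((!) ?l') (snd a)" using a(2) a'(1) h by auto
    have "set (map ((!) ?l') (snd a)) \<subseteq> e'"

    proof
      fix x assume "x \<in> set (map ((!) ?l') (snd a))"
      then obtain i where "i < card e" "x = ?l' ! i" using a'(1) by auto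
      then show "x \<in> e'" using en'(1,3) len by (metis nth_mem)
    qed
    then show "(fst f, map h (snd f)) \<in> facts_in I e'"
      unfolding eq_map using a'(2) a(2) by (simp add: facts_in_def)
  qed
  moreover have "h c \<in> e' \<and> col (h c) = col c" if c: "c \<in> e" for c
  proof -
    obtain i where i: "i < card e" "?l ! i = c" using c en(1,3) by (metis in_set_conv_nth)
    have "h c = ?l' ! i" using h[OF i(1)] i(2) by simp
    moreover have "?l' ! i \<in> e'" using i(1) en'(1,3) len by (metis nth_mem)
    moreover have "col (?l ! i) = col (?l' ! i)" using cols i(1) en(3) en'(3) len by (metis nth_map)
    ultimately show ?thesis using i(2) by simp
  qed
  ultimately show ?thesis by blast
qed

text \<open>\<open>m\<close> counts the types of vertices at depth \<open>d\<close>, and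
  \<open>N\<close> bounds the part of \<open>I\<close> that realizes one type. Both are chosen
  before \<open>I\<close> and \<open>B\<close>.\<close>

definition simulation_bound :: "rel set \<Rightarrow> nat \<Rightarrow> nat \<Rightarrow> nat \<Rightarrow> nat \<Rightarrow> bool" where
  "simulation_bound SE k d N m \<longleftrightarrow> (\<forall>I B. instance_over SE I \<longrightarrow> (\<forall>e\<in>B. finite e \<and> card e \<le> k) \<longrightarrow>
     (\<exists>(col :: nat \<Rightarrow> nat) Tr. range col \<subseteq> {..<m} \<and>
        (\<forall>b. Tr b \<subseteq> I \<and> card (Tr b) \<le> N \<and> (\<forall>v. col v = col b \<longrightarrow> sim I B (Tr b) d v b))))"

text \<open>One round of color refinement: the new color is the set of patterns of the blocks
  through a vertex. For every pattern at \<open>b\<close> one block is kept, with its facts and the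
  parts \<open>Tr c\<close> of its at most \<open>k\<close> vertices; \<open>N'\<close> counts
  them.\<close>

lemma simulation_bound_Suc:
  assumes SE: "finite SE" and IH: "simulation_bound SE k d N m"
  shows "\<exists>N' m'. simulation_bound SE k (Suc d) N' m'"
proof -
  define PAT where "PAT = Pow (atoms_over SE k) \<times> {cs. set cs \<subseteq> {..<m} \<and> length cs \<le> k}"
  have finPAT: "finite PAT"
    using finite_atoms_over[OF SE] by (auto simp: PAT_def intro!: finite_lists_length_le)
  then obtain enc :: "(atom set \<times> nat list) set \<Rightarrow> nat" and M
    where enc: "enc ` Pow PAT = {i. i < M}" "inj_on enc (Pow PAT)"
    using finite_imp_inj_to_nat_seg[of "Pow PAT"] by auto
  define N' where "N' = card PAT * (card (atoms_over SE k) + k * N)"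
  have "simulation_bound SE k (Suc d) N' M"
    unfolding simulation_bound_def
  proof (intro allI impI)
    fix I :: "fact set" and B :: "nat set set"
    assume I: "instance_over SE I" and B: "\<forall>e\<in>B. finite e \<and> card e \<le> k"
    obtain col :: "nat \<Rightarrow> nat" and Tr where col: "range col \<subseteq> {..<m}" and
      Tr: "\<And>b. Tr b \<subseteq> I \<and> card (Tr b) \<le> N" "\<And>b v. col v = col b \<Longrightarrow> sim I B (Tr b) d v b"
      using IH[unfolded simulation_bound_def, rule_format, OF I] B by metis
    have finI: "finite I" using I by (simp add: instance_over_def)
    define pats where "pats = (\<lambda>v. {pattern SE k I col e v | e. e \<in> B \<and> v \<in> e})"
    have "pattern SE k I col e v \<in> PAT" if "e \<in> B" "v \<in> e" for e v
    proof -
      have "length (enum e v) \<le> k" using enum_props(3)[of e v] B that by auto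
      then show ?thesis using col by (auto simp: pattern_def PAT_def)
    qed
    then have pats: "pats v \<subseteq> PAT" for v by (auto simp: pats_def)
    define blk where "blk = (\<lambda>b p. SOME e. e \<in> B \<and> b \<in> e \<and> pattern SE k I col e b = p)"
    have blk: "blk b p \<in> B \<and> b \<in> blk b p \<and> pattern SE k I col (blk b p) b = p" if "p \<in> pats b" for p b
    proof -
      have "\<exists>e. e \<in> B \<and> b \<in> e \<and> pattern SE k I col e b = p" using that unfolding pats_def by blast
      then show ?thesis unfolding blk_def by (rule someI_ex)
    qed
    define piece where "piece = (\<lambda>b p. facts_in I (blk b p) \<union> \<Union>(Tr ` blk b p))"
    define Tr' where "Tr' = (\<lambda>b. \<Union>(piece b ` pats b))"
    have card_piece: "card (piece b p) \<le> card (atoms_over SE k) + k * N" if "p \<in> pats b" for b p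
    proof -
      have e: "finite (blk b p)" "card (blk b p) \<le> k" "b \<in> blk b p" using blk[OF that] B by auto
      have "card (\<Union>(Tr ` blk b p)) \<le> (\<Sum>c\<in>blk b p. card (Tr c))" by (rule card_UN_le[OF e(1)])
      also have "\<dots> \<le> (\<Sum>c\<in>blk b p. N)" using Tr(1) by (intro sum_mono) blast
      also have "\<dots> \<le> k * N" using e(2) by simp
      finally have "card (\<Union>(Tr ` blk b p)) \<le> k * N" .
      moreover have "card (facts_in I (blk b p)) \<le> card (atoms_over SE k)"
        by (rule card_facts_in[OF SE I e])
      ultimately show ?thesis
        unfolding piece_def using card_Un_le[of "facts_in I (blk b p)" "\<Union>(Tr ` blk b p)"] by linarith
    qed
    have "card (Tr' b) \<le> N'" for b
    proof -
      have fin: "finite (pats b)" using pats finPAT finite_subset by blast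
      have "card (Tr' b) \<le> (\<Sum>p\<in>pats b. card (piece b p))" unfolding Tr'_def by (rule card_UN_le[OF fin])
      also have "\<dots> \<le> (\<Sum>p\<in>pats b. card (atoms_over SE k) + k * N)"
        by (rule sum_mono) (rule card_piece)
      also have "\<dots> \<le> N'" unfolding N'_def using card_mono[OF finPAT pats, of b] by simp
      finally show ?thesis .
    qed
    moreover have "Tr' b \<subseteq> I" for b using Tr(1) by (auto simp: Tr'_def piece_def facts_in_def)
    moreover have "sim I B (Tr' b) (Suc d) v b" if "enc (pats v) = enc (pats b)" for v b
      unfolding sim.simps
    proof (intro ballI impI)
      fix e assume e: "e \<in> B" "v \<in> e"
      have "pats v = pats b" using that enc(2) pats by (simp add: inj_on_def)
      then have p: "pattern SE k I col e v \<in> pats b" using e by (auto simp: pats_def)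
      let ?e = "blk b (pattern SE k I col e v)"
      have e': "?e \<in> B" "b \<in> ?e" "pattern SE k I col e v = pattern SE k I col ?e b"
        using blk[OF p] by auto
      \<comment> \<open>Equal patterns give a map from \<open>e\<close> to the block kept at
        \<open>b\<close> that preserves the old colors, so the bound for depth \<open>d\<close>
        applies at each vertex of \<open>e\<close>.\<close>
      obtain h where h: "h v = b" "hom h (facts_in I e) (facts_in I ?e)"
        "\<And>c. c \<in> e \<Longrightarrow> h c \<in> ?e \<and> col (h c) = col c"
        using pattern_eq_map[OF I _ _ e(2) _ e'(2,3)] B e(1) e'(1) by auto
      have piece: "piece b (pattern SE k I col e v) \<subseteq> Tr' b" using p by (auto simp: Tr'_def)
      then have "hom h (facts_in I e) (Tr' b)" using h(2) unfolding hom_def piece_def by blast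
      moreover have "sim I B (Tr' b) d c (h c)" if "c \<in> e" for c
      proof (rule sim_mono)
        show "sim I B (Tr (h c)) d c (h c)" using Tr(2) h(3)[OF that] by simp
        show "Tr (h c) \<subseteq> Tr' b" using h(3)[OF that] piece unfolding piece_def by blast
      qed
      ultimately show "\<exists>h. h v = b \<and> hom h (facts_in I e) (Tr' b) \<and> (\<forall>c\<in>e. sim I B (Tr' b) d c (h c))"
        using h(1) by blast
    qed
    moreover have "range (\<lambda>v. enc (pats v)) \<subseteq> {..<M}" using enc(1) pats by blast
    ultimately show "\<exists>(col :: nat \<Rightarrow> nat) Tr. range col \<subseteq> {..<M} \<and>
        (\<forall>b. Tr b \<subseteq> I \<and> card (Tr b) \<le> N' \<and> (\<forall>v. col v = col b \<longrightarrow> sim I B (Tr b) (Suc d) v b))"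
      by (intro exI[of _ "\<lambda>v. enc (pats v)"] exI[of _ Tr']) blast
  qed
  then show ?thesis by blast
qed

lemma simulation_bound_exists:
  assumes "finite SE"
  shows "\<exists>N m. simulation_bound SE k d N m"
proof (induction d)
  case 0
  have "simulation_bound SE k 0 0 1"
    unfolding simulation_bound_def
    by (intro allI impI exI[of _ "\<lambda>_. 0"] exI[of _ "\<lambda>_. {}"]) simp
  then show ?case by blast
next
  case (Suc d)
  then show ?case using simulation_bound_Suc[OF assms] by blast
qed

text \<open>One representative per color suffices. Nullary facts, at most one per relation symbol,
  are added separately.\<close>

lemma bounded_core:
  assumes SE: "finite SE"
  shows "\<exists>N. \<forall>I B. instance_over SE I \<longrightarrow> (\<forall>e\<in>B. finite e \<and> card e \<le> k) \<longrightarrow>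
    (\<exists>T\<subseteq>I. card T \<le> N \<and> (\<forall>S. (S, []) \<in> I \<longrightarrow> (S, []) \<in> T) \<and> (\<forall>a. \<exists>b. sim I B T d a b))"
proof -
  obtain N m where bound: "simulation_bound SE k d N m" using simulation_bound_exists[OF SE] by blast
  show ?thesis
  proof (intro exI[of _ "card SE + m * N"] allI impI)
    fix I :: "fact set" and B :: "nat set set"
    assume I: "instance_over SE I" and B: "\<forall>e\<in>B. finite e \<and> card e \<le> k"
    obtain col :: "nat \<Rightarrow> nat" and Tr where col: "range col \<subseteq> {..<m}" and
      Tr: "\<And>b. Tr b \<subseteq> I \<and> card (Tr b) \<le> N" "\<And>b v. col v = col b \<Longrightarrow> sim I B (Tr b) d v b"
      using bound[unfolded simulation_bound_def, rule_format, OF I] B by metis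
    define rep where "rep = (\<lambda>x. SOME b. col b = x)"
    have rep: "col (rep (col a)) = col a" for a unfolding rep_def by (rule someI) simp
    define N0 where "N0 = {f\<in>I. snd f = []}"
    define T where "T = N0 \<union> (\<Union>x\<in>{..<m}. Tr (rep x))"
    have "N0 \<subseteq> (\<lambda>S. (S, [])) ` SE"
      using I by (force simp: N0_def instance_over_def)
    then have "card N0 \<le> card SE" using SE surj_card_le by blast
    moreover have "card (\<Union>x\<in>{..<m}. Tr (rep x)) \<le> m * N"
    proof -
      have "card (\<Union>x\<in>{..<m}. Tr (rep x)) \<le> (\<Sum>x\<in>{..<m}. card (Tr (rep x)))"
        by (rule card_UN_le) simp
      also have "\<dots> \<le> (\<Sum>x\<in>{..<m}. N)" using Tr(1) by (intro sum_mono) blast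
      finally show ?thesis by simp
    qed
    ultimately have "card T \<le> card SE + m * N"
      unfolding T_def using card_Un_le[of N0 "\<Union>x\<in>{..<m}. Tr (rep x)"] by linarith
    moreover have "T \<subseteq> I" using Tr(1) by (auto simp: T_def N0_def)
    moreover have "(S, []) \<in> T" if "(S, []) \<in> I" for S using that by (simp add: T_def N0_def)
    moreover have "sim I B T d a (rep (col a))" for a
    proof (rule sim_mono)
      show "sim I B (Tr (rep (col a))) d a (rep (col a))" using Tr(2) rep by simp
      show "Tr (rep (col a)) \<subseteq> T" using col by (auto simp: T_def)
    qed
    ultimately show "\<exists>T\<subseteq>I. card T \<le> card SE + m * N \<and> (\<forall>S. (S, []) \<in> I \<longrightarrow> (S, []) \<in> T) \<and> (\<forall>a. \<exists>b. sim I B T d a b)"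
      by blast
  qed
qed

section \<open>Rewritings into unions of conjunctive queries\<close>

lemma fo_rewriting_core:
  assumes SE: "finite SE" and P: "mddlog_program SE g P" "diameter P \<le> k"
    and \<phi>: "fo_fv \<phi> = {}" "is_rewriting SE g P (\<lambda>I. fo_sat I (\<lambda>_. 0) \<phi>)"
  shows "\<exists>N. \<forall>I. instance_over SE I \<longrightarrow> entails I g P \<longrightarrow>
    (\<exists>T h. instance_over SE T \<and> card T \<le> N \<and> has_treewidth 1 k T \<and> entails T g P \<and> hom h T I)"
proof -
  define q where "q = qrank \<phi>"
  define R where "R = radius q"
  obtain N where "\<forall>I B. instance_over SE I \<longrightarrow> (\<forall>e\<in>B. finite e \<and> card e \<le> k) \<longrightarrow>
    (\<exists>T\<subseteq>I. card T \<le> N \<and> (\<forall>S. (S, []) \<in> I \<longrightarrow> (S, []) \<in> T) \<and> (\<forall>a. \<exists>b. sim I B T (Suc R) a b))"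
    using bounded_core[OF SE, of k "Suc R"] by (elim exE)
  note N = this[rule_format]
  \<comment> \<open>\<open>N\<close> blocks cover the folded subinstance, and
    \<open>2 * Suc R < n\<close> is what folding to depth \<open>Suc R\<close> requires.\<close>
  define n where "n = N + 2 * Suc R + 1"
  have "\<exists>T h. instance_over SE T \<and> card T \<le> N \<and> has_treewidth 1 k T \<and> entails T g P \<and> hom h T I"
    if I: "instance_over SE I" "entails I g P" for I
  proof -
    obtain I' B \<pi> where I': "instance_over SE I'" "hom \<pi> I' I" "entails I' g P" "sparse_cover n k I' B"
      using sparse_instance_exists[OF P I] by blast
    interpret sparse n k I' B by standard (rule I'(4))
    have "\<forall>e\<in>B. finite e \<and> card e \<le> k" using I'(4) by (simp add: sparse_cover_def)
    then have "\<exists>T\<subseteq>I'. card T \<le> N \<and> (\<forall>S. (S, []) \<in> I' \<longrightarrow> (S, []) \<in> T) \<and>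
        (\<forall>a. \<exists>b. sim I' B T (Suc R) a b)" by (intro N[OF I'(1)]) blast
    then obtain T where T: "T \<subseteq> I'" "card T \<le> N" "\<forall>S. (S, []) \<in> I' \<longrightarrow> (S, []) \<in> T"
      "\<forall>a. \<exists>b. sim I' B T (Suc R) a b" by blast
    have finI: "finite I'" using I'(1) by (simp add: instance_over_def)
    have fin: "finite (ball_components q)"
      using finite_ball_components instance_over_finite_adom I'(1) by blast
    let ?C = "copies R (insert None (ball_components q))" and ?D = "copies R (ball_components q)"
    have inst: "instance_over SE ?C" "instance_over SE ?D"
      using instance_over_copies[OF I'(1)] fin by simp_all
    \<comment> \<open>Adding the balls is harmless by a homomorphism. Discarding the whole instance
      afterwards is not, and is the one step that relies on the sentence.\<close>
    have "entails ?C g P" by (rule entails_hom[OF I'(3) hom_copies]) simp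
    then have "fo_sat ?C (\<lambda>_. 0) \<phi>" using \<phi>(2) inst(1) by (simp add: is_rewriting_def)
    then have "fo_sat ?D (\<lambda>_. 0) \<phi>" using sentence_copies[OF \<phi>(1)] by (simp add: R_def q_def)
    then have "entails ?D g P" using \<phi>(2) inst(2) by (simp add: is_rewriting_def)
    moreover obtain h where "hom h ?D T"
      using copies_hom[of R T q] T(3,4) by (auto simp: n_def)
    ultimately have "entails T g P" by (rule entails_hom)
    moreover have "instance_over SE T" using I'(1) T(1) finite_subset by (auto simp: instance_over_def)
    moreover have "has_treewidth 1 k T"
      using sparse_cover_treewidth[OF I'(4) T(1)] finite_subset[OF T(1) finI] T(2) by (simp add: n_def)
    moreover have "hom \<pi> T I" using I'(2) T(1) unfolding hom_def by blast
    ultimately show ?thesis using T(2) by blast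
  qed
  then show ?thesis by blast
qed

text \<open>The sum of all arities serves as a crude bound on the largest one.\<close>

lemma card_adom_le:
  assumes "finite SE" "instance_over SE T"
  shows "card (adom T) \<le> card T * (\<Sum>S\<in>SE. snd S)"
proof -
  have T: "finite T" "\<And>f. f \<in> T \<Longrightarrow> fst f \<in> SE \<and> length (snd f) = snd (fst f)"
    using assms(2) by (auto simp: instance_over_def)
  have "card (adom T) \<le> (\<Sum>f\<in>T. card (set (snd f)))" unfolding adom_def by (rule card_UN_le[OF T(1)])
  also have "\<dots> \<le> (\<Sum>f\<in>T. \<Sum>S\<in>SE. snd S)"
  proof (rule sum_mono)
    fix f assume "f \<in> T"
    then have "card (set (snd f)) \<le> snd (fst f)" "fst f \<in> SE" using T(2) card_length by metis+
    moreover from this have "snd (fst f) \<le> (\<Sum>S\<in>SE. snd S)"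
      using member_le_sum[of "fst f" SE snd] assms(1) by simp
    ultimately show "card (set (snd f)) \<le> (\<Sum>S\<in>SE. snd S)" by linarith
  qed
  finally show ?thesis by simp
qed

theorem ucq_rewriting_if_fo_rewritable:
  assumes SE: "finite SE" and P: "mddlog_program SE g P" "diameter P \<le> k"
    and fo: "fo_rewritable SE g P"
  shows "\<exists>Q. ucq_rewriting SE g P Q \<and> (\<forall>q\<in>Q. has_treewidth 1 k q)"
proof -
  obtain \<phi> where "fo_fv \<phi> = {}" "is_rewriting SE g P (\<lambda>I. fo_sat I (\<lambda>_. 0) \<phi>)"
    using fo by (auto simp: fo_rewritable_def)
  then obtain N where N: "\<And>I. instance_over SE I \<Longrightarrow> entails I g P \<Longrightarrow>
    (\<exists>T h. instance_over SE T \<and> card T \<le> N \<and> has_treewidth 1 k T \<and> entails T g P \<and> hom h T I)"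
    using fo_rewriting_core[OF SE P] by metis
  define M where "M = N * (\<Sum>S\<in>SE. snd S)"
  \<comment> \<open>Each \<open>q\<close> is read both as a query and as its canonical instance;
    \<open>M\<close> variables are enough to rename any \<open>T\<close> with at most
    \<open>N\<close> facts.\<close>
  define Q where "Q = {q. q \<subseteq> atoms_over SE M \<and> has_treewidth 1 k q \<and> entails q g P}"
  have "finite Q" using finite_atoms_over[OF SE] by (simp add: Q_def)
  moreover have "cq_over SE q" if "q \<in> Q" for q
  proof -
    have "finite q" using that finite_atoms_over[OF SE] finite_subset by (auto simp: Q_def)
    then show ?thesis using that by (auto simp: Q_def cq_over_def atoms_over_def)
  qed
  moreover have "is_rewriting SE g P (\<lambda>I. ucq_sat I Q)"
    unfolding is_rewriting_def
  proof (intro allI impI iffI)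
    fix I assume "ucq_sat I Q"
    then show "entails I g P" using entails_hom unfolding ucq_sat_def cq_sat_iff_hom Q_def by blast
  next
    fix I assume I: "instance_over SE I" "entails I g P"
    obtain T h where T: "instance_over SE T" "card T \<le> N" "has_treewidth 1 k T" "entails T g P" "hom h T I"
      using N[OF I] by blast
    have finA: "finite (adom T)" using T(1) by (rule instance_over_finite_adom)
    then obtain \<rho> :: "nat \<Rightarrow> nat" where \<rho>: "\<rho> ` adom T = {..<card (adom T)}" "inj_on \<rho> (adom T)"
      using ex_bij_betw_finite_nat[of "adom T"] by (auto simp: bij_betw_def atLeast0LessThan)
    have "card (adom T) \<le> M"
      unfolding M_def using card_adom_le[OF SE T(1)] T(2) mult_le_mono1 order_trans by blast
    have "rename \<rho> T \<subseteq> atoms_over SE M"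
    proof
      fix f assume "f \<in> rename \<rho> T"
      then obtain f' where f': "f' \<in> T" "f = (fst f', map \<rho> (snd f'))" by (auto simp: rename_def)
      have "fst f' \<in> SE" "length (snd f') = snd (fst f')"
        using f'(1) T(1) by (auto simp: instance_over_def)
      moreover have "\<rho> ` set (snd f') \<subseteq> {..<M}"
      proof -
        have "set (snd f') \<subseteq> adom T" using f'(1) unfolding adom_def by blast
        then have "\<rho> ` set (snd f') \<subseteq> {..<card (adom T)}" using \<rho>(1) by blast
        then show ?thesis using \<open>card (adom T) \<le> M\<close> by auto
      qed
      ultimately show "f \<in> atoms_over SE M" using f'(2) by (simp add: atoms_over_def)
    qed
    moreover have "has_treewidth 1 k (rename \<rho> T)" by (rule has_treewidth_rename[OF T(3) \<rho>(2)])
    moreover have "entails (rename \<rho> T) g P" by (rule entails_hom[OF T(4) hom_rename])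
    ultimately have "rename \<rho> T \<in> Q" by (simp add: Q_def)
    moreover have "cq_sat I (rename \<rho> T)"
      using hom_comp[OF rename_inverse[OF \<rho>(2)] T(5)] unfolding cq_sat_iff_hom by blast
    ultimately show "ucq_sat I Q" unfolding ucq_sat_def by blast
  qed
  ultimately show ?thesis unfolding ucq_rewriting_def Q_def by blast
qed

section \<open>Monadic Datalog rewritings of small diameter\<close>

definition least_model :: "rule set \<Rightarrow> fact set \<Rightarrow> fact set" where
  "least_model P I = \<Inter>{J. I \<subseteq> J \<and> is_model P J}"

lemma entails_iff_least_model: "entails I g P \<longleftrightarrow> (g, []) \<in> least_model P I"
  by (auto simp: entails_def least_model_def)

lemma least_model_incl: "I \<subseteq> least_model P I"
  by (auto simp: least_model_def)

text \<open>Single heads are essential: a disjunctive head may be satisfied differently in different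
  models, and the intersection would lose it.\<close>

lemma least_model_rule:
  assumes "r \<in> P" "fst r = [a]" "hom h (set (snd r)) (least_model P I)"
  shows "(fst a, map h (snd a)) \<in> least_model P I"
  unfolding least_model_def
proof (rule InterI)
  fix J assume "J \<in> {J. I \<subseteq> J \<and> is_model P J}"
  then have J: "I \<subseteq> J" "is_model P J" by auto
  then have "least_model P I \<subseteq> J" by (auto simp: least_model_def)
  then have "hom h (set (snd r)) J" using assms(3) unfolding hom_def by blast
  then have "\<exists>a\<in>set (fst r). (fst a, map h (snd a)) \<in> J" using J(2) assms(1) unfolding is_model_iff by blast
  then show "(fst a, map h (snd a)) \<in> J" using assms(2) by simp
qed

lemma hom_subset: "hom h I J \<Longrightarrow> I' \<subseteq> I \<Longrightarrow> J \<subseteq> J' \<Longrightarrow> hom h I' J'"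
  unfolding hom_def by blast

definition opt_list :: "'a option \<Rightarrow> 'a list" where
  "opt_list x = (case x of None \<Rightarrow> [] | Some y \<Rightarrow> [y])"

lemma opt_list_simps [simp]: "opt_list None = []" "opt_list (Some y) = [y]"
  by (simp_all add: opt_list_def)

locale labelling =
  fixes SE :: "rel set" and g :: rel and \<Gamma> :: "rule set" and k base :: nat
  assumes finite_SE: "finite SE" and \<Gamma>: "mdlog_program SE g \<Gamma>"
    and base: "S \<in> insert g (SE \<union> idb_rels \<Gamma>) \<Longrightarrow> fst S < base"
begin

text \<open>The name codes level, query and answer variable, so a label determines them; the offset
  \<open>base\<close> separates it from the symbols of the given rewriting.\<close>

definition label :: "nat \<Rightarrow> atom list \<Rightarrow> nat option \<Rightarrow> rel" where
  "label i as x = (base + to_nat (i, as, x), length (opt_list x))"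

definition queries :: "rel set \<Rightarrow> (atom list \<times> nat option) set" where
  "queries Rs = {(as, x). distinct as \<and> set as \<subseteq> atoms_over Rs k \<and> set (opt_list x) \<subseteq> {..<k}}"

fun labels :: "nat \<Rightarrow> rel set" where
  "labels 0 = idb_rels \<Gamma> - {g}"
| "labels (Suc i) = labels i \<union> (\<lambda>(as, x). label i as x) ` queries (SE \<union> labels i)"

text \<open>A vertex carries the label \<open>label i as (Some x)\<close> if the query \<open>as\<close>, which may itself use
  labels of the levels up to \<open>i\<close>, has a match sending its variable \<open>x\<close> to that vertex.\<close>

fun labelled :: "nat \<Rightarrow> fact set \<Rightarrow> fact set" where
  "labelled 0 I = I \<union> {f \<in> least_model \<Gamma> I. fst f \<in> labels 0}"
| "labelled (Suc i) I = labelled i I \<union> {(label i as x, map h (opt_list x)) | as x h.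
     (as, x) \<in> queries (SE \<union> labels i) \<and> hom h (set as) (labelled i I)}"

text \<open>Soundness over all instances under the intended meaning of the labels; goal facts are
  tested against the least model of \<open>\<Gamma>\<close>.\<close>

definition valid :: "nat \<Rightarrow> atom \<Rightarrow> atom list \<Rightarrow> bool" where
  "valid m a body \<longleftrightarrow> (\<forall>I h. instance_over SE I \<longrightarrow> hom h (set body) (labelled m I) \<longrightarrow>
     (fst a, map h (snd a)) \<in> labelled m I \<union> {f \<in> least_model \<Gamma> I. fst f = g})"

definition program :: "nat \<Rightarrow> rule set" where
  "program m = {([a], body) | a body. body \<noteq> [] \<and> distinct body \<and>
     set body \<subseteq> atoms_over (SE \<union> labels m) k \<and> a \<in> atoms_over (insert g (labels m)) k \<and>
     set (snd a) \<subseteq> (\<Union>b\<in>set body. set (snd b)) \<and> valid m a body}"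

lemma mddlog_\<Gamma>: "mddlog_program SE g \<Gamma>"
  using \<Gamma> by (simp add: mdlog_program_def)

lemma g_props: "snd g = 0" "g \<notin> SE"
  using mddlog_\<Gamma> by (simp_all add: mddlog_program_def)

lemma label_fresh: "label i as x \<notin> insert g (SE \<union> idb_rels \<Gamma>)"
  using base[of "label i as x"] by (auto simp: label_def)

lemma label_inj: "label i as x = label j bs y \<longleftrightarrow> i = j \<and> as = bs \<and> x = y"
  by (auto simp: label_def)

lemma label_notin_labels: "j \<le> i \<Longrightarrow> label i as x \<notin> labels j"
proof (induction j)
  case 0
  then show ?case using label_fresh by auto
next
  case (Suc j)
  then show ?case by (auto simp: label_inj)
qed

lemma labels_fresh: "labels i \<inter> insert g SE = {}"
proof (induction i)
  case 0
  then show ?case using idb_rels_not_edb[OF mddlog_\<Gamma>] by auto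
next
  case (Suc i)
  then show ?case using label_fresh by auto
qed

lemma labels_mono: "i \<le> j \<Longrightarrow> labels i \<subseteq> labels j"
  by (rule lift_Suc_mono_le) auto

lemma finite_queries: "finite Rs \<Longrightarrow> finite (queries Rs)"
proof -
  assume "finite Rs"
  then have "finite ({as. set as \<subseteq> atoms_over Rs k \<and> distinct as} \<times> ({None} \<union> Some ` {..<k}))"
    using finite_subset_distinct finite_atoms_over by blast
  moreover have "queries Rs \<subseteq> {as. set as \<subseteq> atoms_over Rs k \<and> distinct as} \<times> ({None} \<union> Some ` {..<k})"
  proof
    fix p assume "p \<in> queries Rs"
    then show "p \<in> {as. set as \<subseteq> atoms_over Rs k \<and> distinct as} \<times> ({None} \<union> Some ` {..<k})"
      by (cases "snd p") (auto simp: queries_def)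
  qed
  ultimately show ?thesis by (rule finite_subset[rotated])
qed

lemma finite_labels: "finite (labels i)"
proof (induction i)
  case 0
  have "finite \<Gamma>" using mddlog_\<Gamma> by (simp add: mddlog_program_def)
  then show ?case using finite_idb_rels by simp
next
  case (Suc i)
  then show ?case using finite_queries finite_SE by simp
qed

lemma labels_arity: "S \<in> labels i \<Longrightarrow> snd S \<le> 1"
proof (induction i)
  case 0
  then show ?case using idb_rels_arity[OF mddlog_\<Gamma>] by auto
next
  case (Suc i)
  have "snd (label i as x) \<le> 1" for as x by (cases x) (simp_all add: label_def)
  then show ?case using Suc by auto
qed

lemma labelled_mono: "i \<le> j \<Longrightarrow> labelled i I \<subseteq> labelled j I"
  by (rule lift_Suc_mono_le[of "\<lambda>i. labelled i I"]) auto

lemma labelled_rels: "instance_over SE I \<Longrightarrow> f \<in> labelled i I \<Longrightarrow> fst f \<in> SE \<union> labels i"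
proof (induction i)
  case 0
  then show ?case by (auto simp: instance_over_def)
next
  case (Suc i)
  then show ?case by fastforce
qed

text \<open>A label determines its level, so higher levels never create facts with labels of lower
  ones.\<close>

lemma labelled_restrict:
  assumes "instance_over SE I" "f \<in> labelled m I" "fst f \<in> SE \<union> labels i" "i \<le> m"
  shows "f \<in> labelled i I"
  using assms(4,2,3)
proof (induction m rule: dec_induct)
  case (step m)
  have "fst f \<noteq> label m as x" for as x
    using step.prems(2) label_notin_labels[OF step.hyps(1), of as x] label_fresh[of m as x] by auto
  then have "f \<in> labelled m I" using step.prems(1) unfolding labelled.simps by fastforce
  then show ?case using step by blast
qed simp

lemma hom_restrict:
  assumes "instance_over SE I" "hom h A (labelled m I)" "\<And>f. f \<in> A \<Longrightarrow> fst f \<in> SE \<union> labels i" "i \<le> m"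
  shows "hom h A (labelled i I)"
  unfolding hom_def
proof
  fix f assume f: "f \<in> A"
  then have "(fst f, map h (snd f)) \<in> labelled m I" using assms(2) by (simp add: hom_def)
  then show "(fst f, map h (snd f)) \<in> labelled i I"
    by (rule labelled_restrict[OF assms(1) _ _ assms(4)]) (use assms(3) f in simp)
qed

text \<open>By freshness and injectivity such a fact can only stem from the query that the label
  names.\<close>

lemma label_match:
  assumes "instance_over SE I" "(label i as x, ys) \<in> labelled (Suc i) I"
  shows "\<exists>h. hom h (set as) (labelled i I) \<and> ys = map h (opt_list x)"
proof -
  have "(label i as x, ys) \<notin> labelled i I"
    using labelled_rels[OF assms(1), of "(label i as x, ys)" i] label_notin_labels[of i i as x]
      label_fresh[of i as x] by auto
  then obtain bs y h where "label i as x = label i bs y" "ys = map h (opt_list y)"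
    "hom h (set bs) (labelled i I)" using assms(2) by auto
  then show ?thesis by (auto simp: label_inj)
qed

section \<open>Soundness and syntactic shape of the new program\<close>

lemma program_sound:
  assumes I: "instance_over SE I" and ent: "entails I g (program m)"
  shows "entails I g \<Gamma>"
proof -
  define J where "J = labelled m I \<union> {f \<in> least_model \<Gamma> I. fst f = g}"
  have "is_model (program m) J"
    unfolding is_model_iff
  proof (intro ballI allI impI)
    fix r h assume "r \<in> program m" and h: "hom h (set (snd r)) J"
    then obtain a body where r: "r = ([a], body)" "set body \<subseteq> atoms_over (SE \<union> labels m) k" "valid m a body"
      unfolding program_def by blast
    have "hom h (set body) (labelled m I)"
      unfolding hom_def
    proof
      fix b assume b: "b \<in> set body"
      then have "fst b \<in> SE \<union> labels m" using r(2) by (auto simp: atoms_over_def)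
      then have "fst b \<noteq> g" using labels_fresh[of m] g_props by auto
      then show "(fst b, map h (snd b)) \<in> labelled m I"
        using h b r(1) by (auto simp: hom_def J_def)
    qed
    then show "\<exists>a\<in>set (fst r). (fst a, map h (snd a)) \<in> J"
      using r I by (simp add: valid_def J_def)
  qed
  moreover have "I \<subseteq> J" using labelled_mono[of 0 m I] by (auto simp: J_def)
  ultimately have "(g, []) \<in> J" using ent by (simp add: entails_def)
  moreover have "(g, []) \<notin> labelled m I"
    using labelled_rels[OF I, of "(g, [])" m] labels_fresh[of m] g_props by auto
  ultimately show ?thesis by (simp add: J_def entails_iff_least_model)
qed

text \<open>Tautological rules let every label occur in a head, so that labels count as IDB
  relations, and one such rule attains the diameter \<open>k\<close>.\<close>

lemma program_self:
  assumes "a \<in> atoms_over (labels m) k" "distinct body" "set body \<subseteq> atoms_over (SE \<union> labels m) k" "a \<in> set body"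
  shows "([a], body) \<in> program m"
proof -
  have "valid m a body" using assms(4) by (auto simp: valid_def hom_def)
  moreover have "a \<in> atoms_over (insert g (labels m)) k" using assms(1) by (auto simp: atoms_over_def)
  ultimately show ?thesis unfolding program_def using assms by fastforce
qed

lemma finite_program: "finite (program m)"
proof -
  have fin: "finite (atoms_over (SE \<union> labels m) k)" "finite (atoms_over (insert g (labels m)) k)"
    using finite_SE finite_labels finite_atoms_over by simp_all
  then have "finite ((\<lambda>a. [a]) ` atoms_over (insert g (labels m)) k \<times>
      {body. set body \<subseteq> atoms_over (SE \<union> labels m) k \<and> distinct body})"
    using finite_subset_distinct by blast
  moreover have "program m \<subseteq> (\<lambda>a. [a]) ` atoms_over (insert g (labels m)) k \<times>
      {body. set body \<subseteq> atoms_over (SE \<union> labels m) k \<and> distinct body}"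
    by (auto simp: program_def)
  ultimately show ?thesis by (rule finite_subset[rotated])
qed

lemma mdlog_program: "mdlog_program SE g (program m)"
  unfolding mdlog_program_def mddlog_program_def
proof (intro conjI ballI)
  show "finite (program m)" by (rule finite_program)
  show "snd g = 0" "g \<notin> SE" by (rule g_props)+
  fix r assume "r \<in> program m"
  then obtain a body where r: "r = ([a], body)" "body \<noteq> []" "distinct body"
     "set body \<subseteq> atoms_over (SE \<union> labels m) k" "a \<in> atoms_over (insert g (labels m)) k"
     "set (snd a) \<subseteq> (\<Union>b\<in>set body. set (snd b))" unfolding program_def by blast
  have a: "fst a \<in> insert g (labels m)" "length (snd a) = snd (fst a)"
    using r(5) by (auto simp: atoms_over_def)
  have bd: "fst b \<in> SE \<union> labels m" "length (snd b) = snd (fst b)" if "b \<in> set body" for b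
    using r(4) that by (auto simp: atoms_over_def)
  show "length (fst r) = 1" "snd r \<noteq> []" using r by simp_all
  show "length (snd b) = snd (fst b)" if "b \<in> set (fst r) \<union> set (snd r)" for b
  proof (cases "b \<in> set body")
    case False
    then have "b = a" using that r(1) by simp
    then show ?thesis using a(2) by simp
  qed (rule bd(2))
  show "(\<Union>a\<in>set (fst r). set (snd a)) \<subseteq> (\<Union>a\<in>set (snd r). set (snd a))" using r by simp
  show "fst b \<noteq> g" if "b \<in> set (snd r)" for b
    using bd[of b] that r(1) labels_fresh[of m] g_props by auto
  show "fst b = g \<longrightarrow> fst r = [(g, [])]" if "b \<in> set (fst r)" for b
  proof
    assume "fst b = g"
    moreover have "b = a" using that r(1) by simp
    ultimately have "a = (g, [])" using a(2) g_props(1) by (cases a) auto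
    then show "fst r = [(g, [])]" using r(1) by simp
  qed
  show "fst b \<noteq> g \<longrightarrow> fst b \<notin> SE \<and> snd (fst b) \<le> 1" if "b \<in> set (fst r)" for b
    using that r(1) a(1) labels_fresh[of m] labels_arity[of "fst b" m] by auto
  show "fst b \<notin> idb_rels (program m) \<longrightarrow> fst b \<in> SE" if b: "b \<in> set (snd r)" for b
  proof (cases "fst b \<in> labels m")
    case True
    have "b \<in> atoms_over (SE \<union> labels m) k" using r(1,4) b by auto
    then have "([b], [b]) \<in> program m" using True by (intro program_self) (auto simp: atoms_over_def)
    then show ?thesis using idb_relsI[of "([b], [b])" "program m" b] by simp
  qed (use bd(1)[of b] b r(1) in auto)
qed

lemma program_diameter:
  assumes "1 \<le> m" shows "diameter (program m) = k"
proof -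
  have vars: "rule_vars r \<subseteq> {..<k}" if "r \<in> program m" for r
  proof -
    obtain a body where "r = ([a], body)" "insert a (set body) \<subseteq> atoms_over UNIV k"
      using \<open>r \<in> program m\<close> unfolding program_def atoms_over_def by blast
    then show ?thesis unfolding rule_vars_def atoms_over_def by fastforce
  qed
  have le: "card (rule_vars r) \<le> k" if "r \<in> program m" for r
    using card_mono[OF _ vars[OF that]] by simp
  have "diameter (program m) \<le> k"
    unfolding diameter_def
  proof (rule Max.boundedI)
    show "finite ({card (rule_vars r) | r. r \<in> program m} \<union> {0})"
      using finite_program
      by (simp only: setcompr_eq_image Collect_mem_eq finite_imageI finite_Un finite.intros)
    show "{card (rule_vars r) | r. r \<in> program m} \<union> {0} \<noteq> {}" by simp
    show "x \<le> k" if "x \<in> {card (rule_vars r) | r. r \<in> program m} \<union> {0}" for x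
      using that le by auto
  qed
  moreover have "k \<le> diameter (program m)"
  proof (cases "k = 0")
    case False
    \<comment> \<open>The empty query provides a unary label even if \<open>\<Gamma>\<close> has no
      unary IDB relation. It appears at level 1, hence \<open>1 \<le> m\<close>.\<close>
    define u where "u = label 0 [] (Some 0)"
    have "([], Some 0) \<in> queries (SE \<union> labels 0)" using False by (simp add: queries_def)
    then have "u \<in> labels (Suc 0)" by (force simp: u_def)
    then have u: "u \<in> labels m" using labels_mono[of "Suc 0" m] assms by auto
    have "snd u = 1" by (simp add: u_def label_def)
    let ?body = "map (\<lambda>x. (u, [x])) [0..<k]"
    have "([(u, [0])], ?body) \<in> program m"
    proof (rule program_self)
      show "(u, [0]) \<in> atoms_over (labels m) k" using u \<open>snd u = 1\<close> False by (simp add: atoms_over_def)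
      show "distinct ?body" by (simp add: distinct_map inj_on_def)
      show "set ?body \<subseteq> atoms_over (SE \<union> labels m) k" using u \<open>snd u = 1\<close> by (auto simp: atoms_over_def)
      show "(u, [0]) \<in> set ?body" using False by auto
    qed
    from diameter_ge[OF finite_program this]
    have "card (rule_vars ([(u, [0])], ?body)) \<le> diameter (program m)" .
    moreover have "rule_vars ([(u, [0])], ?body) = {..<k}" using False by (auto simp: rule_vars_def)
    ultimately show ?thesis by simp
  qed simp
  ultimately show ?thesis by simp
qed

end

section \<open>Completeness of the new program over sparse instances\<close>

text \<open>\<open>J\<close> is a model of the program over the sparse instance \<open>I\<close>; \<open>known i\<close> consists of \<open>I\<close> and the
  labels of the levels up to \<open>i\<close> that hold in \<open>J\<close>.\<close>

locale sparse_model = labelling +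
  fixes m :: nat and I :: "fact set" and B :: "nat set set" and J :: "fact set"
  assumes I: "instance_over SE I" and cover: "sparse_cover (Suc m) k I B"
    and J: "I \<subseteq> J" "is_model (program m) J"
begin

definition known :: "nat \<Rightarrow> fact set" where
  "known i = I \<union> {f \<in> J. fst f \<in> labels i \<and> length (snd f) = snd (fst f) \<and> set (snd f) \<subseteq> \<Union>B}"

definition known_in :: "nat \<Rightarrow> nat set set \<Rightarrow> fact set" where
  "known_in i F = {f \<in> known i. \<exists>e\<in>F. set (snd f) \<subseteq> e}"

lemma known_atom:
  assumes "f \<in> known i" shows "fst f \<in> SE \<union> labels i" "length (snd f) = snd (fst f)" "f \<in> J"
  using assms I J(1) by (auto simp: known_def instance_over_def)

lemma known_Suc: "known i \<subseteq> known (Suc i)"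
  by (auto simp: known_def)

lemma block_index:
  assumes "e \<in> B"
  shows "\<exists>idx. inj_on idx e \<and> idx ` e \<subseteq> {..<k}"
proof -
  have e: "finite e" "card e \<le> k" using cover assms by (auto simp: sparse_cover_def)
  obtain idx where "bij_betw idx e {0..<card e}" using ex_bij_betw_finite_nat[OF e(1)] by blast
  then have "inj_on idx e" "idx ` e \<subseteq> {..<k}" using e(2) by (auto simp: bij_betw_def)
  then show ?thesis by blast
qed

text \<open>All that is known about a block fits into one query, as a block has at most
  \<open>k\<close> vertices.\<close>

lemma block_query:
  assumes "idx ` e \<subseteq> {..<k}"
  shows "\<exists>as. distinct as \<and> set as = rename idx (known_in i {e}) \<and> set as \<subseteq> atoms_over (SE \<union> labels i) k"
proof -
  have sub: "rename idx (known_in i {e}) \<subseteq> atoms_over (SE \<union> labels i) k"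
  proof
    fix b assume "b \<in> rename idx (known_in i {e})"
    then obtain f where f: "f \<in> known i" "set (snd f) \<subseteq> e" "b = (fst f, map idx (snd f))"
      by (auto simp: rename_def known_in_def)
    have "set (map idx (snd f)) \<subseteq> {..<k}" using f(2) assms by auto
    then show "b \<in> atoms_over (SE \<union> labels i) k"
      using known_atom(1,2)[OF f(1)] f(3) by (simp add: atoms_over_def)
  qed
  then have "finite (rename idx (known_in i {e}))"
    using finite_atoms_over finite_SE finite_labels finite_subset by (meson finite_UnI)
  then show ?thesis using finite_distinct_list sub by metis
qed

lemma fire:
  assumes rule: "([a], as) \<in> program m" "set as = rename idx A" and A: "A \<subseteq> J" "inj_on idx (adom A)"
    and a: "snd a = map idx xs" "set xs \<subseteq> adom A"
  shows "(fst a, xs) \<in> J"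
proof -
  let ?l = "inv_into (adom A) idx"
  have "hom ?l (set as) J" unfolding rule(2) by (rule hom_subset[OF rename_inverse[OF A(2)]]) (use A(1) in auto)
  then have "(fst a, map ?l (snd a)) \<in> J" using J(2) rule(1) unfolding is_model_iff by fastforce
  moreover have "map ?l (snd a) = xs"
    unfolding a(1) using a(2) A(2) by (auto intro!: map_idI simp: inv_into_f_f)
  ultimately show ?thesis by simp
qed

text \<open>What is known at level \<open>i\<close> about \<open>f\<close> is summarized by one
  label of level \<open>Suc i\<close> at the vertex shared with \<open>F\<close>. The label is
  derived in \<open>J\<close>, transported to \<open>K\<close> by \<open>\<gamma>\<close>, and
  unfolds there into a match for \<open>f\<close> that agrees with \<open>\<gamma>\<close>.\<close>

lemma extend_block:
  assumes i: "i < m" and f: "f \<in> B" and F: "F \<subseteq> B" "F \<noteq> {}" "at_most_one (f \<inter> \<Union>F)"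
    and K: "instance_over SE K" and g: "hom \<gamma> (known_in (Suc i) F) (labelled (Suc i) K)"
  shows "\<exists>\<gamma>'. hom \<gamma>' (known_in i (insert f F)) (labelled i K) \<and> (\<forall>v\<in>\<Union>F. \<gamma>' v = \<gamma> v)"
proof -
  let ?A = "known_in i {f}"
  have Af: "adom ?A \<subseteq> f" by (auto simp: known_in_def adom_def)
  obtain idx where idx: "inj_on idx f" "idx ` f \<subseteq> {..<k}" using block_index[OF f] by blast
  have injA: "inj_on idx (adom ?A)" using idx(1) Af inj_on_subset by blast
  obtain as where as: "distinct as" "set as = rename idx ?A" "set as \<subseteq> atoms_over (SE \<union> labels i) k"
    using block_query[OF idx(2)] by metis
  have AJ: "?A \<subseteq> J" using known_atom(3) by (auto simp: known_in_def)
  \<comment> \<open>Only a shared vertex occurring in a known fact of \<open>f\<close> is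
    constrained; this also puts the head variable of the new rule into its body.\<close>
  have "\<exists>h. hom h (set as) (labelled i K) \<and> (\<forall>v\<in>adom ?A \<inter> \<Union>F. h (idx v) = \<gamma> v)"
  proof (cases "as = []")
    case True
    then have "?A = {}" using as(2) by (simp add: rename_def)
    then show ?thesis using True by (simp add: hom_def adom_def)
  next
    case False
    have "\<exists>zs x. length zs \<le> 1 \<and> map idx zs = opt_list x \<and> set zs = adom ?A \<inter> \<Union>F"
    proof (cases "adom ?A \<inter> \<Union>F = {}")
      case True
      then show ?thesis by (intro exI[of _ "[]"] exI[of _ None]) simp
    next
      case False
      then obtain z where z: "z \<in> adom ?A \<inter> \<Union>F" by blast
      have one: "at_most_one (adom ?A \<inter> \<Union>F)" by (rule at_most_one_subset[OF F(3)]) (use Af in auto)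
      have "adom ?A \<inter> \<Union>F = {z}"
      proof
        show "adom ?A \<inter> \<Union>F \<subseteq> {z}"
        proof
          fix w assume "w \<in> adom ?A \<inter> \<Union>F"
          then have "w = z" using one z unfolding at_most_one_def by metis
          then show "w \<in> {z}" by simp
        qed
      qed (use z in simp)
      then have "length [z] \<le> 1 \<and> map idx [z] = opt_list (Some (idx z)) \<and> set [z] = adom ?A \<inter> \<Union>F"
        by simp
      then show ?thesis by (intro exI)
    qed
    then obtain zs x where zs: "map idx zs = opt_list x" "set zs = adom ?A \<inter> \<Union>F" "length zs \<le> 1"
      by (elim exE conjE)
    let ?L = "label i as x"
    have "set (opt_list x) \<subseteq> {..<k}" using zs(1,2) Af idx(2) by (metis Int_subset_iff image_mono image_set order_trans subset_refl)
    then have q: "(as, x) \<in> queries (SE \<union> labels i)" using as(1,3) by (simp add: queries_def)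
    then have L: "?L \<in> labels (Suc i)" by force
    have Lm: "?L \<in> labels m" using L labels_mono[of "Suc i" m] i by auto
    have valid: "valid m (?L, opt_list x) as"
      unfolding valid_def
    proof (intro allI impI)
      fix K' h assume K': "instance_over SE K'" "hom h (set as) (labelled m K')"
      have "hom h (set as) (labelled i K')"
        by (rule hom_restrict[OF K']) (use as(3) i in \<open>auto simp: atoms_over_def\<close>)
      then have "(?L, map h (opt_list x)) \<in> labelled (Suc i) K'" using q by auto
      then show "(fst (?L, opt_list x), map h (snd (?L, opt_list x))) \<in>
          labelled m K' \<union> {f \<in> least_model \<Gamma> K'. fst f = g}"
        unfolding fst_conv snd_conv using labelled_mono[of "Suc i" m K'] i by (meson UnI1 Suc_leI subsetD)
    qed
    have rule: "([(?L, opt_list x)], as) \<in> program m"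
      unfolding program_def
    proof (intro CollectI exI conjI)
      show "([(?L, opt_list x)], as) = ([(?L, opt_list x)], as)" by simp
      show "as \<noteq> []" "distinct as" using False as by simp_all
      show "set as \<subseteq> atoms_over (SE \<union> labels m) k"
        using as(3) labels_mono[of i m] i by (auto simp: atoms_over_def)
      show "(?L, opt_list x) \<in> atoms_over (insert g (labels m)) k"
        using Lm \<open>set (opt_list x) \<subseteq> {..<k}\<close> by (simp add: atoms_over_def label_def)
      have "adom (set as) = idx ` adom ?A" unfolding as(2) by (rule adom_rename)
      moreover have "set (opt_list x) = idx ` set zs" unfolding zs(1)[symmetric] by simp
      then have "set (snd (?L, opt_list x)) \<subseteq> idx ` adom ?A" using zs(2) by auto
      ultimately show "set (snd (?L, opt_list x)) \<subseteq> (\<Union>b\<in>set as. set (snd b))"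
        unfolding adom_def by (simp only:)
      show "valid m (?L, opt_list x) as" by (rule valid)
    qed
    have "(?L, zs) \<in> J"
      using fire[OF rule as(2) AJ injA, of zs] zs(1,2) by simp
    moreover have "length zs = snd ?L" using zs(1) by (metis label_def length_map snd_conv)
    moreover have "set zs \<subseteq> \<Union>B" using zs(2) F(1) by blast
    ultimately have "(?L, zs) \<in> known (Suc i)" using L by (simp add: known_def)
    moreover have "\<exists>e\<in>F. set zs \<subseteq> e"
    proof (cases zs)
      case Nil
      then show ?thesis using F(2) by auto
    next
      case (Cons z zs')
      then have "zs' = []" using zs(3) by simp
      then have eq: "set zs = {z}" using Cons by simp
      then have "z \<in> \<Union>F" using zs(2) by blast
      then show ?thesis using eq by auto
    qed
    ultimately have "(?L, zs) \<in> known_in (Suc i) F" by (simp add: known_in_def)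
    then have "(?L, map \<gamma> zs) \<in> labelled (Suc i) K" by (rule homD[OF g])
    then obtain h where h: "hom h (set as) (labelled i K)" "map \<gamma> zs = map h (opt_list x)"
      using label_match[OF K] by blast
    have "h (idx v) = \<gamma> v" if "v \<in> set zs" for v
    proof -
      have "map \<gamma> zs = map (h \<circ> idx) zs" using h(2) zs(1)[symmetric] by simp
      then show ?thesis using that by (simp add: list_eq_iff_nth_eq in_set_conv_nth) metis
    qed
    then show ?thesis using h(1) zs(2) by blast
  qed
  then obtain h where h: "hom h (set as) (labelled i K)" "\<forall>v\<in>adom ?A \<inter> \<Union>F. h (idx v) = \<gamma> v" by blast
  define \<gamma>' where "\<gamma>' = (\<lambda>v. if v \<in> \<Union>F then \<gamma> v else h (idx v))"
  have "hom \<gamma>' (known_in i (insert f F)) (labelled i K)"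
    unfolding hom_def
  proof
    fix a assume a: "a \<in> known_in i (insert f F)"
    show "(fst a, map \<gamma>' (snd a)) \<in> labelled i K"
    proof (cases "a \<in> known_in i F")
      case True
      have "hom \<gamma> (known_in i F) (labelled i K)"
      proof (rule hom_restrict[OF K _ _ le_SucI[OF order_refl]])
        show "hom \<gamma> (known_in i F) (labelled (Suc i) K)"
          by (rule hom_subset[OF g]) (use known_Suc[of i] in \<open>auto simp: known_in_def\<close>)
        show "fst b \<in> SE \<union> labels i" if "b \<in> known_in i F" for b
          using known_atom(1) that by (simp add: known_in_def)
      qed
      then have "hom \<gamma>' (known_in i F) (labelled i K)"
        by (rule hom_cong) (auto simp: known_in_def \<gamma>'_def)
      then show ?thesis using True by (simp add: hom_def)
    next
      case False
      then have aA: "a \<in> ?A" using a by (auto simp: known_in_def)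
      have "hom (h \<circ> idx) ?A (labelled i K)"
        by (rule hom_comp[OF hom_rename h(1)[unfolded as(2)]])
      then have "hom \<gamma>' ?A (labelled i K)"
      proof (rule hom_cong)
        fix b v assume "b \<in> ?A" "v \<in> set (snd b)"
        then have "v \<in> adom ?A" unfolding adom_def by blast
        then show "\<gamma>' v = (h \<circ> idx) v" using h(2) by (simp add: \<gamma>'_def)
      qed
      then show ?thesis using aA by (simp add: hom_def)
    qed
  qed
  then show ?thesis by (intro exI[of _ \<gamma>']) (simp add: \<gamma>'_def)
qed

text \<open>The match spreads from the root in the order of growth and loses one level per block,
  hence the level \<open>i + card F - 1\<close> at the root.\<close>

lemma extend_forest:
  assumes "grows e F" "F \<subseteq> B" "i + card F \<le> Suc m" "instance_over SE K"
    "hom \<gamma> (known_in (i + card F - 1) {e}) (labelled (i + card F - 1) K)"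
  shows "\<exists>\<gamma>'. hom \<gamma>' (known_in i F) (labelled i K) \<and> (\<forall>v\<in>e. \<gamma>' v = \<gamma> v)"
  using assms
proof (induction arbitrary: i rule: grows.induct)
  case base
  then show ?case by auto
next
  case (step F f)
  have fin: "finite F" using grows_finite[OF step.hyps(1)] .
  have e: "e \<in> F" using grows_mem[OF step.hyps(1)] .
  then have pos: "0 < card F" using fin by (auto simp: card_gt_0_iff)
  have card: "card (insert f F) = Suc (card F)" using fin step.hyps(2) by simp
  have "\<exists>\<gamma>'. hom \<gamma>' (known_in (Suc i) F) (labelled (Suc i) K) \<and> (\<forall>v\<in>e. \<gamma>' v = \<gamma> v)"
    using step.prems card by (intro step.IH) auto
  then obtain \<gamma>1 where \<gamma>1: "hom \<gamma>1 (known_in (Suc i) F) (labelled (Suc i) K)" "\<forall>v\<in>e. \<gamma>1 v = \<gamma> v" by blast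
  have "\<exists>\<gamma>'. hom \<gamma>' (known_in i (insert f F)) (labelled i K) \<and> (\<forall>v\<in>\<Union>F. \<gamma>' v = \<gamma>1 v)"
  proof (rule extend_block)
    show "i < m" using step.prems(2) card pos by linarith
    show "f \<in> B" "F \<subseteq> B" "F \<noteq> {}" using step.prems e by auto
  qed (fact step.hyps(3) step.prems(3) \<gamma>1(1))+
  then show ?case using \<gamma>1(2) e by (metis UnionI)
qed

text \<open>The IDB facts of \<open>\<Gamma>\<close> in \<open>J\<close> form a model of
  \<open>\<Gamma>\<close> with \<open>I\<close>. For a match of a rule, take the rule that derives
  its head from all known facts of the block \<open>e\<close> around the head variable: it is valid
  because over any instance its matches extend to the whole forest.\<close>

lemma program_complete:
  assumes ent: "entails I g \<Gamma>" and len: "\<And>r. r \<in> \<Gamma> \<Longrightarrow> length (snd r) \<le> Suc m"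
  shows "(g, []) \<in> J"
proof -
  define N where "N = I \<union> {f \<in> J. fst f \<in> idb_rels \<Gamma> \<and> length (snd f) = snd (fst f) \<and> set (snd f) \<subseteq> \<Union>B}"
  have "is_model \<Gamma> N"
    unfolding is_model_iff
  proof (intro ballI allI impI)
    fix r \<sigma> assume r: "r \<in> \<Gamma>" and \<sigma>: "hom \<sigma> (set (snd r)) N"
    note wf = mddlog_rule[OF mddlog_\<Gamma> r]
    have "length (fst r) = 1" using \<Gamma> r by (simp add: mdlog_program_def)
    then obtain a where a: "fst r = [a]" by (cases "fst r") auto
    have aidb: "fst a \<in> idb_rels \<Gamma>" using idb_relsI[OF r] a by simp
    \<comment> \<open>Here monadicity enters: an IDB atom has at most one argument, so some block
      contains its image. Facts of \<open>I\<close> are covered anyway.\<close>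
    have "\<exists>e\<in>B. \<sigma> ` set (snd b) \<subseteq> e" if b: "b \<in> set (snd r)" for b
    proof -
      have "(fst b, map \<sigma> (snd b)) \<in> N" using \<sigma> b by (simp add: hom_def)
      then consider "(fst b, map \<sigma> (snd b)) \<in> I"
        | "fst b \<in> idb_rels \<Gamma>" "length (snd b) = snd (fst b)" "\<sigma> ` set (snd b) \<subseteq> \<Union>B" by (auto simp: N_def)
      then show ?thesis
      proof cases
        case 1
        then show ?thesis using cover unfolding sparse_cover_def by fastforce
      next
        case 2
        then have "length (snd b) \<le> 1" using idb_rels_arity[OF mddlog_\<Gamma>] by simp
        then consider "snd b = []" | x where "snd b = [x]" by (cases "snd b") auto
        then show ?thesis using 2(3) cover by cases (auto simp: sparse_cover_def)
      qed
    qed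
    then obtain c where c: "\<And>b. b \<in> set (snd r) \<Longrightarrow> c b \<in> B \<and> \<sigma> ` set (snd b) \<subseteq> c b" by metis
    have "length (snd a) \<le> 1" using wf(2,5)[of a] a by simp
    obtain b0 where b0: "b0 \<in> set (snd r)" "set (snd a) \<subseteq> set (snd b0)"
    proof (cases "snd a")
      case Nil
      then show ?thesis using that wf(1) by (metis empty_subsetI list.set(1) list.set_intros(1) neq_Nil_conv)
    next
      case (Cons x xs)
      then have x: "snd a = [x]" using \<open>length (snd a) \<le> 1\<close> by simp
      then obtain b where "b \<in> set (snd r)" "x \<in> set (snd b)" using wf(3) a by auto
      then show ?thesis using that x by simp
    qed
    define F where "F = c ` set (snd r)"
    define e where "e = c b0"
    have F: "F \<subseteq> B" "e \<in> F" "finite F" using c b0 by (auto simp: F_def e_def)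
    have cardF: "card F \<le> Suc m"
      using card_image_le[of "set (snd r)" c] card_length[of "snd r"] len[OF r] by (simp add: F_def)
    then have "grows e F" using cover F unfolding sparse_cover_def locally_forest_def forest_def by blast
    define j where "j = card F - 1"
    have j: "j \<le> m" using cardF by (simp add: j_def)
    let ?A = "known_in j {e}"
    have eB: "e \<in> B" using F by blast
    obtain idx where idx: "inj_on idx e" "idx ` e \<subseteq> {..<k}" using block_index[OF eB] by blast
    have Ae: "adom ?A \<subseteq> e" by (auto simp: known_in_def adom_def)
    have injA: "inj_on idx (adom ?A)" using idx(1) Ae inj_on_subset by blast
    obtain as where as: "distinct as" "set as = rename idx ?A" "set as \<subseteq> atoms_over (SE \<union> labels j) k"
      using block_query[OF idx(2)] by metis
    have match: "(fst b, map \<sigma> (snd b)) \<in> known_in i {c b}" if b: "b \<in> set (snd r)" for b i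
    proof -
      have "(fst b, map \<sigma> (snd b)) \<in> N" using \<sigma> b by (simp add: hom_def)
      moreover have "fst b \<noteq> g" using wf(4)[OF b] .
      ultimately have "(fst b, map \<sigma> (snd b)) \<in> known 0" by (auto simp: N_def known_def)
      moreover have "known 0 \<subseteq> known i" by (rule lift_Suc_mono_le[of known, OF known_Suc]) simp
      ultimately show ?thesis using c[OF b] by (auto simp: known_in_def)
    qed
    have \<sigma>b0: "\<sigma> ` set (snd b0) \<subseteq> adom ?A"
      using adom_fact[OF match[OF b0(1), of j]] by (simp add: e_def)
    then have xs: "set (map \<sigma> (snd a)) \<subseteq> adom ?A" using b0(2) by auto
    let ?a = "(fst a, map idx (map \<sigma> (snd a)))"
    have valid: "valid m ?a as"
      unfolding valid_def
    proof (intro allI impI)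
      fix K h assume K: "instance_over SE K" and "hom h (set as) (labelled m K)"
      then have "hom h (rename idx ?A) (labelled j K)"
        using as(3) j unfolding as(2)[symmetric]
        by (intro hom_restrict[of K h _ m j]) (auto simp: atoms_over_def)
      then have "hom (h \<circ> idx) ?A (labelled j K)" by (rule hom_comp[OF hom_rename])
      then have "\<exists>\<gamma>'. hom \<gamma>' (known_in 0 F) (labelled 0 K) \<and> (\<forall>v\<in>e. \<gamma>' v = (h \<circ> idx) v)"
        using cardF by (intro extend_forest[OF \<open>grows e F\<close> F(1) _ K]) (simp_all add: j_def del: o_apply)
      then obtain \<gamma> where \<gamma>: "hom \<gamma> (known_in 0 F) (labelled 0 K)" "\<forall>v\<in>e. \<gamma> v = h (idx v)" by auto
      have "labelled 0 K \<subseteq> least_model \<Gamma> K" using least_model_incl by auto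
      moreover have "hom \<sigma> (set (snd r)) (known_in 0 F)"
        unfolding hom_def
      proof
        fix b assume b: "b \<in> set (snd r)"
        show "(fst b, map \<sigma> (snd b)) \<in> known_in 0 F"
          using match[OF b, of 0] b unfolding known_in_def F_def by blast
      qed
      ultimately have "hom (\<gamma> \<circ> \<sigma>) (set (snd r)) (least_model \<Gamma> K)"
        using hom_comp \<gamma>(1) hom_subset by blast
      then have "(fst a, map (\<gamma> \<circ> \<sigma>) (snd a)) \<in> least_model \<Gamma> K"
        by (rule least_model_rule[OF r a])
      moreover have "map (\<gamma> \<circ> \<sigma>) (snd a) = map h (map idx (map \<sigma> (snd a)))"
        using xs Ae \<gamma>(2) by auto
      ultimately have "(fst a, map h (map idx (map \<sigma> (snd a)))) \<in> least_model \<Gamma> K" by simp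
      then show "(fst ?a, map h (snd ?a)) \<in> labelled m K \<union> {f \<in> least_model \<Gamma> K. fst f = g}"
        using labelled_mono[of 0 m K] aidb by auto
    qed
    have "([?a], as) \<in> program m"
      unfolding program_def
    proof (intro CollectI exI conjI)
      show "([?a], as) = ([?a], as)" by simp
      have "rename idx ?A \<noteq> {}" using match[OF b0(1), of j] by (auto simp: rename_def e_def)
      then show "as \<noteq> []" using as(2) by auto
      show "distinct as" by (rule as)
      show "set as \<subseteq> atoms_over (SE \<union> labels m) k"
        using as(3) labels_mono[OF j] by (auto simp: atoms_over_def)
      have "fst a \<in> insert g (labels m)" using aidb labels_mono[of 0 m] by auto
      moreover have "length (snd a) = snd (fst a)" using wf(2)[of a] a by simp
      moreover have "idx ` set (map \<sigma> (snd a)) \<subseteq> {..<k}" using xs Ae idx(2) by blast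
      ultimately show "?a \<in> atoms_over (insert g (labels m)) k"
        by (simp add: atoms_over_def image_image)
      have "set (snd ?a) \<subseteq> idx ` adom ?A" using xs by auto
      also have "\<dots> = adom (set as)" unfolding as(2) by (rule adom_rename[symmetric])
      finally show "set (snd ?a) \<subseteq> (\<Union>b\<in>set as. set (snd b))" unfolding adom_def .
      show "valid m ?a as" by (rule valid)
    qed
    moreover have "?A \<subseteq> J" using known_atom(3) by (auto simp: known_in_def)
    ultimately have "(fst a, map \<sigma> (snd a)) \<in> J"
      using fire[of ?a as idx ?A "map \<sigma> (snd a)"] as(2) injA xs by simp
    moreover have "set (map \<sigma> (snd a)) \<subseteq> \<Union>B" using xs Ae eB by blast
    moreover have "length (snd a) = snd (fst a)" using wf(2)[of a] a by simp
    ultimately have "(fst a, map \<sigma> (snd a)) \<in> N" using aidb by (simp add: N_def)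
    then show "\<exists>a\<in>set (fst r). (fst a, map \<sigma> (snd a)) \<in> N" using a by simp
  qed
  moreover have "I \<subseteq> N" by (simp add: N_def)
  ultimately have "(g, []) \<in> N" using ent unfolding entails_def by blast
  moreover have "(g, []) \<notin> I" using I g_props by (auto simp: instance_over_def)
  ultimately show ?thesis by (simp add: N_def)
qed

end

theorem mdlog_rewriting_of_diameter:
  assumes SE: "finite SE" and P: "mddlog_program SE g P" and md: "mdlog_rewritable SE g P"
  shows "\<exists>g' P'. mdlog_program SE g' P' \<and> diameter P' = diameter P \<and>
    is_rewriting SE g P (\<lambda>I. entails I g' P')"
proof -
  obtain g' \<Gamma> where rew: "mdlog_program SE g' \<Gamma>" "is_rewriting SE g P (\<lambda>I. entails I g' \<Gamma>)"
    using md by (auto simp: mdlog_rewritable_def)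
  have fin\<Gamma>: "finite \<Gamma>" using rew(1) by (simp add: mdlog_program_def mddlog_program_def)
  then have "finite (fst ` insert g' (SE \<union> idb_rels \<Gamma>))" using SE finite_idb_rels by simp
  then obtain base where base: "\<And>S. S \<in> insert g' (SE \<union> idb_rels \<Gamma>) \<Longrightarrow> fst S < base"
    by (metis finite_nat_set_iff_bounded image_eqI)
  have "finite ((length \<circ> snd) ` \<Gamma>)" using fin\<Gamma> by simp
  then obtain l where l: "\<And>r. r \<in> \<Gamma> \<Longrightarrow> length (snd r) < l"
    by (metis finite_nat_set_iff_bounded image_eqI comp_apply)
  \<comment> \<open>\<open>Suc m\<close> bounds the body lengths and hence the number of blocks of a
    match; the successor guarantees \<open>1 \<le> m\<close> for the diameter.\<close>
  define m where "m = Suc l"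
  interpret labelling SE g' \<Gamma> "diameter P" base
    by standard (use SE rew(1) base in auto)
  have "entails I g' (program m) \<longleftrightarrow> entails I g P" if I: "instance_over SE I" for I
  proof
    assume "entails I g' (program m)"
    then have "entails I g' \<Gamma>" by (rule program_sound[OF I])
    then show "entails I g P" using rew(2) I by (simp add: is_rewriting_def)
  next
    assume "entails I g P"
    then obtain I' B \<pi> where I': "instance_over SE I'" "hom \<pi> I' I" "entails I' g P"
      "sparse_cover (Suc m) (diameter P) I' B"
      using sparse_instance_exists[OF P order_refl I] by blast
    have "entails I' g' (program m)"
      unfolding entails_def
    proof (intro allI impI)
      fix J assume J: "I' \<subseteq> J \<and> is_model (program m) J"
      interpret sparse_model SE g' \<Gamma> "diameter P" base m I' B J
        by standard (use I' J in auto)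
      show "(g', []) \<in> J"
      proof (rule program_complete)
        show "entails I' g' \<Gamma>" using rew(2) I'(1,3) by (simp add: is_rewriting_def)
        show "length (snd r) \<le> Suc m" if "r \<in> \<Gamma>" for r using l[OF that] by (simp add: m_def)
      qed
    qed
    then show "entails I g' (program m)" using I'(2) by (rule entails_hom)
  qed
  then have "is_rewriting SE g P (\<lambda>I. entails I g' (program m))" by (simp add: is_rewriting_def)
  moreover have "diameter (program m) = diameter P" by (rule program_diameter) (simp add: m_def)
  ultimately show ?thesis using mdlog_program by blast
qed

theorem theorem5p1:
  fixes SE :: "rel set" and g :: rel and P :: "rule set" and k :: nat
  assumes "finite SE"
    and "mddlog_program SE g P"
    and "diameter P = k"
  shows "(fo_rewritable SE g P \<longrightarrow>
            (\<exists>Q. ucq_rewriting SE g P Q \<and> (\<forall>q \<in> Q. has_treewidth 1 k q)))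
       \<and> (mdlog_rewritable SE g P \<longrightarrow>
            (\<exists>g' P'. mdlog_program SE g' P' \<and> diameter P' = k \<and>
                     is_rewriting SE g P (\<lambda>I. entails I g' P')))"
  using ucq_rewriting_if_fo_rewritable[OF assms(1,2), of k] mdlog_rewriting_of_diameter[OF assms(1,2)]
    assms(3) by simp

end
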